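(* Let $$1\to K\xrightarrow{\ \iota\ }G\xrightarrow{\ q\ }Q\to 1$$ be a short exact sequence of groups and group homomorphisms. Let $A$ and $B$ be finite inverse-closed generating sets of $K$ and $Q$, respectively, and let $\widehat B\subseteq G$ be an inverse-closed subset of $G$ that $q$ maps bijectively onto $B$. Then: (1) if $K$ is autostackable over $A$ and $Q$ is autostackable over $B$, then $G$ is autostackable over the generating set $\iota(A)\cup\widehat B$; (2) if $K$ is stackable over $A$ and $Q$ is stackable over $B$, then $G$ is stackable over $\iota(A)\cup\widehat B$; (3) if $K$ is algorithmically stackable over $A$ and $Q$ is algorithmically stackable over $B$, then $G$ is algorithmically stackable over $\iota(A)\cup\widehat B$.
   Context: Conventions. All generating sets are finite and inverse-closed; no element of a generating set represents the identity, and distinct elements represent distinct group elements. $A^*$ is the set of all finite words over $A$; for $a\in A$, $a^{-1}$ denotes the letter of $A$ representing the inverse of $a$. Flow functions. Let $G$ be a group with finite inverse-closed generating set $A$ and Cayley graph $\Gamma=\Gamma(G,A)$. Let $\vec E$ be the set of directed edges and $\vec P$ the set of directed edge paths of $\Gamma$. For $g\in G$, $a\in A$, $e_{g,a}$ is the directed edge from $g$ to $ga$ labeled $a$; the directed edges $e_{g,a}$ and $e_{ga,a^{-1}}$ have the same underlying undirected edge. A flow function associated to a maximal tree $\mathcal T$ in $\Gamma$ is a function $\Phi:\vec E\to\vec P$ such that: (F1) for each $e\in\vec E$, the path $\Phi(e)$ has the same initial and terminal vertices as $e$; (F2d) if the undirected edge underlying $e$ lies in $\mathcal T$, then $\Phi(e)=e$;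 (F2r) the transitive closure $<_\Phi$ of the relation $<$ on $\vec E$, defined by $e'<e$ whenever $e'$ lies on the path $\Phi(e)$ and the undirected edges underlying both $e$ and $e'$ do not lie in $\mathcal T$, is a well-founded strict partial ordering. $\Phi$ is bounded if there is a constant $k$ such that for all $e\in\vec E$ the path $\Phi(e)$ has length at most $k$. Stacking map. For $g\in G$ let $y_g\in A^*$ be the label of the unique path without backtracking in $\mathcal T$ from the identity to $g$, and let $\mathcal N=\{y_g\mid g\in G\}$. The stacking map of $\Phi$ is $\phi:\mathcal N\times A\to A^*$, where $\phi(y_g,a)$ is the word labeling the path $\Phi(e_{g,a})$. Its graph is $graph(\phi)=\{(y_g,a,\phi(y_g,a))\mid g\in G,\ a\in A\}\subseteq (A^* )^3$. Definitions. $G$ is stackable over $A$ if there is a bounded flow function on a maximal tree in $\Gamma(G,A)$. $G$ is algorithmically stackable over $A$ if it has a bounded flow function for which $graph(\phi)$ is computable (a decidable set). $G$ is autostackable over $A$ if it has a bounded flow function for which $graph(\phi)$ is synchronously regular. Synchronously regular languages. Let $\$\notin A$ and let $A_n=(A\cup\{\$\})^n\setminus\{(\$,\dots,\$)\}$. For $u=(u_1,\dots,u_n)\in(A^* )^n$, append symbols $\$$ at the end of each $u_i$ to make all components have length $M=\max_i \ell(u_i)$, and let $\mu(u)\in A_n^*$ be the word of length $M$ whose $m$-th letter is the $n$-tuple of $m$-th letters of the padded components. A subset $L\subseteq(A^* )^n$ is synchronously regular if $\{\mu(u)\mid u\in L\}$ is a regular language over $A_n$. *)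

theory Defs
  imports
    "HOL-Algebra.Algebra"
    "HOL-Library.Nat_Bijection"
    "Graph_Theory.Arc_Walk"
begin

section \<open>Generating sets and Cayley graphs\<close>

text \<open>
  Letters are the group elements they represent, so distinct letters automatically represent
  distinct elements, and a word over \<open>A\<close> is an element of \<open>lists A\<close>.
\<close>

definition generating_set :: "('a, 'b) monoid_scheme \<Rightarrow> 'a set \<Rightarrow> bool" where
  "generating_set G A \<longleftrightarrow>
     finite A \<and> A \<subseteq> carrier G \<and> (\<forall>a\<in>A. inv\<^bsub>G\<^esub> a \<in> A) \<and> \<one>\<^bsub>G\<^esub> \<notin> A \<and>
     generate G A = carrier G"

text \<open>
  The pair \<open>(g, a)\<close> is the directed edge $e_{g,a}$. A directed edge path is an arc walk
  in the sense of \<open>pre_digraph.awalk\<close>, that is, a list of directed edges.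
\<close>

definition cayley_graph :: "('a, 'b) monoid_scheme \<Rightarrow> 'a set \<Rightarrow> ('a, 'a \<times> 'a) pre_digraph" where
  "cayley_graph G A =
     \<lparr>verts = carrier G, arcs = carrier G \<times> A, tail = fst, head = (\<lambda>(g, a). g \<otimes>\<^bsub>G\<^esub> a)\<rparr>"

definition rev_edge :: "('a, 'b) monoid_scheme \<Rightarrow> 'a \<times> 'a \<Rightarrow> 'a \<times> 'a" where
  "rev_edge G = (\<lambda>(g, a). (g \<otimes>\<^bsub>G\<^esub> a, inv\<^bsub>G\<^esub> a))"

text \<open>An undirected edge is the set of the two directed edges lying over it.\<close>

definition undirected :: "('a, 'b) monoid_scheme \<Rightarrow> 'a \<times> 'a \<Rightarrow> ('a \<times> 'a) set" where
  "undirected G e = {e, rev_edge G e}"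

definition path_label :: "('a \<times> 'a) list \<Rightarrow> 'a list" where
  "path_label p = map snd p"

section \<open>Maximal trees and normal forms\<close>

text \<open>
  A set \<open>T\<close> of undirected edges is identified with the subgraph of the Cayley graph that has
  all vertices and exactly the edges in \<open>T\<close>.
\<close>

definition edge_subgraph ::
  "('a, 'b) monoid_scheme \<Rightarrow> 'a set \<Rightarrow> ('a \<times> 'a) set set \<Rightarrow> ('a, 'a \<times> 'a) pre_digraph" where
  "edge_subgraph G A T =
     (cayley_graph G A)\<lparr>arcs := {e \<in> arcs (cayley_graph G A). undirected G e \<in> T}\<rparr>"

text \<open>
  A maximal tree is a subtree (a connected subgraph without cycles) that contains all vertices.
  An edge followed by its reverse is a directed cycle of length 2 in the sense of
  \<open>pre_digraph.cycle\<close>; since Cayley graphs here have neither loops nor multiple edges, the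
  cycles of the undirected graph are exactly those of length at least 3.
\<close>

definition maximal_tree :: "('a, 'b) monoid_scheme \<Rightarrow> 'a set \<Rightarrow> ('a \<times> 'a) set set \<Rightarrow> bool" where
  "maximal_tree G A T \<longleftrightarrow>
     T \<subseteq> undirected G ` arcs (cayley_graph G A) \<and>
     (\<forall>g\<in>carrier G. \<forall>h\<in>carrier G. \<exists>p. pre_digraph.awalk (edge_subgraph G A T) g p h) \<and>
     \<not> (\<exists>p. pre_digraph.cycle (edge_subgraph G A T) p \<and> 3 \<le> length p)"

definition no_backtracking :: "('a, 'b) monoid_scheme \<Rightarrow> ('a \<times> 'a) list \<Rightarrow> bool" where
  "no_backtracking G p \<longleftrightarrow> (\<forall>i. Suc i < length p \<longrightarrow> p ! Suc i \<noteq> rev_edge G (p ! i))"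

definition normal_form ::
  "('a, 'b) monoid_scheme \<Rightarrow> 'a set \<Rightarrow> ('a \<times> 'a) set set \<Rightarrow> 'a \<Rightarrow> 'a list" where
  "normal_form G A T g =
     path_label (THE p. pre_digraph.awalk (edge_subgraph G A T) \<one>\<^bsub>G\<^esub> p g \<and> no_backtracking G p)"

section \<open>Flow functions\<close>

text \<open>A pair \<open>(e', e)\<close> in \<open>flow_rel G A T \<Phi>\<close> means \<open>e' < e\<close>.\<close>

definition flow_rel ::
  "('a, 'b) monoid_scheme \<Rightarrow> 'a set \<Rightarrow> ('a \<times> 'a) set set \<Rightarrow> ('a \<times> 'a \<Rightarrow> ('a \<times> 'a) list)
   \<Rightarrow> (('a \<times> 'a) \<times> ('a \<times> 'a)) set" where
  "flow_rel G A T \<Phi> =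
     {(e', e). e' \<in> arcs (cayley_graph G A) \<and> e \<in> arcs (cayley_graph G A) \<and> e' \<in> set (\<Phi> e) \<and>
               undirected G e \<notin> T \<and> undirected G e' \<notin> T}"

definition flow_function ::
  "('a, 'b) monoid_scheme \<Rightarrow> 'a set \<Rightarrow> ('a \<times> 'a) set set \<Rightarrow> ('a \<times> 'a \<Rightarrow> ('a \<times> 'a) list) \<Rightarrow> bool" where
  "flow_function G A T \<Phi> \<longleftrightarrow>
     maximal_tree G A T \<and>
     (\<forall>e\<in>arcs (cayley_graph G A).
        pre_digraph.awalk (cayley_graph G A)
          (tail (cayley_graph G A) e) (\<Phi> e) (head (cayley_graph G A) e)) \<and>
     (\<forall>e\<in>arcs (cayley_graph G A). undirected G e \<in> T \<longrightarrow> \<Phi> e = [e]) \<and>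
     irrefl ((flow_rel G A T \<Phi>)\<^sup>+) \<and> trans ((flow_rel G A T \<Phi>)\<^sup>+) \<and> wf ((flow_rel G A T \<Phi>)\<^sup>+)"

definition bounded_flow_function ::
  "('a, 'b) monoid_scheme \<Rightarrow> 'a set \<Rightarrow> ('a \<times> 'a) set set \<Rightarrow> ('a \<times> 'a \<Rightarrow> ('a \<times> 'a) list) \<Rightarrow> bool" where
  "bounded_flow_function G A T \<Phi> \<longleftrightarrow>
     flow_function G A T \<Phi> \<and> (\<exists>k. \<forall>e\<in>arcs (cayley_graph G A). length (\<Phi> e) \<le> k)"

text \<open>
  The graph of the stacking map, i.e. the set of all $(y_g, a, \phi(y_g, a))$, where
  $\phi(y_g, a)$ is the label of $\Phi(e_{g,a})$. Tuples of words are encoded as lists of words.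
\<close>

definition stacking_graph ::
  "('a, 'b) monoid_scheme \<Rightarrow> 'a set \<Rightarrow> ('a \<times> 'a) set set \<Rightarrow> ('a \<times> 'a \<Rightarrow> ('a \<times> 'a) list)
   \<Rightarrow> 'a list list set" where
  "stacking_graph G A T \<Phi> =
     {[normal_form G A T g, [a], path_label (\<Phi> (g, a))] | g a. g \<in> carrier G \<and> a \<in> A}"

section \<open>Synchronously regular sets of tuples of words\<close>

definition word_tuples :: "nat \<Rightarrow> 'a set \<Rightarrow> 'a list list set" where
  "word_tuples n A = {us. length us = n \<and> set us \<subseteq> lists A}"

text \<open>
  Regular languages are those accepted by a complete deterministic finite automaton;
  taking the states to be natural numbers is no restriction.
\<close>

definition regular_language :: "'c set \<Rightarrow> 'c list set \<Rightarrow> bool" where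
  "regular_language \<Sigma> L \<longleftrightarrow>
     (\<exists>(S :: nat set) s\<^sub>0 \<delta> F.
        finite S \<and> s\<^sub>0 \<in> S \<and> F \<subseteq> S \<and> (\<forall>s\<in>S. \<forall>c\<in>\<Sigma>. \<delta> s c \<in> S) \<and>
        L = {w \<in> lists \<Sigma>. foldl \<delta> s\<^sub>0 w \<in> F})"

text \<open>The padding symbol is \<open>None\<close>, and letters of $A_n$ are lists of length \<open>n\<close>.\<close>

definition padded_alphabet :: "nat \<Rightarrow> 'a set \<Rightarrow> 'a option list set" where
  "padded_alphabet n A =
     {cs. length cs = n \<and> set cs \<subseteq> insert None (Some ` A)} - {replicate n None}"

text \<open>The \<open>0\<close> only serves to make \<open>Max\<close> defined for the empty tuple.\<close>

definition padded_word :: "'a list list \<Rightarrow> 'a option list list" where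
  "padded_word us =
     map (\<lambda>m. map (\<lambda>u. if m < length u then Some (u ! m) else None) us)
       [0..<Max (insert 0 (length ` set us))]"

definition synchronously_regular :: "nat \<Rightarrow> 'a set \<Rightarrow> 'a list list set \<Rightarrow> bool" where
  "synchronously_regular n A L \<longleftrightarrow>
     L \<subseteq> word_tuples n A \<and> regular_language (padded_alphabet n A) (padded_word ` L)"

section \<open>Decidable sets of tuples of words\<close>

text \<open>
  The total recursive functions: the least class of total functions on natural numbers that
  contains the basic functions and is closed under composition, primitive recursion, and
  minimization of regular functions (those that have a zero for all values of the remaining
  arguments). An \<open>n\<close>-ary function is represented by any function on lists that agrees with it on
  lists of length \<open>n\<close>; values at lists of other lengths are irrelevant.
\<close>

inductive total_recursive :: "nat \<Rightarrow> (nat list \<Rightarrow> nat) \<Rightarrow> bool" where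
  zero: "total_recursive n (\<lambda>xs. 0)"
| succ: "total_recursive 1 (\<lambda>xs. Suc (xs ! 0))"
| proj: "i < n \<Longrightarrow> total_recursive n (\<lambda>xs. xs ! i)"
| comp: "total_recursive (length hs) f \<Longrightarrow> (\<forall>h\<in>set hs. total_recursive n h) \<Longrightarrow>
    total_recursive n (\<lambda>xs. f (map (\<lambda>h. h xs) hs))"
| prim: "total_recursive n f \<Longrightarrow> total_recursive (Suc (Suc n)) h \<Longrightarrow>
    total_recursive (Suc n)
      (\<lambda>xs. rec_nat (f (tl xs)) (\<lambda>k r. h (k # r # tl xs)) (hd xs))"
| minim: "total_recursive (Suc n) f \<Longrightarrow> (\<forall>xs. length xs = n \<longrightarrow> (\<exists>k. f (k # xs) = 0)) \<Longrightarrow>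
    total_recursive n (\<lambda>xs. LEAST k. f (k # xs) = 0)"
| ext: "total_recursive n f \<Longrightarrow> (\<forall>xs. length xs = n \<longrightarrow> f' xs = f xs) \<Longrightarrow> total_recursive n f'"

definition recursive_relation :: "nat \<Rightarrow> nat list set \<Rightarrow> bool" where
  "recursive_relation n R \<longleftrightarrow>
     R \<subseteq> {xs. length xs = n} \<and>
     (\<exists>f. total_recursive n f \<and> (\<forall>xs. length xs = n \<longrightarrow> f xs = (if xs \<in> R then 1 else 0)))"

text \<open>
  Words over the finite alphabet \<open>A\<close> are coded by natural numbers, by numbering the letters and
  applying the standard coding of number lists. As \<open>A\<close> is finite, the choice of the numbering
  \<open>c\<close> does not affect decidability.
\<close>

definition decidable_set :: "nat \<Rightarrow> 'a set \<Rightarrow> 'a list list set \<Rightarrow> bool" where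
  "decidable_set n A L \<longleftrightarrow>
     finite A \<and> L \<subseteq> word_tuples n A \<and>
     (\<exists>c :: 'a \<Rightarrow> nat. inj_on c A \<and>
        recursive_relation n (map (\<lambda>u. list_encode (map c u)) ` L))"

section \<open>Stackability\<close>

definition stackable :: "('a, 'b) monoid_scheme \<Rightarrow> 'a set \<Rightarrow> bool" where
  "stackable G A \<longleftrightarrow> (\<exists>T \<Phi>. bounded_flow_function G A T \<Phi>)"

definition algorithmically_stackable :: "('a, 'b) monoid_scheme \<Rightarrow> 'a set \<Rightarrow> bool" where
  "algorithmically_stackable G A \<longleftrightarrow>
     (\<exists>T \<Phi>. bounded_flow_function G A T \<Phi> \<and> decidable_set 3 A (stacking_graph G A T \<Phi>))"

definition autostackable :: "('a, 'b) monoid_scheme \<Rightarrow> 'a set \<Rightarrow> bool" where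
  "autostackable G A \<longleftrightarrow>
     (\<exists>T \<Phi>. bounded_flow_function G A T \<Phi> \<and> synchronously_regular 3 A (stacking_graph G A T \<Phi>))"

end

theory Submission
  imports Defs
begin

text \<open>
  For \<open>p\<close> in \<open>Q\<close> let \<open>sec p\<close> be the value in \<open>G\<close> of the normal form of \<open>p\<close>, read with letters
  lifted to \<open>Bhat\<close>. Every \<open>g\<close> in \<open>G\<close> is uniquely \<open>\<iota> k\<close> times \<open>sec (q g)\<close>, and its normal form is chosen
  to be the normal form of \<open>k\<close> followed by the lifted normal form of \<open>q g\<close>. These words are closed
  under prefixes, and a prefix-closed choice of one word for each element is the same thing as a
  maximal tree (\<open>maximal_tree_forms\<close>, \<open>tree_forms_maximal_tree\<close>). The resulting tree of \<open>G\<close> consists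
  of the tree of \<open>K\<close>, embedded by \<open>\<iota>\<close>, together with all edges that lie over an edge of the tree of \<open>Q\<close>.

  The flow function treats the remaining edges as follows. An edge labeled \<open>\<iota> a\<close> inside \<open>\<iota> K\<close> follows
  the flow of \<open>K\<close>. An edge labeled \<open>\<iota> a\<close> at a vertex over \<open>p\<close> different from 1 is conjugated by the
  last letter \<open>b\<close> of the normal form of \<open>p\<close>: its path goes back along the lift of \<open>b\<close>, then along a
  word over \<open>\<iota> A\<close>, then forward along the lift of \<open>b\<close>; the first and last edge are in the tree, and the
  middle part lies over a vertex that is nearer to the root of the tree of \<open>Q\<close>. An edge labeled by
  a lift of \<open>b\<close> follows the lift of the flow path of its image in \<open>Q\<close>; the two sides differ by an
  element of \<open>\<iota> K\<close>, which is inserted at the start as a word over \<open>\<iota> A\<close>. Hence a lexicographic rank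
  decreases along the flow (\<open>rank_decreases\<close>): edges over edges of \<open>Q\<close> come above those labeled in
  \<open>\<iota> A\<close>; the former are ordered by the flow of \<open>Q\<close>, the latter by the distance of their image from
  the root and then by the flow of \<open>K\<close>. Only finitely many path labels occur, which gives
  boundedness.

  For the stacking map this finiteness has another consequence: its graph is regular or decidable
  if and only if each of its fibers is, a fiber being the language of the normal forms that are
  mapped to a given label when paired with a given letter. By \<open>fiberG_iota\<close> and \<open>fiberG_hat\<close> each
  fiber of \<open>G\<close> is a finite union of products of a language over \<open>\<iota> A\<close> and a language over \<open>Bhat\<close>, and
  the factors are images of fibers of \<open>K\<close> and \<open>Q\<close>, of the full sets of normal forms, or of the set
  of those normal forms of \<open>Q\<close> that end in a given letter. It remains to see that regular languages
  (by derivatives) and decidable languages (by primitive recursion on codes) are closed under these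
  operations.
\<close>

section \<open>Regular languages by derivatives\<close>

definition deriv :: "'c \<Rightarrow> 'c list set \<Rightarrow> 'c list set" where
  "deriv c L = {w. c # w \<in> L}"

definition derivative_family :: "'c set \<Rightarrow> 'c list set set \<Rightarrow> bool" where
  "derivative_family \<Sigma> \<F> \<longleftrightarrow> finite \<F> \<and> (\<forall>M\<in>\<F>. \<forall>c\<in>\<Sigma>. deriv c M \<in> \<F>)"

lemma deriv_simps [simp]:
  "deriv c {} = {}" "deriv c {[]} = {}" "deriv c (L \<union> M) = deriv c L \<union> deriv c M"
  "deriv c (L \<inter> M) = deriv c L \<inter> deriv c M"
  by (auto simp: deriv_def)

text \<open>
  Brzozowski and Nerode: a finite family of languages that is closed under letter derivatives is
  itself an automaton, with the languages as states and those that contain the empty word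
  accepting. Working with such families replaces every automaton construction below by the
  computation of a derivative.
\<close>

lemma regular_languageI:
  assumes fam: "derivative_family \<Sigma> \<F>" and L: "L \<in> \<F>" "L \<subseteq> lists \<Sigma>"
  shows "regular_language \<Sigma> L"
proof -
  from fam have fin: "finite \<F>" by (simp add: derivative_family_def)
  obtain f :: "_ \<Rightarrow> nat" where f: "inj_on f \<F>"
    using finite_imp_inj_to_nat_seg[OF fin] by blast
  define g where "g = inv_into \<F> f"
  have g: "M \<in> \<F> \<Longrightarrow> g (f M) = M" for M
    using f by (simp add: g_def)
  define \<delta> where "\<delta> = (\<lambda>s c. f (deriv c (g s)))"
  define Acc where "Acc = f ` {M\<in>\<F>. [] \<in> M}"
  have Acc: "M \<in> \<F> \<Longrightarrow> f M \<in> Acc \<longleftrightarrow> [] \<in> M" for M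
    using f unfolding Acc_def by (auto dest: inj_onD)
  have run: "w \<in> lists \<Sigma> \<Longrightarrow> M \<in> \<F> \<Longrightarrow> foldl \<delta> (f M) w \<in> Acc \<longleftrightarrow> w \<in> M" for w M
  proof (induction w arbitrary: M)
    case Nil
    then show ?case by (simp add: Acc)
  next
    case (Cons c w)
    then have "deriv c M \<in> \<F>" using fam by (auto simp: derivative_family_def)
    with Cons show ?case by (simp add: \<delta>_def g deriv_def)
  qed
  have "L = {w \<in> lists \<Sigma>. foldl \<delta> (f L) w \<in> Acc}"
    using run[OF _ L(1)] L(2) by blast
  moreover have "finite (f ` \<F>)" "f L \<in> f ` \<F>" "Acc \<subseteq> f ` \<F>"
    using fin L by (auto simp: Acc_def)
  moreover have "\<forall>s\<in>f ` \<F>. \<forall>c\<in>\<Sigma>. \<delta> s c \<in> f ` \<F>"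
    using fam by (auto simp: \<delta>_def g derivative_family_def)
  ultimately show ?thesis unfolding regular_language_def by blast
qed

lemma regular_languageE:
  assumes "regular_language \<Sigma> L"
  obtains \<F> where "derivative_family \<Sigma> \<F>" "L \<in> \<F>"
proof -
  from assms obtain S s0 \<delta> Acc where
    fin: "finite (S :: nat set)" and s0: "s0 \<in> S" and cl: "\<forall>s\<in>S. \<forall>c\<in>\<Sigma>. \<delta> s c \<in> S"
    and L: "L = {w \<in> lists \<Sigma>. foldl \<delta> s0 w \<in> Acc}"
    unfolding regular_language_def by blast
  let ?lang = "\<lambda>s. {w \<in> lists \<Sigma>. foldl \<delta> s w \<in> Acc}"
  have "deriv c (?lang s) = ?lang (\<delta> s c)" if "c \<in> \<Sigma>" for c s
    using that by (auto simp: deriv_def)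
  with fin cl have "derivative_family \<Sigma> (?lang ` S)"
    by (simp add: derivative_family_def)
  with L s0 show thesis by (intro that[of "?lang ` S"]) auto
qed

lemma regular_language_subset: "regular_language \<Sigma> L \<Longrightarrow> L \<subseteq> lists \<Sigma>"
  unfolding regular_language_def by auto

lemma regular_language_empty: "regular_language \<Sigma> {}"
  by (rule regular_languageI[where \<F> = "{{}}"]) (auto simp: derivative_family_def)

lemma regular_language_Nil: "regular_language \<Sigma> {[]}"
  by (rule regular_languageI[where \<F> = "{{}, {[]}}"]) (auto simp: derivative_family_def)

lemma regular_language_Un:
  assumes "regular_language \<Sigma> L" "regular_language \<Sigma> M"
  shows "regular_language \<Sigma> (L \<union> M)"
proof -
  obtain \<F> \<G> where "derivative_family \<Sigma> \<F>" "L \<in> \<F>" "derivative_family \<Sigma> \<G>" "M \<in> \<G>"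
    using assms by (elim regular_languageE)
  then show ?thesis using assms[THEN regular_language_subset]
    by (intro regular_languageI[where \<F> = "(\<lambda>(U, Y). U \<union> Y) ` (\<F> \<times> \<G>)"])
      (auto simp: derivative_family_def)
qed

lemma regular_language_Int:
  assumes "regular_language \<Sigma> L" "regular_language \<Sigma> M"
  shows "regular_language \<Sigma> (L \<inter> M)"
proof -
  obtain \<F> \<G> where "derivative_family \<Sigma> \<F>" "L \<in> \<F>" "derivative_family \<Sigma> \<G>" "M \<in> \<G>"
    using assms by (elim regular_languageE)
  then show ?thesis using assms[THEN regular_language_subset]
    by (intro regular_languageI[where \<F> = "(\<lambda>(U, Y). U \<inter> Y) ` (\<F> \<times> \<G>)"])
      (auto simp: derivative_family_def)
qed

lemma regular_language_UN:
  assumes "finite I" "\<And>i. i \<in> I \<Longrightarrow> regular_language \<Sigma> (L i)"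
  shows "regular_language \<Sigma> (\<Union>i\<in>I. L i)"
  using assms by (induction I) (auto intro: regular_language_Un regular_language_empty)

lemma regular_language_last:
  assumes "b \<in> \<Sigma>"
  shows "regular_language \<Sigma> {w \<in> lists \<Sigma>. w \<noteq> [] \<and> last w = b}" (is "regular_language _ ?E")
proof (rule regular_languageI[where \<F> = "{?E, insert [] ?E}"])
  show "derivative_family \<Sigma> {?E, insert [] ?E}"
  proof -
    have "deriv c ?E = (if c = b then insert [] ?E else ?E)" if "c \<in> \<Sigma>" for c
      using that by (auto simp: deriv_def split: if_splits)
    moreover have "deriv c (insert [] ?E) = deriv c ?E" for c
      by (auto simp: deriv_def)
    ultimately show ?thesis by (auto simp: derivative_family_def)
  qed
qed auto

text \<open>
  A concatenation whose factors live over different alphabets, as the two parts of a normal form of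
  an extension do.
\<close>

definition image_concat :: "('a \<Rightarrow> 'c) \<Rightarrow> ('b \<Rightarrow> 'c) \<Rightarrow> 'a list set \<Rightarrow> 'b list set \<Rightarrow> 'c list set" where
  "image_concat f h U Y = {map f x @ map h y | x y. x \<in> U \<and> y \<in> Y}"

text \<open>
  Since the two images of the alphabets are disjoint, the first letter of the second factor is
  recognizable, so a derivative of a product is a single product again: a letter of the first
  kind differentiates the first factor, and a letter of the second kind forces the first factor
  to be exhausted. This avoids the unions that derivatives of general concatenations produce.
\<close>

lemma regular_language_image_concat:
  assumes U: "regular_language A U" and Y: "regular_language B Y"
    and inj: "inj_on f A" "inj_on h B" and disj: "f ` A \<inter> h ` B = {}"
  shows "regular_language (f ` A \<union> h ` B) (image_concat f h U Y)"
proof -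
  obtain \<F> \<G> where fam: "derivative_family A \<F>" "U \<in> \<F>" "derivative_family B \<G>" "Y \<in> \<G>"
    using U Y by (elim regular_languageE)
  define \<F>' where "\<F>' = insert {} (insert {[]} ((\<inter>) (lists A) ` \<F>))"
  define \<G>' where "\<G>' = (\<inter>) (lists B) ` \<G>"
  have derivF: "deriv a U' \<in> \<F>'" if "a \<in> A" "U' \<in> \<F>'" for a U'
  proof -
    \<comment> \<open>Intersecting with \<open>lists A\<close> keeps the injectivity of \<open>f\<close> applicable to all words involved.\<close>
    have "deriv a (lists A \<inter> M) = lists A \<inter> deriv a M" for M
      using \<open>a \<in> A\<close> by (auto simp: deriv_def)
    with that fam show ?thesis by (auto simp: \<F>'_def derivative_family_def)
  qed
  have derivG: "deriv b Y' \<in> \<G>'" if "b \<in> B" "Y' \<in> \<G>'" for b Y'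
  proof -
    have "deriv b (lists B \<inter> M) = lists B \<inter> deriv b M" for M
      using \<open>b \<in> B\<close> by (auto simp: deriv_def)
    with that fam show ?thesis by (auto simp: \<G>'_def derivative_family_def)
  qed
  have sub: "U' \<subseteq> lists A" if "U' \<in> \<F>'" for U' using that by (auto simp: \<F>'_def)
  have sub': "Y' \<subseteq> lists B" if "Y' \<in> \<G>'" for Y' using that by (auto simp: \<G>'_def)
  have 1: "deriv (f a) (image_concat f h U' Y') = image_concat f h (deriv a U') Y'"
    if "a \<in> A" "U' \<subseteq> lists A" "Y' \<subseteq> lists B" for a U' Y'
  proof (intro equalityI subsetI)
    fix w assume "w \<in> deriv (f a) (image_concat f h U' Y')"
    then obtain x y where xy: "f a # w = map f x @ map h y" "x \<in> U'" "y \<in> Y'"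
      by (auto simp: deriv_def image_concat_def)
    show "w \<in> image_concat f h (deriv a U') Y'"
    proof (cases x)
      case Nil
      then obtain b y' where "y = b # y'" "h b = f a" using xy by (cases y) auto
      then have "b \<in> B" using xy(3) that(3) by auto
      with \<open>h b = f a\<close> disj that(1) have False by blast
      then show ?thesis ..
    next
      case (Cons a' x')
      then have "a' \<in> A" "f a' = f a" using xy that by auto
      then have "a' = a" using inj that(1) by (auto dest: inj_onD)
      then show ?thesis using xy Cons by (auto simp: deriv_def image_concat_def)
    qed
  next
    fix w assume "w \<in> image_concat f h (deriv a U') Y'"
    then obtain x y where "w = map f x @ map h y" "a # x \<in> U'" "y \<in> Y'"
      by (auto simp: deriv_def image_concat_def)
    then show "w \<in> deriv (f a) (image_concat f h U' Y')"
      by (auto simp: deriv_def image_concat_def intro!: exI[of _ "a # x"])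
  qed
  have 2: "deriv (h b) (image_concat f h U' Y') =
      image_concat f h (if [] \<in> U' then {[]} else {}) (deriv b Y')"
    if "b \<in> B" "U' \<subseteq> lists A" "Y' \<subseteq> lists B" for b U' Y'
  proof (intro equalityI subsetI)
    fix w assume "w \<in> deriv (h b) (image_concat f h U' Y')"
    then obtain x y where xy: "h b # w = map f x @ map h y" "x \<in> U'" "y \<in> Y'"
      by (auto simp: deriv_def image_concat_def)
    show "w \<in> image_concat f h (if [] \<in> U' then {[]} else {}) (deriv b Y')"
    proof (cases x)
      case Nil
      then obtain b' y' where y: "y = b' # y'" "h b' = h b" "w = map h y'" using xy by (cases y) auto
      then have "b' \<in> B" using xy(3) that(3) by auto
      then have "b' = b" using inj that(1) y by (auto dest: inj_onD)
      then show ?thesis using xy Nil y by (auto simp: deriv_def image_concat_def)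
    next
      case (Cons a' x')
      then have "a' \<in> A" "f a' = h b" using xy that by auto
      with disj that(1) have False by (metis IntI emptyE imageI)
      then show ?thesis ..
    qed
  next
    fix w assume "w \<in> image_concat f h (if [] \<in> U' then {[]} else {}) (deriv b Y')"
    then obtain y where "w = map h y" "[] \<in> U'" "b # y \<in> Y'"
      by (auto simp: deriv_def image_concat_def split: if_splits)
    then show "w \<in> deriv (h b) (image_concat f h U' Y')"
      by (auto simp: deriv_def image_concat_def intro!: exI[of _ "[]"] exI[of _ "b # y"])
  qed
  have "derivative_family (f ` A \<union> h ` B) ((\<lambda>(U', Y'). image_concat f h U' Y') ` (\<F>' \<times> \<G>'))"
    unfolding derivative_family_def
  proof (intro conjI ballI)
    show "finite ((\<lambda>(U', Y'). image_concat f h U' Y') ` (\<F>' \<times> \<G>'))"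
      using fam by (simp add: \<F>'_def \<G>'_def derivative_family_def)
  next
    fix M c
    assume "M \<in> (\<lambda>(U', Y'). image_concat f h U' Y') ` (\<F>' \<times> \<G>')" and c: "c \<in> f ` A \<union> h ` B"
    then obtain U' Y' where M: "M = image_concat f h U' Y'" and XY: "U' \<in> \<F>'" "Y' \<in> \<G>'" by auto
    from c show "deriv c M \<in> (\<lambda>(U', Y'). image_concat f h U' Y') ` (\<F>' \<times> \<G>')"
    proof
      assume "c \<in> f ` A"
      then obtain a where a: "a \<in> A" "c = f a" by auto
      have "deriv c M = image_concat f h (deriv a U') Y'"
        using 1[OF a(1)] sub[OF XY(1)] sub'[OF XY(2)] by (simp add: a M)
      with derivF[OF a(1) XY(1)] XY(2) show ?thesis by auto
    next
      assume "c \<in> h ` B"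
      then obtain b where b: "b \<in> B" "c = h b" by auto
      have "deriv c M = image_concat f h (if [] \<in> U' then {[]} else {}) (deriv b Y')"
        using 2[OF b(1)] sub[OF XY(1)] sub'[OF XY(2)] by (simp add: b M)
      with derivG[OF b(1) XY(2)] show ?thesis by (auto simp: \<F>'_def)
    qed
  qed
  moreover have "U \<in> \<F>'" "Y \<in> \<G>'"
    using fam U[THEN regular_language_subset] Y[THEN regular_language_subset]
    by (auto simp: \<F>'_def \<G>'_def Int_absorb1 intro!: image_eqI)
  moreover have "image_concat f h U Y \<subseteq> lists (f ` A \<union> h ` B)"
    using U[THEN regular_language_subset] Y[THEN regular_language_subset]
    by (force simp: image_concat_def)
  ultimately show ?thesis by (intro regular_languageI) auto
qed

section \<open>Synchronous regularity by fibers\<close>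

definition fiber :: "'a list list set \<Rightarrow> 'a list list \<Rightarrow> 'a list set" where
  "fiber L vs = {y. y # vs \<in> L}"

lemma fiber_subset: "L \<subseteq> word_tuples n A \<Longrightarrow> fiber L vs \<subseteq> lists A"
  by (auto simp: fiber_def word_tuples_def subset_iff)

definition hd_opt :: "'a list \<Rightarrow> 'a option" where
  "hd_opt u = (if u = [] then None else Some (hd u))"

lemma padded_word_Nil: "\<forall>u\<in>set us. u = [] \<Longrightarrow> padded_word us = []"
proof -
  assume "\<forall>u\<in>set us. u = []"
  then have "insert 0 (length ` set us) = {0}" by auto
  then show ?thesis by (simp only: padded_word_def) simp
qed

lemma padded_word_Cons:
  assumes "\<exists>u\<in>set us. u \<noteq> []"
  shows "padded_word us = map hd_opt us # padded_word (map tl us)"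
proof -
  let ?M = "\<lambda>us. Max (insert 0 (length ` set us))"
  have le: "length u \<le> ?M us" if "u \<in> set us" for u
    by (rule Max_ge) (use that in auto)
  from assms obtain u0 where "u0 \<in> set us" "length u0 \<noteq> 0" by auto
  with le[of u0] have pos: "?M us \<noteq> 0" by linarith
  have "?M (map tl us) = ?M us - 1"
  proof (rule Max_eqI)
    have "?M us \<in> insert 0 (length ` set us)" by (rule Max_in) auto
    with pos obtain u where "u \<in> set us" "length u = ?M us" by auto
    then show "?M us - 1 \<in> insert 0 (length ` set (map tl us))" by force
    fix n assume "n \<in> insert 0 (length ` set (map tl us))"
    then consider "n = 0" | u where "u \<in> set us" "n = length u - 1" by auto
    then show "n \<le> ?M us - 1"
    proof cases
      case 2
      with le[of u] show ?thesis by (simp add: diff_le_mono)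
    qed simp
  qed simp
  with pos obtain m where m: "?M us = Suc m" "?M (map tl us) = m"
    by (metis diff_Suc_1 not0_implies_Suc)
  have "[0..<Suc m] = 0 # map Suc [0..<m]"
    by (metis map_Suc_upt upt_conv_Cons zero_less_Suc)
  then show ?thesis
    unfolding padded_word_def m by (simp only: list.map) (auto simp: hd_opt_def hd_conv_nth nth_tl)
qed

text \<open>
  Padding loses no information: each component is recovered by dropping the padding symbols.
  Hence \<open>padded_word_inject\<close> below.
\<close>

lemma component_of_padded_word:
  assumes "i < length us"
  shows "map the (filter (\<lambda>x. x \<noteq> None) (map (\<lambda>c. c ! i) (padded_word us))) = us ! i"
  using assms
proof (induction "sum_list (map length us)" arbitrary: us rule: less_induct)
  case less
  show ?case
  proof (cases "\<forall>u\<in>set us. u = []")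
    case True
    then have "us ! i = []" using less.prems nth_mem by blast
    with True show ?thesis by (simp add: padded_word_Nil)
  next
    case False
    then obtain u where u: "u \<in> set us" "u \<noteq> []" by auto
    have "sum_list (map length (map tl us)) < sum_list (map length us)"
    proof -
      have "sum_list (map length (map tl us)) \<le> sum_list (map length us)" for us :: "'a list list"
        by (induction us) auto
      from u this show ?thesis
        by (induction us) (auto intro: add_le_less_mono add_less_le_mono)
    qed
    from less.hyps[OF this] less.prems
    have IH: "map the (filter (\<lambda>x. x \<noteq> None) (map (\<lambda>c. c ! i) (padded_word (map tl us)))) = tl (us ! i)"
      by simp
    have "padded_word us = map hd_opt us # padded_word (map tl us)"
      using u by (intro padded_word_Cons) auto
    moreover have "hd_opt (us ! i) = None \<Longrightarrow> us ! i = []" "hd_opt (us ! i) \<noteq> None \<Longrightarrow>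
        us ! i = the (hd_opt (us ! i)) # tl (us ! i)"
      by (auto simp: hd_opt_def split: if_splits)
    ultimately show ?thesis using IH less.prems
      by (cases "hd_opt (us ! i)") auto
  qed
qed

lemma padded_word_inject:
  assumes "length us = length vs" "padded_word us = padded_word vs"
  shows "us = vs"
  using assms component_of_padded_word[of _ us] component_of_padded_word[of _ vs]
  by (metis nth_equalityI)

lemma hd_opt_padded_alphabet:
  assumes "us \<in> word_tuples n A" "\<exists>u\<in>set us. u \<noteq> []"
  shows "map hd_opt us \<in> padded_alphabet n A"
proof -
  have "set (map hd_opt us) \<subseteq> insert None (Some ` A)"
    using assms(1) by (fastforce simp: word_tuples_def hd_opt_def in_lists_conv_set)
  moreover have "map hd_opt us \<noteq> replicate n None"
    using assms(2) by (metis hd_opt_def in_set_replicate list.set_map image_eqI option.distinct(1))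
  ultimately show ?thesis using assms(1) by (simp add: padded_alphabet_def word_tuples_def)
qed

lemma tl_word_tuples: "us \<in> word_tuples n A \<Longrightarrow> map tl us \<in> word_tuples n A"
proof -
  assume "us \<in> word_tuples n A"
  moreover have "tl u \<in> lists A" if "u \<in> lists A" for u using that by cases auto
  ultimately show ?thesis by (auto simp: word_tuples_def)
qed

lemma padded_word_in_lists:
  "us \<in> word_tuples n A \<Longrightarrow> padded_word us \<in> lists (padded_alphabet n A)"
proof (induction "padded_word us" arbitrary: us)
  case Nil
  then show ?case by (metis lists.Nil)
next
  case (Cons c w)
  then have ex: "\<exists>u\<in>set us. u \<noteq> []" by (metis padded_word_Nil list.distinct(1))
  then have "w = padded_word (map tl us)" using Cons.hyps padded_word_Cons by (metis list.inject)
  with Cons.hyps(1) have "padded_word (map tl us) \<in> lists (padded_alphabet n A)"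
    using tl_word_tuples Cons.prems by metis
  then show ?case using ex hd_opt_padded_alphabet[OF Cons.prems] by (simp add: padded_word_Cons)
qed

lemma finite_bounded_tuples:
  "finite A \<Longrightarrow> finite {vs \<in> word_tuples n A. \<forall>v\<in>set vs. length v \<le> k}"
  by (rule finite_subset[OF _ finite_lists_length_eq[of "{v \<in> lists A. length v \<le> k}" n]])
    (auto simp: word_tuples_def lists_eq_set intro: finite_subset[OF _ finite_lists_length_le[of A k]])

text \<open>
  Reading a letter \<open>c\<close> of \<open>y\<close> amounts to reading the tuple of \<open>c\<close> and the heads of \<open>vs\<close> and then
  passing to the tails of \<open>vs\<close>. As \<open>vs\<close> has only finitely many iterated tails, a finite family for
  the padded language yields one for the fiber.
\<close>

lemma regular_fiber_of_synchronously_regular: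
  assumes fin: "finite A" and L: "synchronously_regular (Suc n) A L"
  shows "regular_language A (fiber L vs)"
proof (cases "vs \<in> word_tuples n A")
  case False
  then have "fiber L vs = {}"
    using L by (force simp: fiber_def synchronously_regular_def word_tuples_def simp del: in_lists_conv_set)
  then show ?thesis by (simp add: regular_language_empty)
next
  case True
  from L have sub: "L \<subseteq> word_tuples (Suc n) A"
    and "regular_language (padded_alphabet (Suc n) A) (padded_word ` L)"
    by (auto simp: synchronously_regular_def)
  then obtain \<F> where fam: "derivative_family (padded_alphabet (Suc n) A) \<F>"
    and LF: "padded_word ` L \<in> \<F>" by (elim regular_languageE)
  obtain k where k: "\<forall>v\<in>set vs. length v \<le> k"
  proof
    show "\<forall>v\<in>set vs. length v \<le> sum_list (map length vs)"
      by (auto intro: member_le_sum_list)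
  qed
  define V where "V = {vs \<in> word_tuples n A. \<forall>v\<in>set vs. length v \<le> k}"
  have tlV: "map tl us \<in> V" if "us \<in> V" for us
    using that tl_word_tuples[of us] by (force simp: V_def)
  define F where "F M us = {y \<in> lists A. padded_word (y # us) \<in> M}" for M us
  have deriv: "deriv c (F M us) = F (deriv (map hd_opt ([c] # us)) M) (map tl us)"
    if "c \<in> A" for c M us
  proof -
    have "padded_word ((c # y) # us) = map hd_opt ([c] # us) # padded_word (y # map tl us)" for y
      by (subst padded_word_Cons) (auto simp: hd_opt_def)
    with that show ?thesis by (auto simp: F_def deriv_def)
  qed
  have alph: "map hd_opt ([c] # us) \<in> padded_alphabet (Suc n) A" if "c \<in> A" "us \<in> V" for c us
    by (rule hd_opt_padded_alphabet) (use that in \<open>auto simp: V_def word_tuples_def\<close>)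
  have "derivative_family A ((\<lambda>(M, us). F M us) ` (\<F> \<times> V))"
    unfolding derivative_family_def
  proof (intro conjI ballI)
    show "finite ((\<lambda>(M, us). F M us) ` (\<F> \<times> V))"
      using fam finite_bounded_tuples[OF fin] by (simp add: derivative_family_def V_def)
  next
    fix M c assume "M \<in> (\<lambda>(M, us). F M us) ` (\<F> \<times> V)" "c \<in> A"
    then obtain M' us where M: "M = F M' us" "M' \<in> \<F>" "us \<in> V" by auto
    then have "deriv (map hd_opt ([c] # us)) M' \<in> \<F>"
      using fam alph[OF \<open>c \<in> A\<close> M(3)] unfolding derivative_family_def by blast
    then show "deriv c M \<in> (\<lambda>(M, us). F M us) ` (\<F> \<times> V)"
      using deriv[OF \<open>c \<in> A\<close>] tlV[OF M(3)] unfolding M(1) by (intro image_eqI[of _ _ "(_, _)"]) auto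
  qed
  moreover have "fiber L vs = F (padded_word ` L) vs"
  proof -
    have "y # vs \<in> L" if "padded_word (y # vs) = padded_word us" "us \<in> L" for y us
      using padded_word_inject[of "y # vs" us] that sub True by (auto simp: word_tuples_def)
    moreover have "y \<in> lists A" if "y # vs \<in> L" for y
      using that sub by (fastforce simp: word_tuples_def simp del: in_lists_conv_set)
    ultimately show ?thesis by (auto simp: F_def fiber_def simp del: in_lists_conv_set)
  qed
  ultimately show ?thesis using LF True k
    by (intro regular_languageI[where \<F> = "(\<lambda>(M, us). F M us) ` (\<F> \<times> V)"])
      (auto simp: V_def F_def)
qed

text \<open>
  The converse translation. A letter whose first component is padding requires that \<open>y\<close> is
  exhausted, which adds only the languages \<open>{}\<close> and \<open>{[]}\<close> to the family.
\<close>

lemma regular_padded_words: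
  assumes fin: "finite A" and R: "regular_language A R" and vs: "vs \<in> word_tuples n A"
  shows "regular_language (padded_alphabet (Suc n) A) ((\<lambda>y. padded_word (y # vs)) ` R)"
proof -
  obtain \<F> where fam: "derivative_family A \<F>" "R \<in> \<F>" using R by (elim regular_languageE)
  obtain k where k: "\<forall>v\<in>set vs. length v \<le> k"
  proof
    show "\<forall>v\<in>set vs. length v \<le> sum_list (map length vs)"
      by (auto intro: member_le_sum_list)
  qed
  define V where "V = {vs \<in> word_tuples n A. \<forall>v\<in>set vs. length v \<le> k}"
  have tlV: "map tl us \<in> V" if "us \<in> V" for us
    using that tl_word_tuples[of us] by (force simp: V_def)
  define P where "P M us = (\<lambda>y. padded_word (y # us)) ` M" for M :: "'a list set" and us
  define \<F>' where "\<F>' = insert {} (insert {[]} \<F>)"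
  \<comment> \<open>the possible continuations of \<open>y\<close> after the padded letter \<open>c\<close>; a pure padding letter does not occur\<close>
  define rest where "rest c M us = (if tl c \<noteq> map hd_opt us then {}
      else case hd c of Some a \<Rightarrow> deriv a M
        | None \<Rightarrow> if [] \<in> M \<and> (\<exists>u\<in>set us. u \<noteq> []) then {[]} else {})"
    for c and M :: "'a list set" and us
  have step: "c # w \<in> P M us \<longleftrightarrow> w \<in> P (rest c M us) (map tl us)"
    if "length c = Suc n" for c w M us
  proof
    assume "c # w \<in> P M us"
    then obtain y where y: "y \<in> M" "c # w = padded_word (y # us)" by (auto simp: P_def)
    then have ex: "\<exists>u\<in>set (y # us). u \<noteq> []" by (metis padded_word_Nil list.distinct(1))
    from y(2) padded_word_Cons[OF ex] have cw: "c = map hd_opt (y # us)" "w = padded_word (tl y # map tl us)"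
      by auto
    have "tl y \<in> rest c M us"
      using y(1) ex by (cases y) (auto simp: cw(1) rest_def hd_opt_def deriv_def)
    with cw(2) show "w \<in> P (rest c M us) (map tl us)" by (auto simp: P_def)
  next
    assume "w \<in> P (rest c M us) (map tl us)"
    then obtain y where y: "y \<in> rest c M us" "w = padded_word (y # map tl us)" by (auto simp: P_def)
    then have c: "c = hd c # map hd_opt us" using that by (cases c) (auto simp: rest_def split: if_splits)
    show "c # w \<in> P M us"
    proof (cases "hd c")
      case None
      then have "y = []" "[] \<in> M" and ex: "\<exists>u\<in>set us. u \<noteq> []"
        using y(1) by (auto simp: rest_def split: if_splits)
      moreover from ex None c have "c # w = padded_word ([] # us)"
        by (subst padded_word_Cons) (auto simp: y \<open>y = []\<close> hd_opt_def)
      ultimately show ?thesis by (auto simp: P_def)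
    next
      case (Some a)
      then have "a # y \<in> M" using y(1) by (auto simp: rest_def deriv_def split: if_splits)
      moreover from Some c have "c # w = padded_word ((a # y) # us)"
        by (subst padded_word_Cons) (auto simp: y hd_opt_def)
      ultimately show ?thesis by (auto simp: P_def)
    qed
  qed
  then have deriv: "deriv c (P M us) = P (rest c M us) (map tl us)" if "length c = Suc n" for c M us
    using that by (auto simp: deriv_def)
  have rest: "rest c M us \<in> \<F>'" if "c \<in> padded_alphabet (Suc n) A" "M \<in> \<F>'" for c M us
  proof (cases "hd c")
    case None
    then show ?thesis by (simp add: rest_def \<F>'_def)
  next
    case (Some a)
    then have "a \<in> A" using that(1) by (cases c) (auto simp: padded_alphabet_def)
    then have "deriv a M \<in> \<F>'" using that(2) fam by (auto simp: \<F>'_def derivative_family_def)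
    then show ?thesis using Some by (simp add: rest_def \<F>'_def)
  qed
  have "derivative_family (padded_alphabet (Suc n) A) ((\<lambda>(M, us). P M us) ` (\<F>' \<times> V))"
    unfolding derivative_family_def
  proof (intro conjI ballI)
    show "finite ((\<lambda>(M, us). P M us) ` (\<F>' \<times> V))"
      using fam finite_bounded_tuples[OF fin] by (simp add: derivative_family_def V_def \<F>'_def)
  next
    fix M c assume "M \<in> (\<lambda>(M, us). P M us) ` (\<F>' \<times> V)" and c: "c \<in> padded_alphabet (Suc n) A"
    then obtain M' us where M: "M = P M' us" "M' \<in> \<F>'" "us \<in> V" by auto
    have "deriv c M = P (rest c M' us) (map tl us)"
      unfolding M(1) by (rule deriv) (use c in \<open>simp add: padded_alphabet_def\<close>)
    then show "deriv c M \<in> (\<lambda>(M, us). P M us) ` (\<F>' \<times> V)"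
      using rest[OF c M(2)] tlV[OF M(3)] by auto
  qed
  moreover have "(\<lambda>y. padded_word (y # vs)) ` R \<subseteq> lists (padded_alphabet (Suc n) A)"
  proof (intro image_subsetI padded_word_in_lists)
    show "y # vs \<in> word_tuples (Suc n) A" if "y \<in> R" for y
      using that regular_language_subset[OF R] vs by (auto simp: word_tuples_def)
  qed
  ultimately show ?thesis using fam vs k
    by (intro regular_languageI[where \<F> = "(\<lambda>(M, us). P M us) ` (\<F>' \<times> V)"])
      (auto simp: V_def P_def \<F>'_def)
qed

lemma synchronously_regular_of_fibers:
  assumes fin: "finite A" "finite V" and sub: "L \<subseteq> word_tuples (Suc n) A"
    and tails: "\<And>us. us \<in> L \<Longrightarrow> tl us \<in> V"
    and reg: "\<And>vs. vs \<in> V \<Longrightarrow> regular_language A (fiber L vs)"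
  shows "synchronously_regular (Suc n) A L"
proof -
  let ?V = "V \<inter> word_tuples n A"
  have "padded_word ` L = (\<Union>vs\<in>?V. (\<lambda>y. padded_word (y # vs)) ` fiber L vs)" (is "_ = ?R")
  proof (intro equalityI subsetI)
    fix w assume "w \<in> padded_word ` L"
    then obtain us where us: "us \<in> L" "w = padded_word us" by auto
    with sub have len: "length us = Suc n" "set us \<subseteq> lists A" by (auto simp: word_tuples_def)
    then obtain y vs where yvs: "us = y # vs" by (cases us) auto
    with len tails[OF us(1)] have "vs \<in> ?V" by (simp add: word_tuples_def)
    with us yvs show "w \<in> ?R" unfolding fiber_def by blast
  qed (auto simp: fiber_def)
  moreover have "regular_language (padded_alphabet (Suc n) A) ?R"
    using fin reg by (intro regular_language_UN regular_padded_words) auto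
  ultimately show ?thesis using sub by (simp add: synchronously_regular_def)
qed

section \<open>Decidable languages\<close>

definition computable :: "(nat \<Rightarrow> nat) \<Rightarrow> bool" where
  "computable f \<longleftrightarrow> total_recursive 1 (\<lambda>xs. f (xs ! 0))"

definition computable2 :: "(nat \<Rightarrow> nat \<Rightarrow> nat) \<Rightarrow> bool" where
  "computable2 f \<longleftrightarrow> total_recursive 2 (\<lambda>xs. f (xs ! 0) (xs ! 1))"

definition decidable_nats :: "nat set \<Rightarrow> bool" where
  "decidable_nats D \<longleftrightarrow> computable (\<lambda>x. if x \<in> D then 1 else 0)"

lemma total_recursive_const: "total_recursive n (\<lambda>xs. c)"
proof (induction c)
  case (Suc c)
  show ?case
    using total_recursive.comp[of "[\<lambda>xs. c]" "\<lambda>xs. Suc (xs ! 0)" n] Suc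
    by (simp add: total_recursive.succ[simplified])
qed (rule total_recursive.zero)

lemma total_recursive_computable:
  "computable f \<Longrightarrow> total_recursive n g \<Longrightarrow> total_recursive n (\<lambda>xs. f (g xs))"
  using total_recursive.comp[of "[g]" "\<lambda>xs. f (xs ! 0)" n] by (simp add: computable_def)

lemma total_recursive_computable2:
  "computable2 f \<Longrightarrow> total_recursive n g \<Longrightarrow> total_recursive n h \<Longrightarrow> total_recursive n (\<lambda>xs. f (g xs) (h xs))"
  using total_recursive.comp[of "[g, h]" "\<lambda>xs. f (xs ! 0) (xs ! 1)" n]
  by (simp add: computable2_def numeral_2_eq_2)

lemma total_recursive_Suc: "total_recursive n g \<Longrightarrow> total_recursive n (\<lambda>xs. Suc (g xs))"
  using total_recursive_computable[of Suc n g]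
  by (simp add: computable_def total_recursive.succ[simplified])

lemma total_recursive_map_nth:
  assumes f: "total_recursive m f" and ix: "length ix = m" "set ix \<subseteq> {..<n}"
  shows "total_recursive n (\<lambda>xs. f (map ((!) xs) ix))"
proof -
  have "total_recursive (length (map (\<lambda>i xs. xs ! i) ix)) f" using f ix by simp
  from total_recursive.comp[OF this, of n] ix show ?thesis
    by (auto simp: comp_def intro: total_recursive.proj)
qed

text \<open>
  Primitive recursion in which the recursion bound and the parameters are computed from a common
  argument list, so that the rule applies to a goal as it stands.
\<close>

lemma total_recursive_rec:
  assumes f: "total_recursive n f" and h: "total_recursive (Suc (Suc n)) h" and g: "total_recursive n g"
  shows "total_recursive n (\<lambda>xs. rec_nat (f xs) (\<lambda>k r. h (k # r # xs)) (g xs))"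
proof -
  let ?hs = "g # map (\<lambda>i xs. xs ! i) [0..<n]"
  have "total_recursive (length ?hs) (\<lambda>xs. rec_nat (f (tl xs)) (\<lambda>k r. h (k # r # tl xs)) (hd xs))"
    using total_recursive.prim[OF f h] by simp
  moreover have "\<forall>h\<in>set ?hs. total_recursive n h" using g by (auto intro: total_recursive.proj)
  ultimately have "total_recursive n (\<lambda>xs. rec_nat (f (tl (map (\<lambda>h. h xs) ?hs)))
      (\<lambda>k r. h (k # r # tl (map (\<lambda>h. h xs) ?hs))) (hd (map (\<lambda>h. h xs) ?hs)))"
    by (rule total_recursive.comp)
  then show ?thesis
  proof (rule total_recursive.ext, intro allI impI)
    fix xs :: "nat list" assume "length xs = n"
    then have "map (\<lambda>h. h xs) ?hs = g xs # xs" using map_nth[of xs] by (simp add: comp_def)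
    then show "rec_nat (f xs) (\<lambda>k r. h (k # r # xs)) (g xs) = rec_nat (f (tl (map (\<lambda>h. h xs) ?hs)))
      (\<lambda>k r. h (k # r # tl (map (\<lambda>h. h xs) ?hs))) (hd (map (\<lambda>h. h xs) ?hs))" by simp
  qed
qed

lemma total_recursive_tl_tl:
  assumes "total_recursive n f"
  shows "total_recursive (Suc (Suc n)) (\<lambda>xs. f (tl (tl xs)))"
proof (rule total_recursive.ext)
  show "total_recursive (Suc (Suc n)) (\<lambda>xs. f (map ((!) xs) [2..<n+2]))"
    by (rule total_recursive_map_nth[OF assms]) auto
  show "\<forall>xs. length xs = Suc (Suc n) \<longrightarrow> f (tl (tl xs)) = f (map ((!) xs) [2..<n+2])"
  proof (intro allI impI)
    fix xs :: "nat list" assume "length xs = Suc (Suc n)"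
    then have "tl (tl xs) = map ((!) xs) [2..<n+2]"
      by (intro nth_equalityI) (auto simp: nth_tl simp del: upt_Suc)
    then show "f (tl (tl xs)) = f (map ((!) xs) [2..<n+2])" by simp
  qed
qed

lemma total_recursive_funpow:
  assumes "computable f" "total_recursive n g" "total_recursive n h"
  shows "total_recursive n (\<lambda>xs. (f ^^ g xs) (h xs))"
proof -
  have "total_recursive (Suc (Suc n)) (\<lambda>xs. f (xs ! 1))"
    by (intro total_recursive_computable[OF assms(1)] total_recursive.proj) simp
  from total_recursive_rec[OF assms(3) this assms(2)]
  have "total_recursive n (\<lambda>xs. rec_nat (h xs) (\<lambda>k r. f r) (g xs))" by simp
  moreover have "rec_nat x (\<lambda>k r. f r) m = (f ^^ m) x" for x m by (induction m) auto
  ultimately show ?thesis by simp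
qed

lemma total_recursive_if:
  assumes "total_recursive n f" "total_recursive n g" "total_recursive n h"
  shows "total_recursive n (\<lambda>xs. if f xs = 0 then g xs else h xs)"
proof -
  have "rec_nat x (\<lambda>k r. y) m = (if m = 0 then x else y)" for x y m :: nat by (cases m) auto
  with total_recursive_rec[OF assms(2) total_recursive_tl_tl[OF assms(3)] assms(1)]
  show ?thesis by simp
qed

lemma total_recursive_add:
  assumes "total_recursive n f" "total_recursive n g"
  shows "total_recursive n (\<lambda>xs. f xs + g xs)"
proof -
  have "computable Suc" by (simp add: computable_def total_recursive.succ[simplified])
  from total_recursive_funpow[OF this assms] show ?thesis by simp
qed

lemma total_recursive_pred:
  assumes "total_recursive n f"
  shows "total_recursive n (\<lambda>xs. f xs - 1)"
proof -
  have "total_recursive (Suc (Suc n)) (\<lambda>xs. xs ! 0)" by (rule total_recursive.proj) simp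
  from total_recursive_rec[OF total_recursive.zero this assms]
  have "total_recursive n (\<lambda>xs. rec_nat 0 (\<lambda>k r. k) (f xs))" by simp
  moreover have "rec_nat 0 (\<lambda>k r. k) m = m - 1" for m :: nat by (cases m) auto
  ultimately show ?thesis by simp
qed

lemma total_recursive_diff:
  assumes "total_recursive n f" "total_recursive n g"
  shows "total_recursive n (\<lambda>xs. f xs - g xs)"
proof -
  have "computable (\<lambda>x. x - 1)"
    unfolding computable_def by (intro total_recursive_pred total_recursive.proj) simp
  from total_recursive_funpow[OF this assms(2,1)]
  have "total_recursive n (\<lambda>xs. ((\<lambda>x. x - 1) ^^ g xs) (f xs))" .
  moreover have "((\<lambda>x. x - 1) ^^ m) x = x - m" for m x :: nat by (induction m) auto
  ultimately show ?thesis by simp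
qed

lemmas total_recursive_arith =
  total_recursive_const total_recursive_Suc total_recursive_add total_recursive_diff
  total_recursive_if total_recursive.proj

text \<open>
  Minimization, applied below to bounded search: it inverts functions such as doubling and the
  triangular numbers without a further recursion.
\<close>

lemma computable_Least:
  assumes f: "computable2 f" and ex: "\<And>x. \<exists>k. f k x = 0"
  shows "computable (\<lambda>x. LEAST k. f k x = 0)"
proof -
  let ?f = "\<lambda>xs. f (xs ! 0) (xs ! 1)"
  have "total_recursive (Suc 1) ?f" using f by (simp add: computable2_def numeral_2_eq_2)
  then have "total_recursive 1 (\<lambda>xs. LEAST k. ?f (k # xs) = 0)"
    using ex by (intro total_recursive.minim) auto
  then show ?thesis by (simp add: computable_def)
qed

lemma computable_div2: "computable (\<lambda>x. x div 2)"
proof -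
  have "computable2 (\<lambda>k x. x - Suc (k + k))"
    unfolding computable2_def by (intro total_recursive_arith) simp_all
  then have "computable (\<lambda>x. LEAST k. x - Suc (k + k) = 0)"
    by (rule computable_Least) (metis diff_is_0_eq' le_add1 le_SucI)
  moreover have "(LEAST k. x - Suc (k + k) = 0) = x div 2" for x :: nat
    by (rule Least_equality) auto
  ultimately show ?thesis by simp
qed

lemma computable_mod2: "computable (\<lambda>x. x mod 2)"
proof -
  have "computable (\<lambda>x. x - (x div 2 + x div 2))" using computable_div2
    unfolding computable_def by (intro total_recursive_arith) simp_all
  moreover have "x - (x div 2 + x div 2) = x mod 2" for x :: nat by presburger
  ultimately show ?thesis by simp
qed

lemma computable_triangle: "computable triangle"
proof -
  have "total_recursive (Suc (Suc 1)) (\<lambda>xs. xs ! 1 + Suc (xs ! 0))"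
    by (intro total_recursive_arith) simp_all
  from total_recursive_rec[OF total_recursive.zero this total_recursive.proj[of 0 1]]
  have "computable (\<lambda>x. rec_nat 0 (\<lambda>k r. r + Suc k) x)" by (simp add: computable_def)
  moreover have "rec_nat 0 (\<lambda>k r. r + Suc k) x = triangle x" for x by (induction x) auto
  ultimately show ?thesis by simp
qed

lemma total_recursive_prod_encode:
  assumes "total_recursive n f" "total_recursive n g"
  shows "total_recursive n (\<lambda>xs. prod_encode (f xs, g xs))"
  unfolding prod_encode_def using assms
  by (auto intro!: total_recursive_add total_recursive_computable[OF computable_triangle])

text \<open>
  The number of the antidiagonal on which the Cantor pairing function places a code; it is the
  sum of the two components.
\<close>

definition antidiagonal :: "nat \<Rightarrow> nat" where
  "antidiagonal x = (LEAST k. Suc x - triangle (Suc k) = 0)"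

lemma antidiagonal_prod_encode: "antidiagonal (prod_encode (a, b)) = a + b"
  unfolding antidiagonal_def
proof (rule Least_equality)
  show "Suc (prod_encode (a, b)) - triangle (Suc (a + b)) = 0" by (simp add: prod_encode_def)
  fix k assume k: "Suc (prod_encode (a, b)) - triangle (Suc k) = 0"
  have mono: "i \<le> j \<Longrightarrow> triangle i \<le> triangle j" for i j
    by (induction j rule: nat_induct) (auto simp: le_Suc_eq)
  show "a + b \<le> k"
  proof (rule ccontr)
    assume "\<not> a + b \<le> k"
    then have "triangle (Suc k) \<le> triangle (a + b)" by (intro mono) simp
    with k show False by (simp add: prod_encode_def)
  qed
qed

lemma computable_antidiagonal: "computable antidiagonal"
proof -
  have "computable2 (\<lambda>k x. Suc x - triangle (Suc k))"
    unfolding computable2_def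
    by (intro total_recursive_arith total_recursive_computable[OF computable_triangle]) simp_all
  then have "computable (\<lambda>x. LEAST k. Suc x - triangle (Suc k) = 0)"
  proof (rule computable_Least)
    fix x show "\<exists>k. Suc x - triangle (Suc k) = 0" by (intro exI[of _ x]) simp
  qed
  then show ?thesis unfolding antidiagonal_def .
qed

lemma computable_fst_prod_decode: "computable (\<lambda>x. fst (prod_decode x))"
proof -
  have "computable (\<lambda>x. x - triangle (antidiagonal x))"
    unfolding computable_def
    by (intro total_recursive_arith total_recursive_computable[OF computable_triangle]
        total_recursive_computable[OF computable_antidiagonal]) simp_all
  moreover have "x - triangle (antidiagonal x) = fst (prod_decode x)" for x
  proof -
    obtain a b where "x = prod_encode (a, b)" by (metis prod_decode_inverse surj_pair)
    then show ?thesis by (simp add: antidiagonal_prod_encode) (simp add: prod_encode_def)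
  qed
  ultimately show ?thesis by simp
qed

lemma computable_snd_prod_decode: "computable (\<lambda>x. snd (prod_decode x))"
proof -
  have "computable (\<lambda>x. antidiagonal x - fst (prod_decode x))"
    unfolding computable_def
    by (intro total_recursive_arith total_recursive_computable[OF computable_fst_prod_decode]
        total_recursive_computable[OF computable_antidiagonal]) simp_all
  moreover have "antidiagonal x - fst (prod_decode x) = snd (prod_decode x)" for x
  proof -
    obtain a b where "x = prod_encode (a, b)" by (metis prod_decode_inverse surj_pair)
    then show ?thesis by (simp add: antidiagonal_prod_encode)
  qed
  ultimately show ?thesis by simp
qed

lemma total_recursive_fst: "total_recursive n f \<Longrightarrow> total_recursive n (\<lambda>xs. fst (prod_decode (f xs)))"
  by (rule total_recursive_computable[OF computable_fst_prod_decode])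

lemma total_recursive_snd: "total_recursive n f \<Longrightarrow> total_recursive n (\<lambda>xs. snd (prod_decode (f xs)))"
  by (rule total_recursive_computable[OF computable_snd_prod_decode])

lemma length_le_list_encode: "length l \<le> list_encode l"
proof (induction l)
  case (Cons a l)
  then show ?case using le_prod_encode_2[of "list_encode l" a] by simp
qed simp

text \<open>
  Recursion over a coded list is reduced to iteration of a step that acts on a pair, namely the
  code of the remaining list and the accumulator. The step leaves an exhausted list unchanged, so
  the code itself, which is at least the length of the list, can serve as the number of
  iterations.
\<close>

lemma total_recursive_foldl:
  assumes step: "computable2 step" and f: "total_recursive n f" and g: "total_recursive n g"
  shows "total_recursive n (\<lambda>xs. foldl step (g xs) (list_decode (f xs)))"
proof -
  \<comment> \<open>the code of a nonempty list is the successor of the code of its head and tail\<close>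
  define next_state where "next_state s =
    (if fst (prod_decode s) = 0 then s
     else prod_encode (snd (prod_decode (fst (prod_decode s) - 1)),
       step (snd (prod_decode s)) (fst (prod_decode (fst (prod_decode s) - 1)))))" for s
  have "computable next_state"
    unfolding next_state_def computable_def
    by (intro total_recursive_if total_recursive_prod_encode total_recursive_fst total_recursive_snd
        total_recursive_pred total_recursive_computable2[OF step] total_recursive.proj) simp_all
  from total_recursive_funpow[OF this f total_recursive_prod_encode[OF f g]]
  have "total_recursive n (\<lambda>xs. snd (prod_decode ((next_state ^^ f xs) (prod_encode (f xs, g xs)))))"
    by (rule total_recursive_snd)
  moreover have "(next_state ^^ m) (prod_encode (list_encode l, r)) = prod_encode (0, foldl step r l)"
    if "length l \<le> m" for m l r
    using that
  proof (induction l arbitrary: m r)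
    case Nil
    have "next_state (prod_encode (0, r)) = prod_encode (0, r)" for r by (simp add: next_state_def)
    then show ?case by (induction m) auto
  next
    case (Cons x l)
    then obtain m' where m: "m = Suc m'" "length l \<le> m'" by (cases m) auto
    have "next_state (prod_encode (list_encode (x # l), r)) = prod_encode (list_encode l, step r x)"
      by (simp add: next_state_def)
    then show ?case using Cons.IH[OF m(2)] by (simp add: m(1) funpow_Suc_right del: funpow.simps list_encode.simps)
  qed
  from this[OF length_le_list_encode]
  have "snd (prod_decode ((next_state ^^ y) (prod_encode (y, r)))) = foldl step r (list_decode y)" for y r
    by (metis list_decode_inverse prod_encode_inverse snd_conv)
  ultimately show ?thesis by simp
qed

lemma computable_compose: "computable f \<Longrightarrow> computable g \<Longrightarrow> computable (\<lambda>x. f (g x))"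
  unfolding computable_def[of g] computable_def[of "\<lambda>x. f (g x)"] by (rule total_recursive_computable)

lemma decidable_nats_vimage:
  "decidable_nats D \<Longrightarrow> computable f \<Longrightarrow> decidable_nats {x. f x \<in> D}"
  unfolding decidable_nats_def using computable_compose[of "\<lambda>x. if x \<in> D then 1 else 0" f] by simp

lemma decidable_nats_Un:
  assumes "decidable_nats D" "decidable_nats E"
  shows "decidable_nats (D \<union> E)"
proof -
  have "computable (\<lambda>x. if (if x \<in> D then 1 else 0) = (0 :: nat) then (if x \<in> E then 1 else 0) else 1)"
    using assms unfolding decidable_nats_def computable_def
    by (intro total_recursive_if total_recursive_const) simp_all
  then show ?thesis unfolding decidable_nats_def by (rule back_subst[of computable]) auto
qed

lemma decidable_nats_Int:
  assumes "decidable_nats D" "decidable_nats E"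
  shows "decidable_nats (D \<inter> E)"
proof -
  have "computable (\<lambda>x. if (if x \<in> D then 1 else 0) = (0 :: nat) then 0 else (if x \<in> E then 1 else 0))"
    using assms unfolding decidable_nats_def computable_def
    by (intro total_recursive_if total_recursive_const) simp_all
  then show ?thesis unfolding decidable_nats_def by (rule back_subst[of computable]) auto
qed

lemma decidable_nats_empty: "decidable_nats {}"
  unfolding decidable_nats_def computable_def by (simp add: total_recursive.zero)

lemma decidable_nats_UN:
  "finite I \<Longrightarrow> (\<And>i. i \<in> I \<Longrightarrow> decidable_nats (D i)) \<Longrightarrow> decidable_nats (\<Union>i\<in>I. D i)"
  by (induction I rule: finite_induct) (auto intro: decidable_nats_Un decidable_nats_empty)

lemma decidable_nats_eq:
  assumes "computable f" "computable g"
  shows "decidable_nats {x. f x = g x}"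
proof -
  have "computable (\<lambda>x. if (f x - g x) + (g x - f x) = 0 then 1 else 0)"
    using assms unfolding computable_def
    by (intro total_recursive_if total_recursive_add total_recursive_diff total_recursive_const)
  then show ?thesis unfolding decidable_nats_def by (rule back_subst[of computable]) auto
qed

lemma computable_const: "computable (\<lambda>x. c)"
  by (simp add: computable_def total_recursive_const)

lemma computable_id: "computable (\<lambda>x. x)"
  by (simp add: computable_def total_recursive.proj)

text \<open>
  A left fold that pushes each entry in turn reverses the list, so reversal has to appear in this
  statement; with an empty second list it gives reversal alone, which repairs the order in
  \<open>computable_rev_map_filter\<close>.
\<close>

lemma computable_rev_append:
  assumes "computable f" "computable g"
  shows "computable (\<lambda>x. list_encode (rev (list_decode (f x)) @ list_decode (g x)))"
proof -
  let ?push = "\<lambda>acc y. Suc (prod_encode (y, acc))"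
  have "computable2 ?push"
    unfolding computable2_def
    by (intro total_recursive_Suc total_recursive_prod_encode total_recursive.proj) simp_all
  then have "computable (\<lambda>x. foldl ?push (g x) (list_decode (f x)))"
    using assms unfolding computable_def by (intro total_recursive_foldl)
  moreover have "foldl ?push r l = list_encode (rev l @ list_decode r)" for l r
    by (induction l arbitrary: r) auto
  ultimately show ?thesis by simp
qed

lemma computable_rev_map_filter:
  assumes g: "computable g" and P: "decidable_nats {x. P x}"
  shows "computable (\<lambda>x. list_encode (rev (map g (filter P (list_decode x)))))"
proof -
  let ?step = "\<lambda>acc y. if (if y \<in> {x. P x} then 1 else 0) = (0 :: nat) then acc
    else Suc (prod_encode (g y, acc))"
  have "computable2 ?step"
    unfolding computable2_def
    by (intro total_recursive_if total_recursive_Suc total_recursive_prod_encode total_recursive.proj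
        total_recursive_computable[OF g] total_recursive_computable[OF P[unfolded decidable_nats_def]]) simp_all
  then have "computable (\<lambda>x. foldl ?step 0 (list_decode x))"
    unfolding computable_def by (intro total_recursive_foldl total_recursive.proj total_recursive.zero) simp_all
  moreover have "foldl ?step (list_encode r) l = list_encode (rev (map g (filter P l)) @ r)" for l r
    by (induction l arbitrary: r) (auto simp flip: list_encode.simps)
  from this[of "[]"] have "foldl ?step 0 l = list_encode (rev (map g (filter P l)))" for l by simp
  ultimately show ?thesis by simp
qed

text \<open>
  Letters of the first alphabet get even codes and those of the second alphabet odd codes. A list
  of codes is in the product if and only if its even entries precede its odd entries and the two
  sublists, with codes halved, are in the factors.
\<close>

lemma decidable_image_concat:
  assumes U: "decidable_nats (list_encode ` U)" and W: "decidable_nats (list_encode ` W)"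
  shows "decidable_nats (list_encode ` image_concat (\<lambda>n. 2 * n) (\<lambda>n. Suc (2 * n)) U W)"
proof -
  have dec: "decidable_nats {x. even x}" "decidable_nats {x. odd x}"
    using decidable_nats_eq[OF computable_mod2 computable_const[of 0]]
      decidable_nats_eq[OF computable_mod2 computable_const[of 1]]
    by (simp_all only: even_iff_mod_2_eq_zero[symmetric] odd_iff_mod_2_eq_one[symmetric])
  have parts: "computable (\<lambda>x. list_encode (map (\<lambda>n. n div 2) (filter P (list_decode x))))"
    if "decidable_nats {x. P x}" for P
    using computable_rev_append[OF computable_rev_map_filter[OF computable_div2 that] computable_const[of 0]]
    by simp
  have sorted: "computable (\<lambda>x. list_encode (filter even (list_decode x) @ filter odd (list_decode x)))"
    using computable_rev_append[OF computable_rev_map_filter[OF computable_id dec(1)]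
        computable_rev_append[OF computable_rev_map_filter[OF computable_id dec(2)] computable_const[of 0]]]
    by simp
  have code: "x \<in> list_encode ` V \<longleftrightarrow> list_decode x \<in> V" for x V
    by (metis imageE image_eqI list_decode_inverse list_encode_inverse)
  have mem: "l \<in> image_concat (\<lambda>n. 2 * n) (\<lambda>n. Suc (2 * n)) U W \<longleftrightarrow>
      map (\<lambda>n. n div 2) (filter even l) \<in> U \<and> map (\<lambda>n. n div 2) (filter odd l) \<in> W \<and>
      filter even l @ filter odd l = l" for l
  proof
    assume "l \<in> image_concat (\<lambda>n. 2 * n) (\<lambda>n. Suc (2 * n)) U W"
    then obtain u w where l: "l = map (\<lambda>n. 2 * n) u @ map (\<lambda>n. Suc (2 * n)) w" "u \<in> U" "w \<in> W"
      by (auto simp: image_concat_def)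
    have "filter even l = map (\<lambda>n. 2 * n) u" "filter odd l = map (\<lambda>n. Suc (2 * n)) w"
      by (auto simp: l filter_map comp_def)
    with l(2,3) show "map (\<lambda>n. n div 2) (filter even l) \<in> U \<and> map (\<lambda>n. n div 2) (filter odd l) \<in> W \<and>
      filter even l @ filter odd l = l" unfolding l(1) by (simp add: comp_def)
  next
    assume l: "map (\<lambda>n. n div 2) (filter even l) \<in> U \<and> map (\<lambda>n. n div 2) (filter odd l) \<in> W \<and>
      filter even l @ filter odd l = l"
    have "map (\<lambda>n. 2 * n) (map (\<lambda>n. n div 2) (filter even l)) = filter even l"
      "map (\<lambda>n. Suc (2 * n)) (map (\<lambda>n. n div 2) (filter odd l)) = filter odd l"
      by (induction l) auto
    with l have "l = map (\<lambda>n. 2 * n) (map (\<lambda>n. n div 2) (filter even l)) @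
        map (\<lambda>n. Suc (2 * n)) (map (\<lambda>n. n div 2) (filter odd l))" by argo
    with l show "l \<in> image_concat (\<lambda>n. 2 * n) (\<lambda>n. Suc (2 * n)) U W"
      unfolding image_concat_def by blast
  qed
  have "list_encode ` image_concat (\<lambda>n. 2 * n) (\<lambda>n. Suc (2 * n)) U W =
    {x. list_encode (map (\<lambda>n. n div 2) (filter even (list_decode x))) \<in> list_encode ` U} \<inter>
    ({x. list_encode (map (\<lambda>n. n div 2) (filter odd (list_decode x))) \<in> list_encode ` W} \<inter>
    {x. list_encode (filter even (list_decode x) @ filter odd (list_decode x)) = x})"
  proof -
    have "list_encode l = x \<longleftrightarrow> l = list_decode x" for l x by auto
    then show ?thesis by (simp add: set_eq_iff code mem)
  qed
  then show ?thesis using U W parts[OF dec(1)] parts[OF dec(2)] sorted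
    by (auto intro!: decidable_nats_Int decidable_nats_vimage decidable_nats_eq computable_id)
qed

lemma decidable_nats_last:
  "decidable_nats {x. list_decode x \<noteq> [] \<and> last (list_decode x) = c}"
proof -
  have "computable2 (\<lambda>acc y. Suc y)"
    unfolding computable2_def by (intro total_recursive_Suc total_recursive.proj) simp
  then have "computable (\<lambda>x. foldl (\<lambda>acc y. Suc y) 0 (list_decode x))"
    unfolding computable_def by (intro total_recursive_foldl total_recursive.proj total_recursive.zero) simp_all
  from decidable_nats_eq[OF this computable_const[of "Suc c"]]
  have "decidable_nats {x. foldl (\<lambda>acc y. Suc y) 0 (list_decode x) = Suc c}" .
  moreover have "foldl (\<lambda>acc y. Suc y) 0 l = Suc c \<longleftrightarrow> l \<noteq> [] \<and> last l = c" for l :: "nat list"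
    by (cases l rule: rev_cases) auto
  ultimately show ?thesis by simp
qed

text \<open>
  The letters are numbered by \<open>c\<close>, and words are coded as in \<open>decidable_set\<close>.
\<close>

definition decidable_language :: "('a \<Rightarrow> nat) \<Rightarrow> 'a list set \<Rightarrow> bool" where
  "decidable_language c L \<longleftrightarrow> decidable_nats (list_encode ` map c ` L)"

lemma decidable_language_empty: "decidable_language c {}"
  by (simp add: decidable_language_def decidable_nats_empty)

lemma decidable_language_Nil: "decidable_language c {[]}"
  using decidable_nats_eq[OF computable_id computable_const[of 0]]
  by (simp add: decidable_language_def)

lemma decidable_language_UN:
  "finite I \<Longrightarrow> (\<And>i. i \<in> I \<Longrightarrow> decidable_language c (L i)) \<Longrightarrow> decidable_language c (\<Union>i\<in>I. L i)"
  using decidable_nats_UN[of I "\<lambda>i. list_encode ` map c ` L i"]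
  by (simp add: decidable_language_def image_UN)

lemma decidable_language_last:
  assumes inj: "inj_on c A" and L: "L \<subseteq> lists A" "decidable_language c L" and b: "b \<in> A"
  shows "decidable_language c {w \<in> L. w \<noteq> [] \<and> last w = b}"
proof -
  have "list_encode ` map c ` {w \<in> L. w \<noteq> [] \<and> last w = b} =
    list_encode ` map c ` L \<inter> {x. list_decode x \<noteq> [] \<and> last (list_decode x) = c b}"
  proof -
    have "last w = b" if "w \<in> L" "w \<noteq> []" "c (last w) = c b" for w
      using inj_onD[OF inj that(3) _ b] L(1) that by (force simp: in_lists_conv_set)
    then show ?thesis by (auto simp: last_map)
  qed
  then show ?thesis using L(2) unfolding decidable_language_def
    by (auto intro: decidable_nats_Int decidable_nats_last)
qed

text \<open>
  Any numbering of the joint alphabet that extends the doubled numberings will do; for the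
  extension \<open>G\<close> one such numbering is built from the given numberings for \<open>K\<close> and \<open>Q\<close>.
\<close>

lemma decidable_language_image_concat:
  assumes U: "decidable_language cA U" "U \<subseteq> lists A" and W: "decidable_language cB W" "W \<subseteq> lists B"
    and c: "\<And>a. a \<in> A \<Longrightarrow> c (f a) = 2 * cA a" "\<And>b. b \<in> B \<Longrightarrow> c (h b) = Suc (2 * cB b)"
  shows "decidable_language c (image_concat f h U W)"
proof -
  have "map c (map f u @ map h w) = map (\<lambda>n. 2 * n) (map cA u) @ map (\<lambda>n. Suc (2 * n)) (map cB w)"
    if "u \<in> U" "w \<in> W" for u w
    using c U(2) W(2) that by (auto simp: in_lists_conv_set subset_iff)
  then have "map c ` image_concat f h U W =
      image_concat (\<lambda>n. 2 * n) (\<lambda>n. Suc (2 * n)) (map cA ` U) (map cB ` W)"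
    unfolding image_concat_def by (fastforce simp: image_iff simp del: map_append map_map)
  then show ?thesis using decidable_image_concat U(1) W(1) unfolding decidable_language_def by simp
qed

lemma decidable_fiber:
  assumes "inj_on c A" and L: "L \<subseteq> word_tuples 3 A"
    and rec: "recursive_relation 3 (map (\<lambda>u. list_encode (map c u)) ` L)"
  shows "decidable_language c (fiber L [v, w])"
proof (cases "v \<in> lists A \<and> w \<in> lists A")
  case False
  then have "fiber L [v, w] = {}" using L by (force simp: fiber_def word_tuples_def)
  then show ?thesis by (simp add: decidable_language_empty)
next
  case True
  let ?e = "\<lambda>u. list_encode (map c u)"
  obtain f where f: "total_recursive 3 f"
    "\<And>xs. length xs = 3 \<Longrightarrow> f xs = (if xs \<in> map ?e ` L then 1 else 0)"
    using rec by (auto simp: recursive_relation_def)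
  have "total_recursive (length [\<lambda>xs. xs ! 0, \<lambda>xs. ?e v, \<lambda>xs. ?e w]) f"
    using f(1) by (simp add: numeral_3_eq_3)
  from total_recursive.comp[OF this, of 1] have "computable (\<lambda>x. f [x, ?e v, ?e w])"
    by (simp add: computable_def total_recursive_const total_recursive.proj)
  moreover have "[x, ?e v, ?e w] \<in> map ?e ` L \<longleftrightarrow> x \<in> list_encode ` map c ` fiber L [v, w]" for x
  proof
    assume "[x, ?e v, ?e w] \<in> map ?e ` L"
    then obtain us where us: "us \<in> L" "map ?e us = [x, ?e v, ?e w]" by auto
    then obtain u v' w' where *: "us = [u, v', w']" "?e u = x" "?e v' = ?e v" "?e w' = ?e w"
      by (auto simp: map_eq_Cons_conv)
    moreover have "v' \<in> lists A" "w' \<in> lists A"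
      using us(1) L unfolding *(1) by (force simp: word_tuples_def simp del: in_lists_conv_set)+
    ultimately have "v' = v" "w' = w"
      using True inj_on_map_lists[OF \<open>inj_on c A\<close>] by (auto simp: list_encode_eq dest: inj_onD)
    with us * show "x \<in> list_encode ` map c ` fiber L [v, w]" by (auto simp: fiber_def)
  qed (force simp: fiber_def)
  ultimately show ?thesis unfolding decidable_language_def decidable_nats_def by (simp add: f(2))
qed

text \<open>
  The characteristic function of the relation is a finite case distinction on the last two
  arguments.
\<close>

lemma recursive_relation_of_fibers:
  assumes fin: "finite V" and L: "L \<subseteq> {us. length us = 3}"
    and tails: "\<And>us. us \<in> L \<Longrightarrow> tl us \<in> V"
    and dec: "\<And>vs. vs \<in> V \<Longrightarrow> decidable_language c (fiber L vs)"
  shows "recursive_relation 3 (map (\<lambda>u. list_encode (map c u)) ` L)"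
proof -
  let ?e = "\<lambda>u. list_encode (map c u)"
  let ?S = "\<lambda>vs. {x # map ?e vs | x. x \<in> list_encode ` map c ` fiber L vs}"
  have single: "\<exists>f. total_recursive 3 f \<and> (\<forall>xs. length xs = 3 \<longrightarrow> f xs = (if xs \<in> ?S vs then 1 else 0))"
    if "vs \<in> V" for vs
  proof (cases "length vs = 2")
    case False
    then have "xs \<notin> ?S vs" if "length xs = 3" for xs using that by auto
    then show ?thesis by (intro exI[of _ "\<lambda>xs. 0"]) (auto intro: total_recursive.zero)
  next
    case True
    then obtain v w where vs: "vs = [v, w]" by (auto simp: numeral_2_eq_2 length_Suc_conv)
    let ?char = "\<lambda>x. if x \<in> list_encode ` map c ` fiber L vs then 1 else 0 :: nat"
    let ?f = "\<lambda>xs. if ((xs ! 1 - ?e v) + (?e v - xs ! 1)) + ((xs ! 2 - ?e w) + (?e w - xs ! 2)) = 0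
      then ?char (xs ! 0) else 0"
    have "total_recursive 3 ?f"
      using dec[OF that] unfolding decidable_language_def decidable_nats_def
      by (intro total_recursive_if total_recursive_add total_recursive_diff total_recursive_const
          total_recursive.proj total_recursive_computable[of ?char]) simp_all
    moreover have "?f xs = (if xs \<in> ?S vs then 1 else 0)" if len: "length xs = 3" for xs
    proof -
      obtain x y z where "xs = [x, y, z]"
        using len by (cases xs; cases "tl xs"; cases "tl (tl xs)") auto
      then show ?thesis by (auto simp: vs)
    qed
    ultimately show ?thesis by blast
  qed
  have union: "\<exists>f. total_recursive 3 f \<and> (\<forall>xs. length xs = 3 \<longrightarrow> f xs = (if xs \<in> S \<union> S' then 1 else 0))"
    if S: "\<exists>f. total_recursive 3 f \<and> (\<forall>xs. length xs = 3 \<longrightarrow> f xs = (if xs \<in> S then 1 else 0))"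
      and S': "\<exists>f. total_recursive 3 f \<and> (\<forall>xs. length xs = 3 \<longrightarrow> f xs = (if xs \<in> S' then 1 else 0))"
    for S S' :: "nat list set"
  proof -
    from S S' obtain f g where "total_recursive 3 f" "\<forall>xs. length xs = 3 \<longrightarrow> f xs = (if xs \<in> S then 1 else 0)"
      "total_recursive 3 g" "\<forall>xs. length xs = 3 \<longrightarrow> g xs = (if xs \<in> S' then 1 else 0)" by blast
    then show ?thesis
      by (intro exI[of _ "\<lambda>xs. if f xs = 0 then g xs else 1"])
        (simp add: total_recursive_if total_recursive_const)
  qed
  have "\<exists>f. total_recursive 3 f \<and> (\<forall>xs. length xs = 3 \<longrightarrow> f xs = (if xs \<in> (\<Union>vs\<in>I. ?S vs) then 1 else 0))"
    if "finite I" "I \<subseteq> V" for I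
    using that
  proof (induction I rule: finite_induct)
    case empty
    then show ?case by (intro exI[of _ "\<lambda>xs. 0"]) (auto intro: total_recursive.zero)
  next
    case (insert vs I)
    from insert.prems have vs: "vs \<in> V" and I: "I \<subseteq> V" by auto
    show ?case unfolding UN_insert by (rule union[OF single[OF vs] insert.IH[OF I]])
  qed
  from this[OF fin order.refl] have
    rec: "\<exists>f. total_recursive 3 f \<and> (\<forall>xs. length xs = 3 \<longrightarrow> f xs = (if xs \<in> (\<Union>vs\<in>V. ?S vs) then 1 else 0))" .
  have "map ?e ` L = (\<Union>vs\<in>V. ?S vs)"
  proof (intro equalityI subsetI)
    fix xs assume "xs \<in> map ?e ` L"
    then obtain us where us: "us \<in> L" "xs = map ?e us" by auto
    with L obtain u vs where "us = u # vs" by (cases us) auto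
    with us tails[OF us(1)] show "xs \<in> (\<Union>vs\<in>V. ?S vs)" by (auto simp: fiber_def)
  next
    fix xs assume "xs \<in> (\<Union>vs\<in>V. ?S vs)"
    then obtain u vs where "u # vs \<in> L" "xs = map ?e (u # vs)" by (auto simp: fiber_def)
    then show "xs \<in> map ?e ` L" by blast
  qed
  moreover have "map ?e ` L \<subseteq> {xs. length xs = 3}" using L by auto
  ultimately show ?thesis using rec unfolding recursive_relation_def by simp
qed

section \<open>Maximal trees and prefix-closed normal forms\<close>

text \<open>
  Words enter the group lemmas below through membership in \<open>lists A\<close>, so classical rules that unfold
  this membership get in the way.
\<close>

declare in_listsI [rule del] in_listsD [rule del]

primrec word_val :: "('a, 'b) monoid_scheme \<Rightarrow> 'a list \<Rightarrow> 'a" where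
  "word_val G [] = \<one>\<^bsub>G\<^esub>"
| "word_val G (a # w) = a \<otimes>\<^bsub>G\<^esub> word_val G w"

primrec trace :: "('a, 'b) monoid_scheme \<Rightarrow> 'a \<Rightarrow> 'a list \<Rightarrow> ('a \<times> 'a) list" where
  "trace G g [] = []"
| "trace G g (a # w) = (g, a) # trace G (g \<otimes>\<^bsub>G\<^esub> a) w"

text \<open>
  A choice of one representing word for each group element, closed under prefixes: a
  representative without its last letter is again a representative.
\<close>

definition tree_forms :: "('a, 'b) monoid_scheme \<Rightarrow> 'a set \<Rightarrow> ('a \<Rightarrow> 'a list) \<Rightarrow> bool" where
  "tree_forms G A y \<longleftrightarrow>
     (\<forall>g\<in>carrier G. y g \<in> lists A \<and> word_val G (y g) = g) \<and>
     (\<forall>g\<in>carrier G. \<forall>w a. y g = w @ [a] \<longrightarrow> y (g \<otimes>\<^bsub>G\<^esub> inv\<^bsub>G\<^esub> a) = w)"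

text \<open>
  The tree spanned by such a choice: its edges are the last edges of the paths from the identity
  that are labeled by the representatives.
\<close>

definition forms_tree :: "('a, 'b) monoid_scheme \<Rightarrow> 'a set \<Rightarrow> ('a \<Rightarrow> 'a list) \<Rightarrow> ('a \<times> 'a) set set" where
  "forms_tree G A y = {undirected G (g, a) | g a. g \<in> carrier G \<and> a \<in> A \<and> y (g \<otimes>\<^bsub>G\<^esub> a) = y g @ [a]}"

lemma path_label_trace [simp]: "path_label (trace G g w) = w"
  unfolding path_label_def by (induction w arbitrary: g) auto

lemma length_trace [simp]: "length (trace G g w) = length w"
  by (induction w arbitrary: g) auto

locale cayley = group G for G :: "('a, 'b) monoid_scheme" (structure) +
  fixes A :: "'a set"
  assumes gen: "generating_set G A"
begin

lemma letter_closed [simp]: "a \<in> A \<Longrightarrow> a \<in> carrier G"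
  and inv_letter [simp]: "a \<in> A \<Longrightarrow> inv a \<in> A"
  and one_not_letter [simp]: "\<one> \<notin> A"
  and finite_letters [simp]: "finite A"
  using gen by (auto simp: generating_set_def)

abbreviation val :: "'a list \<Rightarrow> 'a" where "val \<equiv> word_val G"

lemma take_lists [simp]: "w \<in> lists A \<Longrightarrow> take i w \<in> lists A"
  and drop_lists [simp]: "w \<in> lists A \<Longrightarrow> drop i w \<in> lists A"
  by (auto simp: in_lists_conv_set dest: in_set_takeD in_set_dropD)

lemma val_closed [simp]: "w \<in> lists A \<Longrightarrow> val w \<in> carrier G"
  by (induction w) auto

lemma val_append [simp]: "v \<in> lists A \<Longrightarrow> w \<in> lists A \<Longrightarrow> val (v @ w) = val v \<otimes> val w"
  by (induction v) (auto simp: m_assoc)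

lemma trace_append: "g \<in> carrier G \<Longrightarrow> v \<in> lists A \<Longrightarrow> trace G g (v @ w) = trace G g v @ trace G (g \<otimes> val v) w"
  by (induction v arbitrary: g) (auto simp: m_assoc)

lemma trace_arcs:
  "g \<in> carrier G \<Longrightarrow> w \<in> lists A \<Longrightarrow> set (trace G g w) \<subseteq> arcs (cayley_graph G A)"
  by (induction w arbitrary: g) (auto simp: cayley_graph_def)

lemma arcs_cayley [simp]: "(g, a) \<in> arcs (cayley_graph G A) \<longleftrightarrow> g \<in> carrier G \<and> a \<in> A"
  by (simp add: cayley_graph_def)

text \<open>
  A path in the Cayley graph is determined by its start and its label, so that paths can be
  replaced by words from here on.
\<close>

lemma awalk_iff_trace:
  assumes E: "E \<subseteq> arcs (cayley_graph G A)"
  shows "pre_digraph.awalk ((cayley_graph G A)\<lparr>arcs := E\<rparr>) g p h \<longleftrightarrow>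
    (\<exists>w\<in>lists A. g \<in> carrier G \<and> p = trace G g w \<and> set p \<subseteq> E \<and> h = g \<otimes> val w)"
proof (induction p arbitrary: g)
  case Nil
  then show ?case
    by (auto simp: pre_digraph.awalk_def pre_digraph.cas.simps cayley_graph_def intro!: bexI[of _ "[]"]
        elim: lists.cases)
next
  case (Cons e p)
  obtain g' a where e: "e = (g', a)" by (cases e)
  show ?case
  proof
    assume l: "pre_digraph.awalk ((cayley_graph G A)\<lparr>arcs := E\<rparr>) g (e # p) h"
    then have *: "g' = g" "g \<in> carrier G" "(g, a) \<in> E"
      "pre_digraph.awalk ((cayley_graph G A)\<lparr>arcs := E\<rparr>) (g \<otimes> a) p h"
      using E by (auto simp: e pre_digraph.awalk_def pre_digraph.cas.simps cayley_graph_def)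
    from Cons.IH[of "g \<otimes> a"] *(4) obtain w where
      "w \<in> lists A" "p = trace G (g \<otimes> a) w" "set p \<subseteq> E" "h = g \<otimes> a \<otimes> val w" by auto
    moreover have "a \<in> A" using *(3) E by auto
    ultimately show "\<exists>w\<in>lists A. g \<in> carrier G \<and> e # p = trace G g w \<and> set (e # p) \<subseteq> E \<and> h = g \<otimes> val w"
      using * by (intro bexI[of _ "a # w"]) (auto simp: e m_assoc)
  next
    assume "\<exists>w\<in>lists A. g \<in> carrier G \<and> e # p = trace G g w \<and> set (e # p) \<subseteq> E \<and> h = g \<otimes> val w"
    then obtain w where w: "w \<in> lists A" "g \<in> carrier G" "e # p = trace G g w" "set (e # p) \<subseteq> E" "h = g \<otimes> val w"
      by blast
    then obtain w' where w': "w = a # w'" "g' = g" "p = trace G (g \<otimes> a) w'" by (cases w) (auto simp: e)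
    with w have "pre_digraph.awalk ((cayley_graph G A)\<lparr>arcs := E\<rparr>) (g \<otimes> a) p h"
      by (subst Cons.IH) (auto simp: m_assoc intro!: bexI[of _ w'])
    then show "pre_digraph.awalk ((cayley_graph G A)\<lparr>arcs := E\<rparr>) g (e # p) h"
      using w w' by (auto simp: e pre_digraph.awalk_def pre_digraph.cas.simps cayley_graph_def)
  qed
qed

lemma awalk_cayley_iff:
  "pre_digraph.awalk (cayley_graph G A) g p h \<longleftrightarrow>
    (\<exists>w\<in>lists A. g \<in> carrier G \<and> p = trace G g w \<and> h = g \<otimes> val w)"
  using awalk_iff_trace[OF order.refl] trace_arcs by fastforce

definition tree_walk :: "('a \<times> 'a) set set \<Rightarrow> 'a \<Rightarrow> 'a list \<Rightarrow> bool" where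
  "tree_walk T g w \<longleftrightarrow> g \<in> carrier G \<and> w \<in> lists A \<and> (\<forall>e\<in>set (trace G g w). undirected G e \<in> T)"

lemma awalk_subgraph_iff:
  "pre_digraph.awalk (edge_subgraph G A T) g p h \<longleftrightarrow>
    (\<exists>w. tree_walk T g w \<and> p = trace G g w \<and> h = g \<otimes> val w)"
proof -
  have "pre_digraph.awalk (edge_subgraph G A T) g p h \<longleftrightarrow>
    (\<exists>w\<in>lists A. g \<in> carrier G \<and> p = trace G g w \<and>
      set p \<subseteq> {e \<in> arcs (cayley_graph G A). undirected G e \<in> T} \<and> h = g \<otimes> val w)"
    unfolding edge_subgraph_def by (rule awalk_iff_trace) auto
  also have "\<dots> \<longleftrightarrow> (\<exists>w. tree_walk T g w \<and> p = trace G g w \<and> h = g \<otimes> val w)"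
    using trace_arcs unfolding tree_walk_def by fastforce
  finally show ?thesis .
qed

lemma tree_walk_append:
  "v \<in> lists A \<Longrightarrow> tree_walk T g (v @ w) \<longleftrightarrow> tree_walk T g v \<and> tree_walk T (g \<otimes> val v) w"
  by (auto simp: tree_walk_def trace_append)

lemma tree_walk_lists: "tree_walk T g w \<Longrightarrow> w \<in> lists A"
  by (simp add: tree_walk_def)

lemma undirected_rev: "g \<in> carrier G \<Longrightarrow> a \<in> A \<Longrightarrow> undirected G (g \<otimes> a, inv a) = undirected G (g, a)"
  by (auto simp: undirected_def rev_edge_def m_assoc)

definition word_inv :: "'a list \<Rightarrow> 'a list" where
  "word_inv w = rev (map (m_inv G) w)"

lemma word_inv_lists [simp]: "w \<in> lists A \<Longrightarrow> word_inv w \<in> lists A"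
  by (auto simp: word_inv_def in_lists_conv_set)

lemma word_inv_append [simp]: "word_inv (v @ w) = word_inv w @ word_inv v"
  by (simp add: word_inv_def)

lemma word_inv_single [simp]: "word_inv [a] = [inv a]" "word_inv [] = []"
  by (simp_all add: word_inv_def)

lemma val_word_inv [simp]: "w \<in> lists A \<Longrightarrow> val (word_inv w) = inv (val w)"
proof (induction w)
  case (Cons a w)
  then show ?case using val_append[of "word_inv w" "[inv a]"] word_inv_append[of "[a]" w]
    by (simp add: inv_mult_group)
qed simp

lemma tree_walk_inv: "tree_walk T g w \<Longrightarrow> tree_walk T (g \<otimes> val w) (word_inv w)"
proof (induction w arbitrary: g)
  case Nil
  then show ?case by (simp add: tree_walk_def)
next
  case (Cons a w)
  then have *: "a \<in> A" "g \<in> carrier G" "w \<in> lists A" "tree_walk T (g \<otimes> a) w" "undirected G (g, a) \<in> T"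
    by (auto simp: tree_walk_def)
  then have "tree_walk T (g \<otimes> a \<otimes> val w) (word_inv w)" using Cons.IH by simp
  moreover have "tree_walk T (g \<otimes> a) [inv a]" using * by (simp add: tree_walk_def undirected_rev)
  ultimately show ?case using * word_inv_append[of "[a]" w]
    by (simp add: tree_walk_append m_assoc r_cancel_one' inv_solve_right)
qed

definition reduced :: "'a list \<Rightarrow> bool" where
  "reduced w \<longleftrightarrow> successively (\<lambda>a b. b \<noteq> inv a) w"

lemma reduced_simps [simp]:
  "reduced []" "reduced [a]" "reduced (a # b # w) \<longleftrightarrow> b \<noteq> inv a \<and> reduced (b # w)"
  by (auto simp: reduced_def)

lemma reduced_append:
  "reduced (v @ w) \<longleftrightarrow> reduced v \<and> reduced w \<and> (v \<noteq> [] \<longrightarrow> w \<noteq> [] \<longrightarrow> hd w \<noteq> inv (last v))"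
  by (auto simp: reduced_def successively_append_iff)

lemma not_reducedE:
  assumes "\<not> reduced w"
  obtains v a z where "w = v @ [a, inv a] @ z"
proof -
  have "\<not> reduced w \<Longrightarrow> \<exists>v a z. w = v @ [a, inv a] @ z"
  proof (induction w rule: induct_list012)
    case (3 a b w)
    show ?case
    proof (cases "b = inv a")
      case True
      then show ?thesis by (intro exI[of _ "[]"]) auto
    next
      case False
      with 3 obtain v c z where "b # w = v @ [c, inv c] @ z" by auto
      then show ?thesis by (intro exI[of _ "a # v"]) auto
    qed
  qed auto
  with assms that show thesis by blast
qed

lemma reduced_word_inv: "w \<in> lists A \<Longrightarrow> reduced w \<Longrightarrow> reduced (word_inv w)"
proof (induction w rule: induct_list012)
  case (3 a b w)
  then have "reduced (word_inv (b # w))" "b \<noteq> inv a" "a \<in> A" "b \<in> A" by auto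
  moreover from this have "a \<noteq> inv b" by (metis inv_inv letter_closed)
  moreover have "word_inv (a # b # w) = word_inv (b # w) @ [inv a]" "word_inv (b # w) \<noteq> []"
    "last (word_inv (b # w)) = inv b"
    by (simp_all add: word_inv_def)
  ultimately show ?case by (simp add: reduced_append)
qed (auto simp: word_inv_def)

lemma no_backtracking_trace:
  assumes "g \<in> carrier G" "w \<in> lists A"
  shows "no_backtracking G (trace G g w) \<longleftrightarrow> reduced w"
proof -
  have "no_backtracking G p \<longleftrightarrow> successively (\<lambda>e e'. e' \<noteq> rev_edge G e) p" for p
    by (auto simp: no_backtracking_def successively_conv_nth)
  moreover have "successively (\<lambda>e e'. e' \<noteq> rev_edge G e) (trace G g w) \<longleftrightarrow> reduced w"
    using assms by (induction w arbitrary: g rule: induct_list012) (auto simp: rev_edge_def)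
  ultimately show ?thesis by simp
qed

text \<open>
  Acyclicity in terms of words, the form that is convenient for comparing two paths with common
  ends.
\<close>

definition no_closed_walks :: "('a \<times> 'a) set set \<Rightarrow> bool" where
  "no_closed_walks T \<longleftrightarrow> (\<forall>g w. tree_walk T g w \<longrightarrow> reduced w \<longrightarrow> val w = \<one> \<longrightarrow> w = [])"

lemma nth_awalk_verts:
  assumes "g \<in> carrier G" "w \<in> lists A" "i \<le> length w"
  shows "pre_digraph.awalk_verts (edge_subgraph G A T) g (trace G g w) ! i = g \<otimes> val (take i w)"
  using assms
proof (induction w arbitrary: g i)
  case Nil
  then show ?case by (simp add: pre_digraph.awalk_verts.simps)
next
  case (Cons a w)
  then show ?case
    by (cases i) (auto simp: pre_digraph.awalk_verts.simps edge_subgraph_def cayley_graph_def m_assoc)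
qed

lemma cycle_iff:
  "(\<exists>p. pre_digraph.cycle (edge_subgraph G A T) p \<and> n \<le> length p) \<longleftrightarrow>
   (\<exists>g w. tree_walk T g w \<and> val w = \<one> \<and> w \<noteq> [] \<and> n \<le> length w \<and>
      inj_on (\<lambda>i. val (take i w)) {1..length w})"
proof -
  let ?vs = "\<lambda>g w. pre_digraph.awalk_verts (edge_subgraph G A T) g (trace G g w)"
  have dist: "distinct (tl (?vs g w)) \<longleftrightarrow> inj_on (\<lambda>i. val (take i w)) {1..length w}"
    if "tree_walk T g w" for g w
  proof -
    from that have g: "g \<in> carrier G" and w: "w \<in> lists A" by (auto simp: tree_walk_def)
    have len: "length (tl (?vs g w)) = length w" by (simp add: pre_digraph.length_awalk_verts)
    have tw: "take i w \<in> lists A" for i using w by simp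
    have nth: "tl (?vs g w) ! i = g \<otimes> val (take (Suc i) w)" if "i < length w" for i
      using that nth_awalk_verts[OF g w, of "Suc i" T] len by (simp add: nth_tl)
    have "distinct (tl (?vs g w)) \<longleftrightarrow> inj_on (\<lambda>i. val (take (Suc i) w)) {..<length w}"
      unfolding distinct_conv_nth len inj_on_def
      using g tw by (auto simp: nth)
    also have "\<dots> \<longleftrightarrow> inj_on (\<lambda>i. val (take i w)) (Suc ` {..<length w})"
      by (auto simp: inj_on_def)
    also have "Suc ` {..<length w} = {1..length w}"
      by (simp add: image_Suc_lessThan)
    finally show ?thesis .
  qed
  have closed: "g = g \<otimes> val w \<longleftrightarrow> val w = \<one>" if "tree_walk T g w" for g w
    using that by (auto simp: tree_walk_def)
  show ?thesis
  proof
    assume "\<exists>p. pre_digraph.cycle (edge_subgraph G A T) p \<and> n \<le> length p"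
    then obtain p g where "pre_digraph.awalk (edge_subgraph G A T) g p g"
      "distinct (tl (pre_digraph.awalk_verts (edge_subgraph G A T) g p))" "p \<noteq> []" "n \<le> length p"
      by (auto simp: pre_digraph.cycle_def)
    then obtain w where w: "tree_walk T g w" "p = trace G g w" "g = g \<otimes> val w" "distinct (tl (?vs g w))"
      unfolding awalk_subgraph_iff by blast
    have "w \<noteq> []" using w(2) \<open>p \<noteq> []\<close> by auto
    moreover have "n \<le> length w" using w(2) \<open>n \<le> length p\<close> by simp
    ultimately show "\<exists>g w. tree_walk T g w \<and> val w = \<one> \<and> w \<noteq> [] \<and> n \<le> length w \<and>
      inj_on (\<lambda>i. val (take i w)) {1..length w}"
      using w dist[OF w(1)] closed[OF w(1)] by blast
  next
    assume "\<exists>g w. tree_walk T g w \<and> val w = \<one> \<and> w \<noteq> [] \<and> n \<le> length w \<and>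
      inj_on (\<lambda>i. val (take i w)) {1..length w}"
    then obtain g w where w: "tree_walk T g w" "val w = \<one>" "w \<noteq> []" "n \<le> length w"
      "inj_on (\<lambda>i. val (take i w)) {1..length w}" by blast
    then have "trace G g w \<noteq> []" by (cases w) auto
    moreover have "pre_digraph.awalk (edge_subgraph G A T) g (trace G g w) g"
      unfolding awalk_subgraph_iff using w(1,2) by (auto simp: tree_walk_def)
    ultimately show "\<exists>p. pre_digraph.cycle (edge_subgraph G A T) p \<and> n \<le> length p"
      using w dist by (intro exI[of _ "trace G g w"]) (auto simp: pre_digraph.cycle_def)
  qed
qed

text \<open>
  If there are no cycles, a shortest nonempty reduced closed walk cannot visit a vertex twice, hence
  would be a cycle; it is not of length 1 because the identity is not a letter, and not of length 2
  because it is reduced. Conversely a cycle of length at least 3 is reduced, as a backtracking step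
  would repeat a vertex two positions apart.
\<close>

lemma no_cycle_iff:
  "\<not> (\<exists>p. pre_digraph.cycle (edge_subgraph G A T) p \<and> 3 \<le> length p) \<longleftrightarrow> no_closed_walks T"
proof
  assume acyc: "\<not> (\<exists>p. pre_digraph.cycle (edge_subgraph G A T) p \<and> 3 \<le> length p)"
  have "w = []" if "tree_walk T g w" "reduced w" "val w = \<one>" for g w
    using that
  proof (induction "length w" arbitrary: g w rule: less_induct)
    case less
    show ?case
    proof (rule ccontr)
      assume ne: "w \<noteq> []"
      have w: "w \<in> lists A" using less.prems tree_walk_lists by blast
      have "3 \<le> length w"
      proof (rule ccontr)
        assume "\<not> 3 \<le> length w"
        with ne consider a where "w = [a]" | a b where "w = [a, b]"
          by (cases w; cases "tl w"; cases "tl (tl w)") auto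
        then show False
        proof cases
          case 1
          then show False using less.prems(3) w by simp
        next
          case 2
          then have "a \<otimes> b = \<one>" "a \<in> A" "b \<in> A" using less.prems(3) w by auto
          then have "inv b = a" by (intro inv_equality) auto
          then have "b = inv a" using \<open>b \<in> A\<close> by auto
          then show False using less.prems(2) 2 by simp
        qed
      qed
      then have "\<not> inj_on (\<lambda>i. val (take i w)) {1..length w}"
        using acyc[unfolded cycle_iff] less.prems(1,3) ne by blast
      then obtain i j where ij: "1 \<le> i" "i < j" "j \<le> length w" "val (take i w) = val (take j w)"
        using linorder_inj_onI[of "{1..length w}" "\<lambda>i. val (take i w)"] by fastforce
      define u where "u = drop i (take j w)"
      have split: "take j w = take i w @ u" using ij append_take_drop_id[of i "take j w"]
        by (simp add: u_def min_absorb2)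
      have wu: "take i w @ u @ drop j w = w" using append_take_drop_id[of j w] unfolding split by simp
      have lists: "take i w \<in> lists A" "u \<in> lists A" "drop j w \<in> lists A"
        using w by (simp_all add: u_def)
      have "val (take i w) \<otimes> val u = val (take i w)"
        using ij(4) lists unfolding split by simp
      then have "val u = \<one>" using lists by simp
      moreover have "tree_walk T g (take i w @ u @ drop j w)" "reduced (take i w @ u @ drop j w)"
        unfolding wu by (rule less.prems)+
      then have "tree_walk T (g \<otimes> val (take i w)) u" "reduced u"
        using lists by (simp_all only: tree_walk_append reduced_append)
      moreover have "length u < length w" "u \<noteq> []" using ij by (auto simp: u_def)
      ultimately show False using less.hyps by blast
    qed
  qed
  then show "no_closed_walks T" unfolding no_closed_walks_def by blast
next
  assume ncw: "no_closed_walks T"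
  show "\<not> (\<exists>p. pre_digraph.cycle (edge_subgraph G A T) p \<and> 3 \<le> length p)"
  proof
    assume "\<exists>p. pre_digraph.cycle (edge_subgraph G A T) p \<and> 3 \<le> length p"
    then obtain g w where w: "tree_walk T g w" "val w = \<one>" "w \<noteq> []" "3 \<le> length w"
      and inj: "inj_on (\<lambda>i. val (take i w)) {1..length w}"
      unfolding cycle_iff by blast
    with ncw have "\<not> reduced w" unfolding no_closed_walks_def by blast
    then obtain v a z where split: "w = v @ [a, inv a] @ z" by (rule not_reducedE)
    let ?i = "length v"
    from tree_walk_lists[OF w(1)] have "v \<in> lists A" "a \<in> A" by (simp_all add: split)
    then have eq: "val (take (?i + 2) w) = val (take ?i w)"
      using val_append[of v "[a, inv a]"] by (simp add: split)
    show False
    proof (cases "?i = 0")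
      case True
      \<comment> \<open>The repetition at the start of the cycle is not seen by \<open>inj\<close>, which excludes position 0; the
        last position is the same vertex.\<close>
      then have "val (take 2 w) = val (take (length w) w)" using eq w(2) by (simp add: numeral_2_eq_2)
      with inj_onD[OF inj this] w(4) show False by simp
    next
      case False
      moreover have "?i + 2 \<le> length w" by (simp add: split)
      ultimately have "?i + 2 = ?i" by (intro inj_onD[OF inj eq]) (auto simp: Suc_le_eq)
      then show False by simp
    qed
  qed
qed

text \<open>
  If two reduced walks with common ends have different last letters, the first followed by the
  inverse of the second is a nonempty reduced closed walk; equal last letters are cancelled.
\<close>

lemma reduced_tree_walk_unique:
  assumes ncw: "no_closed_walks T"
  shows "tree_walk T g v \<Longrightarrow> tree_walk T g w \<Longrightarrow> reduced v \<Longrightarrow> reduced w \<Longrightarrow> val v = val w \<Longrightarrow> v = w"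
proof (induction v arbitrary: w rule: rev_induct)
  case Nil
  then show ?case using ncw unfolding no_closed_walks_def by (metis word_val.simps(1))
next
  case (snoc a v)
  note walks = snoc.prems(1,2)
  have lists: "v \<in> lists A" "a \<in> A" "w \<in> lists A" "g \<in> carrier G"
    using walks by (auto simp: tree_walk_def)
  show ?case
  proof (cases w rule: rev_cases)
    case Nil
    with snoc.prems have "v @ [a] = []" using ncw unfolding no_closed_walks_def by (metis word_val.simps(1))
    then show ?thesis by simp
  next
    case (snoc w' b)
    note w = this
    have lists': "w' \<in> lists A" "b \<in> A" using lists w by auto
    show ?thesis
    proof (cases "a = b")
      case True
      then have "val v = val w'" using snoc.prems(5) lists lists' w by simp
      moreover have "tree_walk T g v" "tree_walk T g w'" "reduced v" "reduced w'"
        using snoc.prems lists lists' w tree_walk_append reduced_append by auto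
      ultimately show ?thesis using snoc.IH[of w'] w True by simp
    next
      case False
      let ?u = "(v @ [a]) @ word_inv w"
      have "inv b \<noteq> inv a" using False lists lists' by (metis inv_inv letter_closed)
      moreover have "word_inv w = inv b # word_inv w'" by (simp add: w)
      ultimately have "reduced ?u"
        using snoc.prems(3) reduced_word_inv[OF lists(3) snoc.prems(4)]
        by (subst reduced_append) auto
      moreover have "tree_walk T g ?u"
        using walks tree_walk_inv[OF walks(2)] snoc.prems(5) lists
        by (subst tree_walk_append) auto
      moreover have "val ?u = \<one>"
        using val_append[of "v @ [a]" "word_inv w"] lists snoc.prems(5) by simp
      ultimately have "?u = []" using ncw unfolding no_closed_walks_def by blast
      then show ?thesis by simp
    qed
  qed
qed

lemma reduced_tree_walk_exists:
  assumes "tree_walk T g w"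
  shows "\<exists>v. tree_walk T g v \<and> reduced v \<and> val v = val w"
  using assms
proof (induction "length w" arbitrary: w rule: less_induct)
  case less
  show ?case
  proof (cases "reduced w")
    case True
    with less.prems show ?thesis by blast
  next
    case False
    then obtain v a z where w: "w = v @ [a, inv a] @ z" by (rule not_reducedE)
    have lists: "v \<in> lists A" "a \<in> A" "z \<in> lists A" "g \<in> carrier G"
      using less.prems by (auto simp: w tree_walk_def)
    have "val w = val (v @ z)" using lists by (simp add: w m_assoc[symmetric])
    moreover have "tree_walk T g (v @ z)"
      using less.prems lists val_append[of "[a, inv a]" z] tree_walk_append[of "[a, inv a]" T _ z]
      by (simp add: w tree_walk_append del: append_Cons)
    moreover have "length (v @ z) < length w" by (simp add: w)
    ultimately show ?thesis using less.hyps by metis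
  qed
qed

lemma normal_form_eqI:
  assumes ncw: "no_closed_walks T" and w: "tree_walk T \<one> w" "reduced w" "val w = g"
  shows "normal_form G A T g = w"
proof -
  have "(THE p. pre_digraph.awalk (edge_subgraph G A T) \<one> p g \<and> no_backtracking G p) = trace G \<one> w"
  proof (rule the_equality)
    show "pre_digraph.awalk (edge_subgraph G A T) \<one> (trace G \<one> w) g \<and> no_backtracking G (trace G \<one> w)"
      using w tree_walk_lists[OF w(1)] by (auto simp: awalk_subgraph_iff no_backtracking_trace)
  next
    fix p assume "pre_digraph.awalk (edge_subgraph G A T) \<one> p g \<and> no_backtracking G p"
    then obtain v where v: "tree_walk T \<one> v" "p = trace G \<one> v" "g = \<one> \<otimes> val v" "no_backtracking G p"
      by (auto simp: awalk_subgraph_iff)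
    then have "reduced v" "val v = g" using tree_walk_lists by (auto simp: no_backtracking_trace)
    then show "p = trace G \<one> w" using reduced_tree_walk_unique[OF ncw v(1) w(1)] v(2) w by simp
  qed
  then show ?thesis by (simp add: normal_form_def)
qed

text \<open>
  For \<open>forms_tree G A y = T\<close>, take an edge of \<open>T\<close> from \<open>g\<close> labeled \<open>a\<close>. Either the normal form of \<open>g\<close>
  ends in the inverse of \<open>a\<close>, and the edge is the reverse of its last edge, or the normal form of \<open>g\<close>
  extended by \<open>a\<close> is still reduced, hence is the normal form of the other end.
\<close>

lemma maximal_tree_forms:
  assumes T: "maximal_tree G A T"
  defines "y \<equiv> normal_form G A T"
  shows "tree_forms G A y" and "forms_tree G A y = T"
proof -
  from T have ncw: "no_closed_walks T" unfolding maximal_tree_def no_cycle_iff by blast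
  have nf: "y (val w) = w" if "tree_walk T \<one> w" "reduced w" for w
    unfolding y_def by (rule normal_form_eqI[OF ncw that refl])
  have y: "tree_walk T \<one> (y g)" "reduced (y g)" "val (y g) = g" if g: "g \<in> carrier G" for g
  proof -
    obtain w where w: "tree_walk T \<one> w" "g = \<one> \<otimes> val w"
      using T g one_closed unfolding maximal_tree_def awalk_subgraph_iff by meson
    obtain v where v: "tree_walk T \<one> v" "reduced v" "val v = val w"
      using reduced_tree_walk_exists[OF w(1)] by blast
    have val: "val v = g" using w(2) v(3) tree_walk_lists[OF w(1)] by simp
    have "y g = v" using nf[OF v(1,2)] unfolding val .
    then show "tree_walk T \<one> (y g)" "reduced (y g)" "val (y g) = g" using v val by simp_all
  qed
  have prefix: "y (g \<otimes> inv a) = w" if g: "g \<in> carrier G" "y g = w @ [a]" for g w a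
  proof -
    have wa: "w \<in> lists A" "a \<in> A" using y(1)[OF g(1)] g(2) by (auto simp: tree_walk_def)
    then have "tree_walk T \<one> w" "reduced w"
      using y(1,2)[OF g(1)] g(2) by (auto simp: tree_walk_append reduced_append)
    moreover have "val w \<otimes> a = g" using y(3)[OF g(1)] wa by (simp add: g(2))
    then have "val w = g \<otimes> inv a" using wa g(1) by (simp add: inv_solve_right)
    ultimately show ?thesis using nf[of w] by simp
  qed
  show "tree_forms G A y"
    unfolding tree_forms_def
  proof (intro conjI ballI allI impI)
    fix g assume g: "g \<in> carrier G"
    show "y g \<in> lists A" "val (y g) = g" using y[OF g] tree_walk_lists by blast+
    show "y (g \<otimes> inv a) = w" if "y g = w @ [a]" for w a by (rule prefix[OF g that])
  qed
  show "forms_tree G A y = T"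
  proof (intro equalityI subsetI)
    fix e assume "e \<in> forms_tree G A y"
    then obtain g a where e: "e = undirected G (g, a)" "g \<in> carrier G" "a \<in> A" "y (g \<otimes> a) = y g @ [a]"
      by (auto simp: forms_tree_def)
    have "tree_walk T \<one> (y g @ [a])" using y(1)[of "g \<otimes> a"] e by simp
    then have "tree_walk T g [a]" using y[OF e(2)] e(2) tree_walk_lists by (auto simp: tree_walk_append)
    then show "e \<in> T" using e(1) by (simp add: tree_walk_def)
  next
    fix e assume "e \<in> T"
    then obtain g a where e: "e = undirected G (g, a)" "g \<in> carrier G" "a \<in> A"
      using T by (auto simp: maximal_tree_def)
    show "e \<in> forms_tree G A y"
    proof (cases "\<exists>w. y g = w @ [inv a]")
      case True
      then obtain w where w: "y g = w @ [inv a]" by blast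
      then have "y (g \<otimes> a) = w" using prefix[OF e(2) w] e by simp
      moreover have "g \<otimes> a \<otimes> inv a = g" using e by (simp add: m_assoc)
      ultimately have "y (g \<otimes> a \<otimes> inv a) = y (g \<otimes> a) @ [inv a]" using w by simp
      moreover have "e = undirected G (g \<otimes> a, inv a)" "g \<otimes> a \<in> carrier G" "inv a \<in> A"
        using e by (simp_all add: undirected_rev)
      ultimately show ?thesis
        unfolding forms_tree_def mem_Collect_eq by (intro exI[of _ "g \<otimes> a"] exI[of _ "inv a"]) simp
    next
      case False
      have red: "reduced (y g @ [a])"
      proof -
        have "a \<noteq> inv (last (y g))" if "y g \<noteq> []"
        proof
          assume "a = inv (last (y g))"
          moreover have "last (y g) \<in> A" using that y(1)[OF e(2)] by (auto simp: tree_walk_def in_lists_conv_set)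
          ultimately have "last (y g) = inv a" by simp
          with that have "y g = butlast (y g) @ [inv a]" using append_butlast_last_id[of "y g"] by simp
          with False show False by blast
        qed
        then show ?thesis using y(2)[OF e(2)] by (simp add: reduced_append)
      qed
      moreover have "tree_walk T \<one> (y g @ [a])"
        using y[OF e(2)] tree_walk_lists[OF y(1)[OF e(2)]] \<open>e \<in> T\<close> e
        by (simp add: tree_walk_append) (simp add: tree_walk_def)
      moreover have "val (y g @ [a]) = g \<otimes> a"
        using y[OF e(2)] tree_walk_lists e by simp
      ultimately have "y (g \<otimes> a) = y g @ [a]" using nf[of "y g @ [a]"] by simp
      then show ?thesis using e by (auto simp: forms_tree_def)
    qed
  qed
qed

lemma in_forms_tree_iff:
  assumes "g \<in> carrier G" "a \<in> A"
  shows "undirected G (g, a) \<in> forms_tree G A y \<longleftrightarrow> y (g \<otimes> a) = y g @ [a] \<or> y g = y (g \<otimes> a) @ [inv a]"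
proof
  assume "undirected G (g, a) \<in> forms_tree G A y"
  then obtain h b where hb: "undirected G (g, a) = undirected G (h, b)" "h \<in> carrier G" "b \<in> A"
    "y (h \<otimes> b) = y h @ [b]" by (auto simp: forms_tree_def)
  then have "(h, b) \<in> {(g, a), (g \<otimes> a, inv a)}" by (auto simp: undirected_def rev_edge_def)
  then show "y (g \<otimes> a) = y g @ [a] \<or> y g = y (g \<otimes> a) @ [inv a]"
    using hb(4) assms by (auto simp: m_assoc)
next
  assume "y (g \<otimes> a) = y g @ [a] \<or> y g = y (g \<otimes> a) @ [inv a]"
  then show "undirected G (g, a) \<in> forms_tree G A y"
  proof
    assume "y g = y (g \<otimes> a) @ [inv a]"
    then have "y (g \<otimes> a \<otimes> inv a) = y (g \<otimes> a) @ [inv a]" using assms by (simp add: m_assoc)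
    moreover have "undirected G (g, a) = undirected G (g \<otimes> a, inv a)" "g \<otimes> a \<in> carrier G" "inv a \<in> A"
      using assms by (simp_all add: undirected_rev)
    ultimately show ?thesis unfolding forms_tree_def by blast
  qed (use assms in \<open>auto simp: forms_tree_def\<close>)
qed

lemma tree_forms_prefix:
  assumes y: "tree_forms G A y" and "g \<in> carrier G" "y g = v @ w"
  shows "y (val v) = v"
  using assms(2,3)
proof (induction w arbitrary: g rule: rev_induct)
  case Nil
  then show ?case using y by (auto simp: tree_forms_def)
next
  case (snoc a w)
  then have "y (g \<otimes> inv a) = v @ w" using y by (auto simp: tree_forms_def)
  moreover have "y g \<in> lists A" using y snoc.prems by (auto simp: tree_forms_def)
  then have "g \<otimes> inv a \<in> carrier G" using snoc.prems by simp
  ultimately show ?case using snoc.IH by blast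
qed

text \<open>
  Each edge of the tree appends or removes a last letter. A reduced walk cannot remove a letter
  directly after appending one, since that would be backtracking; so it first removes all of
  \<open>word_inv w1\<close> and then appends \<open>w2\<close>.
\<close>

lemma tree_walk_up_down:
  assumes y: "tree_forms G A y" and g: "tree_walk (forms_tree G A y) g w" "reduced w"
  shows "\<exists>v w1 w2. w = w1 @ w2 \<and> y g = v @ word_inv w1 \<and> y (g \<otimes> val w) = v @ w2"
  using g
proof (induction w rule: rev_induct)
  case Nil
  then show ?case by (auto simp: tree_walk_def)
next
  case (snoc c w)
  let ?h = "g \<otimes> val w"
  have lists: "w \<in> lists A" "c \<in> A" "g \<in> carrier G" using snoc.prems by (auto simp: tree_walk_def)
  have walk: "tree_walk (forms_tree G A y) g w" "undirected G (?h, c) \<in> forms_tree G A y"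
    using snoc.prems(1) lists by (auto simp: tree_walk_append) (auto simp: tree_walk_def)
  obtain v w1 w2 where IH: "w = w1 @ w2" "y g = v @ word_inv w1" "y ?h = v @ w2"
    using snoc.IH[OF walk(1)] snoc.prems(2) by (auto simp: reduced_append)
  have end_eq: "g \<otimes> val (w @ [c]) = ?h \<otimes> c" using lists by (simp add: m_assoc)
  from walk(2) consider "y (?h \<otimes> c) = y ?h @ [c]" | "y ?h = y (?h \<otimes> c) @ [inv c]"
    using in_forms_tree_iff[of ?h c y] lists by auto
  then show ?case
  proof cases
    case 1
    then show ?thesis unfolding end_eq
      using IH by (intro exI[of _ v] exI[of _ w1] exI[of _ "w2 @ [c]"]) simp
  next
    case 2
    show ?thesis
    proof (cases w2 rule: rev_cases)
      case Nil
      then show ?thesis unfolding end_eq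
        using IH 2 by (intro exI[of _ "y (?h \<otimes> c)"] exI[of _ "w1 @ [c]"] exI[of _ "[]"]) simp
    next
      case (snoc w2' d)
      then have "d = inv c" using IH(3) 2 by simp
      then have "c = inv (last w)" "w \<noteq> []" using lists IH(1) snoc by auto
      with snoc.prems(2) have False by (simp add: reduced_append)
      then show ?thesis ..
    qed
  qed
qed

text \<open>
  Acyclicity comes from \<open>tree_walk_up_down\<close>: for a closed walk the removed and the appended word
  agree, so that the walk would backtrack at its turning point.
\<close>

lemma tree_forms_maximal_tree:
  assumes y: "tree_forms G A y"
  shows "maximal_tree G A (forms_tree G A y)"
    and "g \<in> carrier G \<Longrightarrow> normal_form G A (forms_tree G A y) g = y g"
proof -
  let ?T = "forms_tree G A y"
  have y_val: "y g \<in> lists A" "val (y g) = g" if "g \<in> carrier G" for g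
    using y that by (auto simp: tree_forms_def)
  have down: "tree_walk ?T \<one> (y g)" if g: "g \<in> carrier G" for g
  proof -
    have "tree_walk ?T \<one> w" if "g \<in> carrier G" "y g = w" for w g
      using that
    proof (induction w arbitrary: g rule: rev_induct)
      case Nil
      then show ?case by (simp add: tree_walk_def)
    next
      case (snoc a w)
      then have a: "a \<in> A" "w \<in> lists A" using y_val[OF snoc.prems(1)] by auto
      have "y (g \<otimes> inv a) = w" using y snoc.prems unfolding tree_forms_def by blast
      then have w: "tree_walk ?T \<one> w" "val w = g \<otimes> inv a"
        using snoc.IH[of "g \<otimes> inv a"] y_val[of "g \<otimes> inv a"] a snoc.prems by auto
      have "g \<otimes> inv a \<otimes> a = g" using a snoc.prems by (simp add: m_assoc)
      then have "undirected G (g \<otimes> inv a, a) \<in> ?T"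
        using \<open>y (g \<otimes> inv a) = w\<close> snoc.prems a by (subst in_forms_tree_iff) auto
      then show ?case using w a snoc.prems by (simp add: tree_walk_append) (simp add: tree_walk_def)
    qed
    from this[OF g refl] show ?thesis .
  qed
  have ncw: "no_closed_walks ?T"
    unfolding no_closed_walks_def
  proof (intro allI impI)
    fix g w assume w: "tree_walk ?T g w" "reduced w" "val w = \<one>"
    then obtain v w1 w2 where *: "w = w1 @ w2" "y g = v @ word_inv w1" "y (g \<otimes> val w) = v @ w2"
      using tree_walk_up_down[OF y] by blast
    have "g \<in> carrier G" using w(1) by (simp add: tree_walk_def)
    with * w(3) have w2: "w2 = word_inv w1" by simp
    show "w = []"
    proof (cases w1 rule: rev_cases)
      case Nil
      with * w2 show ?thesis by simp
    next
      case (snoc x a)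
      then have "hd w2 = inv (last w1)" "w1 \<noteq> []" "w2 \<noteq> []" by (simp_all add: w2)
      with w(2) *(1) have False by (simp add: reduced_append)
      then show ?thesis ..
    qed
  qed
  have red: "reduced (y g)" if g: "g \<in> carrier G" for g
  proof (rule ccontr)
    assume "\<not> reduced (y g)"
    then obtain v a z where split: "y g = v @ [a, inv a] @ z" by (rule not_reducedE)
    have "v \<in> lists A" "a \<in> A" using y_val(1)[OF g] by (simp_all add: split)
    then have "val (v @ [a, inv a]) = val v" by simp
    moreover have "y (val (v @ [a, inv a])) = v @ [a, inv a]" "y (val v) = v"
      using tree_forms_prefix[OF y g, of "v @ [a, inv a]"] tree_forms_prefix[OF y g, of v] split by auto
    ultimately show False by simp
  qed
  show nf: "g \<in> carrier G \<Longrightarrow> normal_form G A ?T g = y g" for g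
    using normal_form_eqI[OF ncw down red] y_val by blast
  have "?T \<subseteq> undirected G ` arcs (cayley_graph G A)"
    by (auto simp: forms_tree_def)
  moreover have "\<exists>p. pre_digraph.awalk (edge_subgraph G A ?T) g p h"
    if "g \<in> carrier G" "h \<in> carrier G" for g h
  proof -
    have "tree_walk ?T g (word_inv (y g))" "tree_walk ?T \<one> (y h)"
      using tree_walk_inv[OF down] down y_val that by auto
    then have "tree_walk ?T g (word_inv (y g) @ y h)"
      using y_val that by (simp add: tree_walk_append)
    moreover have "h = g \<otimes> val (word_inv (y g) @ y h)"
      using y_val that by (simp add: m_assoc[symmetric])
    ultimately show ?thesis unfolding awalk_subgraph_iff by blast
  qed
  ultimately show "maximal_tree G A ?T"
    unfolding maximal_tree_def no_cycle_iff using ncw by blast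
qed

end

section \<open>Flow functions and stacking graphs by words\<close>

context cayley begin

lemma word_exists:
  assumes "g \<in> carrier G" shows "\<exists>w\<in>lists A. val w = g"
proof -
  from assms gen have "g \<in> generate G A" by (simp add: generating_set_def)
  then show ?thesis
  proof induction
    case one
    then show ?case by (intro bexI[of _ "[]"]) auto
  next
    case (incl h)
    then show ?case by (intro bexI[of _ "[h]"]) auto
  next
    case (inv h)
    then show ?case by (intro bexI[of _ "[inv h]"]) auto
  next
    case (eng h1 h2)
    then obtain v w where "v \<in> lists A" "val v = h1" "w \<in> lists A" "val w = h2" by blast
    then show ?case by (intro bexI[of _ "v @ w"]) auto
  qed
qed

lemma flow_pathE:
  assumes "flow_function G A T \<Phi>" "g \<in> carrier G" "a \<in> A"
  obtains w where "w \<in> lists A" "val w = a" "\<Phi> (g, a) = trace G g w"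
proof -
  have "pre_digraph.awalk (cayley_graph G A) g (\<Phi> (g, a)) (g \<otimes> a)"
    using assms(1)[unfolded flow_function_def, THEN conjunct2, THEN conjunct1, THEN bspec, of "(g, a)"] assms(2,3)
    by (simp add: cayley_graph_def)
  then obtain w where w: "w \<in> lists A" "\<Phi> (g, a) = trace G g w" "g \<otimes> a = g \<otimes> val w"
    unfolding awalk_cayley_iff by blast
  then have "val w = a" using assms by simp
  with w that show thesis by blast
qed

lemma flow_label:
  assumes "flow_function G A T \<Phi>" "g \<in> carrier G" "a \<in> A"
  shows "path_label (\<Phi> (g, a)) \<in> lists A" "val (path_label (\<Phi> (g, a))) = a"
  using flow_pathE[OF assms] by fastforce+

lemma tree_forms_one: "tree_forms G A y \<Longrightarrow> y \<one> = []"
  using tree_forms_prefix[of y \<one> "[]" "y \<one>"] by simp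

lemma fiber_stacking_graph:
  "fiber (stacking_graph G A T \<Phi>) [[a], v] =
    (if a \<in> A then normal_form G A T ` {g \<in> carrier G. path_label (\<Phi> (g, a)) = v} else {})"
  by (auto simp: fiber_def stacking_graph_def)

text \<open>
  Every normal form lies in some fiber over any fixed letter, and boundedness leaves finitely many
  fibers. Only the trivial group has no letter.
\<close>

lemma normal_forms_UN_fibers:
  assumes T: "tree_forms G A (normal_form G A T)" and flow: "flow_function G A T \<Phi>"
    and k: "\<And>e. e \<in> arcs (cayley_graph G A) \<Longrightarrow> length (\<Phi> e) \<le> k"
  shows "normal_form G A T ` carrier G =
    (if A = {} then {[]}
     else \<Union>v\<in>{v \<in> lists A. length v \<le> k}. fiber (stacking_graph G A T \<Phi>) [[SOME a. a \<in> A], v])"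
proof (cases "A = {}")
  case True
  then have "normal_form G A T g = []" if "g \<in> carrier G" for g
    using T that by (auto simp: tree_forms_def elim: lists.cases)
  then show ?thesis using True by (auto intro!: image_eqI[of _ _ \<one>])
next
  case False
  then have a: "(SOME a. a \<in> A) \<in> A" by (rule some_in_eq[THEN iffD2])
  have "length (path_label (\<Phi> (g, SOME a. a \<in> A))) \<le> k" if "g \<in> carrier G" for g
    using k[of "(g, SOME a. a \<in> A)"] a that by (simp add: path_label_def)
  with flow_label(1)[OF flow _ a]
  have "normal_form G A T ` carrier G = (\<Union>v\<in>{v \<in> lists A. length v \<le> k}.
      normal_form G A T ` {g \<in> carrier G. path_label (\<Phi> (g, SOME a. a \<in> A)) = v})"
    by blast
  then show ?thesis using False a by (simp add: fiber_stacking_graph)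
qed

lemma finite_bounded_words: "finite {v \<in> lists A. length v \<le> k}"
  using finite_lists_length_le[of A k] by (simp add: lists_eq_set conj_commute)

end

section \<open>Words in a group extension\<close>

locale group_extension = K: cayley K A + Q: cayley Q B + G: group G
  for K :: "('k, 'x) monoid_scheme" and A and Q :: "('q, 'z) monoid_scheme" and B
    and G :: "('g, 'y) monoid_scheme" +
  fixes \<iota> :: "'k \<Rightarrow> 'g" and q :: "'g \<Rightarrow> 'q" and Bhat :: "'g set"
  assumes \<iota>_hom: "\<iota> \<in> hom K G" and q_hom: "q \<in> hom G Q"
    and \<iota>_inj: "inj_on \<iota> (carrier K)"
    and exact: "\<iota> ` carrier K = kernel G Q q"
    and q_surj: "q ` carrier G = carrier Q"
    and Bhat_sub: "Bhat \<subseteq> carrier G" and Bhat_inv: "\<forall>b\<in>Bhat. inv\<^bsub>G\<^esub> b \<in> Bhat"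
    and Bhat_bij: "bij_betw q Bhat B"
begin

sublocale iota: group_hom K G \<iota>
  using \<iota>_hom by unfold_locales

sublocale q: group_hom G Q q
  using q_hom by unfold_locales

abbreviation C :: "'g set" where "C \<equiv> \<iota> ` A \<union> Bhat"

definition hat :: "'q \<Rightarrow> 'g" where "hat = inv_into Bhat q"

lemma hat_in [simp]: "b \<in> B \<Longrightarrow> hat b \<in> Bhat"
  using Bhat_bij unfolding hat_def bij_betw_def by (metis inv_into_into)

lemma q_hat [simp]: "b \<in> B \<Longrightarrow> q (hat b) = b"
  using Bhat_bij unfolding hat_def by (simp add: bij_betw_inv_into_right)

lemma hat_q [simp]: "c \<in> Bhat \<Longrightarrow> hat (q c) = c"
  using Bhat_bij unfolding hat_def by (simp add: bij_betw_inv_into_left)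

lemma q_Bhat [simp]: "c \<in> Bhat \<Longrightarrow> q c \<in> B"
  using Bhat_bij by (auto simp: bij_betw_def)

lemma hat_image: "hat ` B = Bhat"
  using bij_betw_imp_surj_on[OF bij_betw_inv_into[OF Bhat_bij]] by (simp add: hat_def)

lemma inj_hat: "inj_on hat B"
  by (rule inj_on_inverseI[of _ q]) simp

lemma hat_closed [simp]: "b \<in> B \<Longrightarrow> hat b \<in> carrier G"
  using Bhat_sub by auto

lemma hat_inv: "b \<in> B \<Longrightarrow> hat (inv\<^bsub>Q\<^esub> b) = inv\<^bsub>G\<^esub> hat b"
proof -
  assume b: "b \<in> B"
  then have "inv\<^bsub>G\<^esub> hat b \<in> Bhat" using bspec[OF Bhat_inv hat_in] by simp
  from hat_q[OF this] b show ?thesis by simp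
qed

lemma inj_iota: "inj_on \<iota> A"
  using \<iota>_inj by (rule inj_on_subset) auto

lemma q_iota [simp]: "k \<in> carrier K \<Longrightarrow> q (\<iota> k) = \<one>\<^bsub>Q\<^esub>"
  using exact by (auto simp: kernel_def)

lemma iota_not_Bhat: "k \<in> carrier K \<Longrightarrow> \<iota> k \<notin> Bhat"
  using q_Bhat[of "\<iota> k"] Q.one_not_letter by auto

lemma disjoint_letters: "\<iota> ` A \<inter> hat ` B = {}"
  using iota_not_Bhat by (auto simp: hat_image)

lemma in_iota_imageI: "g \<in> carrier G \<Longrightarrow> q g = \<one>\<^bsub>Q\<^esub> \<Longrightarrow> g \<in> \<iota> ` carrier K"
  unfolding exact by (simp add: kernel_def)

lemma map_iota_lists: "w \<in> lists A \<Longrightarrow> map \<iota> w \<in> lists C"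
  by (induction w) auto

lemma map_hat_lists: "w \<in> lists B \<Longrightarrow> map hat w \<in> lists C"
  by (induction w) auto

lemma val_map_iota: "w \<in> lists A \<Longrightarrow> word_val G (map \<iota> w) = \<iota> (word_val K w)"
  by (induction w) auto

lemma val_map_hat_closed: "w \<in> lists B \<Longrightarrow> word_val G (map hat w) \<in> carrier G"
  by (induction w) auto

lemma q_val_map_hat: "w \<in> lists B \<Longrightarrow> q (word_val G (map hat w)) = word_val Q w"
  by (induction w) (auto simp: val_map_hat_closed)

text \<open>
  Lift a word for \<open>q g\<close>; its value differs from \<open>g\<close> by an element of \<open>\<iota> K\<close>.
\<close>

lemma generating_set_extension: "generating_set G C"
  unfolding generating_set_def
proof (intro conjI ballI)
  have "finite (hat ` B)" by simp
  then show "finite C" by (simp add: hat_image)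
  show "C \<subseteq> carrier G" using Bhat_sub by auto
  show "inv\<^bsub>G\<^esub> c \<in> C" if "c \<in> C" for c using that
  proof
    assume "c \<in> \<iota> ` A"
    then obtain a where "a \<in> A" "c = \<iota> a" by auto
    then have "inv\<^bsub>G\<^esub> c = \<iota> (inv\<^bsub>K\<^esub> a)" "inv\<^bsub>K\<^esub> a \<in> A" by simp_all
    then show ?thesis by blast
  next
    assume "c \<in> Bhat"
    then show ?thesis using bspec[OF Bhat_inv] by simp
  qed
  have "\<one>\<^bsub>G\<^esub> \<noteq> \<iota> a" if "a \<in> A" for a
    using inj_onD[OF \<iota>_inj, of a "\<one>\<^bsub>K\<^esub>"] that K.one_not_letter by auto
  then show "\<one>\<^bsub>G\<^esub> \<notin> C" using iota_not_Bhat[of "\<one>\<^bsub>K\<^esub>"] by auto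
  show "generate G C = carrier G"
  proof (intro equalityI subsetI)
    fix g assume "g \<in> generate G C"
    then show "g \<in> carrier G" using G.generate_in_carrier \<open>C \<subseteq> carrier G\<close> by blast
  next
    fix g assume g: "g \<in> carrier G"
    have word: "word_val G w \<in> generate G C" if "w \<in> lists C" for w
      using that
    proof (induction w)
      case (Cons c w)
      then show ?case by (simp add: generate.eng[OF generate.incl])
    qed (simp add: generate.one)
    obtain w where w: "w \<in> lists B" "word_val Q w = q g" using Q.word_exists[of "q g"] g by auto
    let ?h = "word_val G (map hat w)"
    have h: "?h \<in> carrier G" by (rule val_map_hat_closed[OF w(1)])
    have "g \<otimes>\<^bsub>G\<^esub> inv\<^bsub>G\<^esub> ?h \<in> \<iota> ` carrier K"
      using g h w by (intro in_iota_imageI) (simp_all add: q_val_map_hat)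
    then obtain k where k: "k \<in> carrier K" "g \<otimes>\<^bsub>G\<^esub> inv\<^bsub>G\<^esub> ?h = \<iota> k" by auto
    obtain v where v: "v \<in> lists A" "word_val K v = k" using K.word_exists[OF k(1)] by auto
    have "g = \<iota> k \<otimes>\<^bsub>G\<^esub> ?h" using g h k(2)[symmetric] by (simp add: G.m_assoc)
    also have "\<dots> \<in> generate G C"
      using generate.eng[OF word[OF map_iota_lists[OF v(1)]] word[OF map_hat_lists[OF w(1)]]] v
      by (simp add: val_map_iota)
    finally show "g \<in> generate G C" .
  qed
qed

sublocale GC: cayley G C
  by unfold_locales (rule generating_set_extension)

text \<open>
  A word over \<open>A\<close> whose image represents \<open>x\<close>, for \<open>x\<close> in the kernel of \<open>q\<close>. The empty word for the
  identity matters: it makes \<open>lift_word b [b]\<close> the single letter \<open>hat b\<close>, so that edges over tree edges of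
  \<open>Q\<close> are fixed by the flow of \<open>G\<close> without a case distinction.
\<close>

definition kernel_word :: "'g \<Rightarrow> 'k list" where
  "kernel_word x = (if x = \<one>\<^bsub>G\<^esub> then [] else SOME w. w \<in> lists A \<and> \<iota> (word_val K w) = x)"

lemma kernel_word:
  assumes "x \<in> carrier G" "q x = \<one>\<^bsub>Q\<^esub>"
  shows "kernel_word x \<in> lists A" "\<iota> (word_val K (kernel_word x)) = x"
proof -
  obtain k where "k \<in> carrier K" "x = \<iota> k" using in_iota_imageI[OF assms] by auto
  then have "\<exists>w. w \<in> lists A \<and> \<iota> (word_val K w) = x" using K.word_exists by blast
  from someI_ex[OF this] show "kernel_word x \<in> lists A" "\<iota> (word_val K (kernel_word x)) = x"
    by (simp_all add: kernel_word_def)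
qed

text \<open>
  The detour for an edge labeled \<open>\<iota> a\<close> that starts at a vertex whose normal form ends in the lift of \<open>b\<close>.
\<close>

definition conj_word :: "'q \<Rightarrow> 'k \<Rightarrow> 'g list" where
  "conj_word b a = inv\<^bsub>G\<^esub> hat b # map \<iota> (kernel_word (hat b \<otimes>\<^bsub>G\<^esub> \<iota> a \<otimes>\<^bsub>G\<^esub> inv\<^bsub>G\<^esub> hat b)) @ [hat b]"

text \<open>
  The lift of a flow path of \<open>Q\<close> with label \<open>z\<close> and the same ends as an edge labeled \<open>b\<close>. The initial word
  over \<open>\<iota> A\<close> corrects the discrepancy between the values of the two lifts, which lies in the kernel.
\<close>

definition lift_word :: "'q \<Rightarrow> 'q list \<Rightarrow> 'g list" where
  "lift_word b z = map \<iota> (kernel_word (hat b \<otimes>\<^bsub>G\<^esub> inv\<^bsub>G\<^esub> word_val G (map hat z))) @ map hat z"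

lemma conj_kernel_word:
  assumes "b \<in> B" "a \<in> A"
  shows "kernel_word (hat b \<otimes>\<^bsub>G\<^esub> \<iota> a \<otimes>\<^bsub>G\<^esub> inv\<^bsub>G\<^esub> hat b) \<in> lists A" (is "kernel_word ?x \<in> _")
    "word_val G (map \<iota> (kernel_word (hat b \<otimes>\<^bsub>G\<^esub> \<iota> a \<otimes>\<^bsub>G\<^esub> inv\<^bsub>G\<^esub> hat b))) = hat b \<otimes>\<^bsub>G\<^esub> \<iota> a \<otimes>\<^bsub>G\<^esub> inv\<^bsub>G\<^esub> hat b"
proof -
  have "?x \<in> carrier G" "q ?x = \<one>\<^bsub>Q\<^esub>" using assms by simp_all
  from kernel_word[OF this] show "kernel_word ?x \<in> lists A" "word_val G (map \<iota> (kernel_word ?x)) = ?x"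
    by (simp_all add: val_map_iota)
qed

lemma conj_word:
  assumes "b \<in> B" "a \<in> A"
  shows "conj_word b a \<in> lists C" "word_val G (conj_word b a) = \<iota> a"
proof -
  note w = conj_kernel_word[OF assms]
  show "conj_word b a \<in> lists C"
    using assms bspec[OF Bhat_inv hat_in[OF assms(1)]] map_iota_lists[OF w(1)] by (simp add: conj_word_def)
  show "word_val G (conj_word b a) = \<iota> a"
    using assms w map_iota_lists[OF w(1)] by (simp add: conj_word_def G.m_assoc) (simp add: G.m_assoc[symmetric])
qed

lemma lift_kernel_word:
  assumes "b \<in> B" "z \<in> lists B" "word_val Q z = b"
  shows "kernel_word (hat b \<otimes>\<^bsub>G\<^esub> inv\<^bsub>G\<^esub> word_val G (map hat z)) \<in> lists A" (is "kernel_word ?x \<in> _")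
    "word_val G (map \<iota> (kernel_word (hat b \<otimes>\<^bsub>G\<^esub> inv\<^bsub>G\<^esub> word_val G (map hat z)))) =
      hat b \<otimes>\<^bsub>G\<^esub> inv\<^bsub>G\<^esub> word_val G (map hat z)"
proof -
  have "?x \<in> carrier G" "q ?x = \<one>\<^bsub>Q\<^esub>" using assms by (simp_all add: val_map_hat_closed q_val_map_hat)
  from kernel_word[OF this] show "kernel_word ?x \<in> lists A" "word_val G (map \<iota> (kernel_word ?x)) = ?x"
    by (simp_all add: val_map_iota)
qed

lemma lift_word:
  assumes "b \<in> B" "z \<in> lists B" "word_val Q z = b"
  shows "lift_word b z \<in> lists C" "word_val G (lift_word b z) = hat b"
proof -
  note w = lift_kernel_word[OF assms]
  show "lift_word b z \<in> lists C"
    using map_iota_lists[OF w(1)] map_hat_lists[OF assms(2)] by (simp add: lift_word_def)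
  show "word_val G (lift_word b z) = hat b"
    using assms w map_iota_lists[OF w(1)] map_hat_lists[OF assms(2)]
    by (simp add: lift_word_def G.m_assoc)
qed

lemma lift_word_single: "b \<in> B \<Longrightarrow> lift_word b [b] = [hat b]"
  by (simp add: lift_word_def kernel_word_def)

end

section \<open>The flow function of the extension\<close>

locale extension_flows = group_extension K A Q B G \<iota> q Bhat
  for K :: "('k, 'x) monoid_scheme" and A and Q :: "('q, 'z) monoid_scheme" and B
    and G :: "('g, 'y) monoid_scheme" and \<iota> q Bhat +
  fixes TK \<Phi>K TQ \<Phi>Q
  assumes flowK: "bounded_flow_function K A TK \<Phi>K" and flowQ: "bounded_flow_function Q B TQ \<Phi>Q"
begin

abbreviation "yK \<equiv> normal_form K A TK"
abbreviation "yQ \<equiv> normal_form Q B TQ"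

lemma flow_functions: "flow_function K A TK \<Phi>K" "flow_function Q B TQ \<Phi>Q"
  using flowK flowQ by (auto simp: bounded_flow_function_def)

lemma formsK: "tree_forms K A yK" and treeK: "forms_tree K A yK = TK"
  and formsQ: "tree_forms Q B yQ" and treeQ: "forms_tree Q B yQ = TQ"
  using flow_functions K.maximal_tree_forms Q.maximal_tree_forms by (auto simp: flow_function_def)

lemma in_TK_iff: "k \<in> carrier K \<Longrightarrow> a \<in> A \<Longrightarrow> undirected K (k, a) \<in> TK \<longleftrightarrow>
    yK (k \<otimes>\<^bsub>K\<^esub> a) = yK k @ [a] \<or> yK k = yK (k \<otimes>\<^bsub>K\<^esub> a) @ [inv\<^bsub>K\<^esub> a]"
  using K.in_forms_tree_iff[of k a yK] unfolding treeK .

lemma in_TQ_iff: "p \<in> carrier Q \<Longrightarrow> b \<in> B \<Longrightarrow> undirected Q (p, b) \<in> TQ \<longleftrightarrow>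
    yQ (p \<otimes>\<^bsub>Q\<^esub> b) = yQ p @ [b] \<or> yQ p = yQ (p \<otimes>\<^bsub>Q\<^esub> b) @ [inv\<^bsub>Q\<^esub> b]"
  using Q.in_forms_tree_iff[of p b yQ] unfolding treeQ .

lemma yK: "k \<in> carrier K \<Longrightarrow> yK k \<in> lists A" "k \<in> carrier K \<Longrightarrow> word_val K (yK k) = k"
  and yQ: "p \<in> carrier Q \<Longrightarrow> yQ p \<in> lists B" "p \<in> carrier Q \<Longrightarrow> word_val Q (yQ p) = p"
  using formsK formsQ by (auto simp: tree_forms_def)

text \<open>
  A section of \<open>q\<close>, given by the normal forms of \<open>Q\<close>.
\<close>

definition sec :: "'q \<Rightarrow> 'g" where "sec p = word_val G (map hat (yQ p))"

definition kernel_part :: "'g \<Rightarrow> 'k" where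
  "kernel_part g = inv_into (carrier K) \<iota> (g \<otimes>\<^bsub>G\<^esub> inv\<^bsub>G\<^esub> sec (q g))"

definition yG :: "'g \<Rightarrow> 'g list" where
  "yG g = map \<iota> (yK (kernel_part g)) @ map hat (yQ (q g))"

lemma sec_closed [simp]: "p \<in> carrier Q \<Longrightarrow> sec p \<in> carrier G"
  by (simp add: sec_def val_map_hat_closed yQ)

lemma q_sec [simp]: "p \<in> carrier Q \<Longrightarrow> q (sec p) = p"
  by (simp add: sec_def q_val_map_hat yQ)

lemma sec_one [simp]: "sec \<one>\<^bsub>Q\<^esub> = \<one>\<^bsub>G\<^esub>"
  by (simp add: sec_def Q.tree_forms_one[OF formsQ])

lemma kernel_part:
  assumes "g \<in> carrier G"
  shows "kernel_part g \<in> carrier K" "\<iota> (kernel_part g) \<otimes>\<^bsub>G\<^esub> sec (q g) = g"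
proof -
  have "g \<otimes>\<^bsub>G\<^esub> inv\<^bsub>G\<^esub> sec (q g) \<in> \<iota> ` carrier K"
    using assms by (intro in_iota_imageI) simp_all
  then have "kernel_part g \<in> carrier K" "\<iota> (kernel_part g) = g \<otimes>\<^bsub>G\<^esub> inv\<^bsub>G\<^esub> sec (q g)"
    unfolding kernel_part_def by (auto intro: inv_into_into f_inv_into_f)
  with assms show "kernel_part g \<in> carrier K" "\<iota> (kernel_part g) \<otimes>\<^bsub>G\<^esub> sec (q g) = g"
    by (simp_all add: G.m_assoc)
qed

lemma kernel_part_eq:
  assumes "k \<in> carrier K" "p \<in> carrier Q"
  shows "kernel_part (\<iota> k \<otimes>\<^bsub>G\<^esub> sec p) = k"
  using assms \<iota>_inj by (simp add: kernel_part_def G.m_assoc)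

lemma kernel_part_iota: "k \<in> carrier K \<Longrightarrow> kernel_part (\<iota> k) = k"
  using kernel_part_eq[of k "\<one>\<^bsub>Q\<^esub>"] by simp

lemma yG_eq: "k \<in> carrier K \<Longrightarrow> p \<in> carrier Q \<Longrightarrow>
    yG (\<iota> k \<otimes>\<^bsub>G\<^esub> sec p) = map \<iota> (yK k) @ map hat (yQ p)"
  by (simp add: yG_def kernel_part_eq)

lemma yG_iota: "k \<in> carrier K \<Longrightarrow> yG (\<iota> k) = map \<iota> (yK k)"
  by (simp add: yG_def kernel_part_iota Q.tree_forms_one[OF formsQ])

lemma yQ_snocD:
  assumes "p \<in> carrier Q" "yQ p = u @ [b]"
  shows "b \<in> B" "yQ (p \<otimes>\<^bsub>Q\<^esub> inv\<^bsub>Q\<^esub> b) = u" "sec (p \<otimes>\<^bsub>Q\<^esub> inv\<^bsub>Q\<^esub> b) = sec p \<otimes>\<^bsub>G\<^esub> inv\<^bsub>G\<^esub> hat b"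
proof -
  have u: "u \<in> lists B" "b \<in> B" using yQ(1)[OF assms(1)] by (simp_all add: assms(2))
  then show "b \<in> B" by simp
  show y: "yQ (p \<otimes>\<^bsub>Q\<^esub> inv\<^bsub>Q\<^esub> b) = u" using formsQ assms by (auto simp: tree_forms_def)
  have "sec p = word_val G (map hat u) \<otimes>\<^bsub>G\<^esub> hat b"
    using map_hat_lists[OF u(1)] u(2) by (simp add: sec_def assms(2))
  then show "sec (p \<otimes>\<^bsub>Q\<^esub> inv\<^bsub>Q\<^esub> b) = sec p \<otimes>\<^bsub>G\<^esub> inv\<^bsub>G\<^esub> hat b"
    using u val_map_hat_closed[OF u(1)] by (simp add: sec_def[of "p \<otimes>\<^bsub>Q\<^esub> inv\<^bsub>Q\<^esub> b"] y G.m_assoc)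
qed

text \<open>
  Removing the last letter changes the normal form of the image in \<open>Q\<close> unless that is empty, and then
  the normal form in \<open>K\<close>; in both cases prefix-closedness is inherited.
\<close>

lemma formsG: "tree_forms G C yG"
  unfolding tree_forms_def
proof (intro conjI ballI allI impI)
  fix g assume g: "g \<in> carrier G"
  note k = kernel_part[OF g]
  have w: "map \<iota> (yK (kernel_part g)) \<in> lists C" "map hat (yQ (q g)) \<in> lists C"
    using g k by (simp_all add: map_iota_lists map_hat_lists yK yQ)
  then show "yG g \<in> lists C" by (simp add: yG_def)
  show "word_val G (yG g) = g"
    using k w g by (simp add: yG_def val_map_iota yK flip: sec_def)
  fix w c assume wc: "yG g = w @ [c]"
  show "yG (g \<otimes>\<^bsub>G\<^esub> inv\<^bsub>G\<^esub> c) = w"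
  proof (cases "yQ (q g)" rule: rev_cases)
    case Nil
    then have "q g = \<one>\<^bsub>Q\<^esub>" using yQ(2)[of "q g"] g by simp
    then have gk: "g = \<iota> (kernel_part g)" using k by simp
    from wc Nil obtain v a where v: "yK (kernel_part g) = v @ [a]" "w = map \<iota> v" "c = \<iota> a"
      by (auto simp: yG_def map_eq_append_conv)
    then have "a \<in> A" using yK(1)[OF k(1)] by simp
    have y: "yK (kernel_part g \<otimes>\<^bsub>K\<^esub> inv\<^bsub>K\<^esub> a) = v"
      using formsK k(1) v(1) unfolding tree_forms_def by blast
    have eq: "g \<otimes>\<^bsub>G\<^esub> inv\<^bsub>G\<^esub> c = \<iota> (kernel_part g \<otimes>\<^bsub>K\<^esub> inv\<^bsub>K\<^esub> a)"
      using k(1) gk v(3) \<open>a \<in> A\<close> by simp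
    show ?thesis unfolding eq using k(1) v \<open>a \<in> A\<close> y by (subst yG_iota) simp_all
  next
    case (snoc u b)
    then have c: "c = hat b" "w = map \<iota> (yK (kernel_part g)) @ map hat u" using wc by (auto simp: yG_def)
    note s = yQ_snocD[OF _ snoc]
    have "g \<otimes>\<^bsub>G\<^esub> inv\<^bsub>G\<^esub> c = \<iota> (kernel_part g) \<otimes>\<^bsub>G\<^esub> sec (q g) \<otimes>\<^bsub>G\<^esub> inv\<^bsub>G\<^esub> hat b"
      using k(2) c by simp
    also have "\<dots> = \<iota> (kernel_part g) \<otimes>\<^bsub>G\<^esub> sec (q g \<otimes>\<^bsub>Q\<^esub> inv\<^bsub>Q\<^esub> b)"
      using s g k(1) by (simp add: G.m_assoc)
    finally have eq: "g \<otimes>\<^bsub>G\<^esub> inv\<^bsub>G\<^esub> c = \<iota> (kernel_part g) \<otimes>\<^bsub>G\<^esub> sec (q g \<otimes>\<^bsub>Q\<^esub> inv\<^bsub>Q\<^esub> b)" .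
    show ?thesis unfolding eq using s(1,2) g k(1) c by (subst yG_eq) simp_all
  qed
qed

abbreviation "TG \<equiv> forms_tree G C yG"

lemma step_iota:
  assumes "k \<in> carrier K" "a \<in> A"
  shows "yG (\<iota> k \<otimes>\<^bsub>G\<^esub> \<iota> a) = yG (\<iota> k) @ [\<iota> a] \<longleftrightarrow> yK (k \<otimes>\<^bsub>K\<^esub> a) = yK k @ [a]"
proof -
  have y: "yG (\<iota> k \<otimes>\<^bsub>G\<^esub> \<iota> a) = map \<iota> (yK (k \<otimes>\<^bsub>K\<^esub> a))" "yG (\<iota> k) @ [\<iota> a] = map \<iota> (yK k @ [a])"
    using assms by (simp_all add: yG_iota flip: iota.hom_mult)
  have "yK (k \<otimes>\<^bsub>K\<^esub> a) \<in> lists A" "yK k @ [a] \<in> lists A"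
    using assms by (simp_all add: yK)
  then show ?thesis unfolding y by (rule inj_on_eq_iff[OF inj_on_map_lists[OF inj_iota]])
qed

lemma step_hat:
  assumes "g \<in> carrier G" "b \<in> B"
  shows "yG (g \<otimes>\<^bsub>G\<^esub> hat b) = yG g @ [hat b] \<longleftrightarrow> yQ (q g \<otimes>\<^bsub>Q\<^esub> b) = yQ (q g) @ [b]"
proof
  assume step: "yQ (q g \<otimes>\<^bsub>Q\<^esub> b) = yQ (q g) @ [b]"
  have "sec (q g \<otimes>\<^bsub>Q\<^esub> b) = sec (q g) \<otimes>\<^bsub>G\<^esub> hat b"
    using assms map_hat_lists[OF yQ(1)[of "q g"]] by (simp add: sec_def step)
  then have "g \<otimes>\<^bsub>G\<^esub> hat b = \<iota> (kernel_part g) \<otimes>\<^bsub>G\<^esub> sec (q g \<otimes>\<^bsub>Q\<^esub> b)"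
    using kernel_part[OF assms(1)] assms by (simp flip: G.m_assoc)
  then show "yG (g \<otimes>\<^bsub>G\<^esub> hat b) = yG g @ [hat b]"
    using kernel_part[OF assms(1)] assms by (simp add: yG_eq step) (simp add: yG_def)
next
  assume step: "yG (g \<otimes>\<^bsub>G\<^esub> hat b) = yG g @ [hat b]"
  \<comment> \<open>The normal form of the image can be read off from the letters in \<open>Bhat\<close>.\<close>
  have proj: "map q (filter (\<lambda>c. c \<in> Bhat) (yG h)) = yQ (q h)" if "h \<in> carrier G" for h
  proof -
    have "filter (\<lambda>c. c \<in> Bhat) (map \<iota> v) = []" if "v \<in> lists A" for v
      using that by (induction v) (auto simp: iota_not_Bhat)
    moreover have "map q (filter (\<lambda>c. c \<in> Bhat) (map hat v)) = v" if "v \<in> lists B" for v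
      using that by (induction v) auto
    ultimately show ?thesis using that kernel_part by (simp add: yG_def yK yQ)
  qed
  have "yQ (q g \<otimes>\<^bsub>Q\<^esub> b) = map q (filter (\<lambda>c. c \<in> Bhat) (yG (g \<otimes>\<^bsub>G\<^esub> hat b)))"
    using assms by (subst proj) simp_all
  also have "\<dots> = yQ (q g) @ [b]" using assms by (simp add: step proj)
  finally show "yQ (q g \<otimes>\<^bsub>Q\<^esub> b) = yQ (q g) @ [b]" .
qed

lemma iota_edge_in_tree:
  assumes "k \<in> carrier K" "a \<in> A"
  shows "undirected G (\<iota> k, \<iota> a) \<in> TG \<longleftrightarrow> undirected K (k, a) \<in> TK"
  using assms step_iota[OF assms] step_iota[of "k \<otimes>\<^bsub>K\<^esub> a" "inv\<^bsub>K\<^esub> a"]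
  by (simp add: GC.in_forms_tree_iff in_TK_iff K.m_assoc G.m_assoc eq_commute[of "yG _"] eq_commute[of "yK _"])

lemma hat_edge_in_tree:
  assumes "g \<in> carrier G" "b \<in> B"
  shows "undirected G (g, hat b) \<in> TG \<longleftrightarrow> undirected Q (q g, b) \<in> TQ"
  using assms step_hat[OF assms] step_hat[of "g \<otimes>\<^bsub>G\<^esub> hat b" "inv\<^bsub>Q\<^esub> b"]
  by (simp add: GC.in_forms_tree_iff in_TQ_iff hat_inv G.m_assoc Q.m_assoc eq_commute)

text \<open>
  A normal form can end in a letter of \<open>\<iota> A\<close> only if its part over \<open>Bhat\<close> is empty.
\<close>

lemma iota_edge_in_treeD:
  assumes "g \<in> carrier G" "a \<in> A" "undirected G (g, \<iota> a) \<in> TG"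
  shows "q g = \<one>\<^bsub>Q\<^esub>"
proof -
  have *: "q h = \<one>\<^bsub>Q\<^esub>" if "h \<in> carrier G" "yG h = w @ [\<iota> a']" "a' \<in> A" for h w a'
  proof (cases "yQ (q h)" rule: rev_cases)
    case Nil
    then show ?thesis using yQ(2)[of "q h"] that by simp
  next
    case (snoc u b)
    then have "hat b = \<iota> a'" "b \<in> B" using that(2) yQ(1)[of "q h"] that(1) by (auto simp: yG_def)
    then show ?thesis using iota_not_Bhat[of a'] that(3) hat_in by fastforce
  qed
  from assms consider "yG (g \<otimes>\<^bsub>G\<^esub> \<iota> a) = yG g @ [\<iota> a]" | "yG g = yG (g \<otimes>\<^bsub>G\<^esub> \<iota> a) @ [\<iota> (inv\<^bsub>K\<^esub> a)]"
    by (auto simp: GC.in_forms_tree_iff)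
  then show ?thesis
  proof cases
    case 1
    with *[of "g \<otimes>\<^bsub>G\<^esub> \<iota> a"] assms show ?thesis by simp
  next
    case 2
    with *[OF assms(1) 2] assms show ?thesis by simp
  qed
qed

definition labelG :: "'g \<Rightarrow> 'g \<Rightarrow> 'g list" where
  "labelG g c =
    (if c \<in> Bhat then lift_word (q c) (path_label (\<Phi>Q (q g, q c)))
     else if yQ (q g) = [] then map \<iota> (path_label (\<Phi>K (kernel_part g, inv_into A \<iota> c)))
     else conj_word (last (yQ (q g))) (inv_into A \<iota> c))"

definition \<Phi>G :: "'g \<times> 'g \<Rightarrow> ('g \<times> 'g) list" where
  "\<Phi>G = (\<lambda>(g, c). trace G g (labelG g c))"

lemma labelG_hat: "b \<in> B \<Longrightarrow> labelG g (hat b) = lift_word b (path_label (\<Phi>Q (q g, b)))"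
  by (simp add: labelG_def)

lemma labelG_iota:
  "a \<in> A \<Longrightarrow> labelG g (\<iota> a) =
    (if yQ (q g) = [] then map \<iota> (path_label (\<Phi>K (kernel_part g, a))) else conj_word (last (yQ (q g))) a)"
  by (simp add: labelG_def iota_not_Bhat inj_iota)

lemma yQ_eq_Nil_iff: "p \<in> carrier Q \<Longrightarrow> yQ p = [] \<longleftrightarrow> p = \<one>\<^bsub>Q\<^esub>"
  using yQ(2)[of p] Q.tree_forms_one[OF formsQ] by auto

lemma last_yQ: "p \<in> carrier Q \<Longrightarrow> yQ p \<noteq> [] \<Longrightarrow> last (yQ p) \<in> B"
  using yQ(1)[of p] by (auto simp: in_lists_conv_set)

lemma letter_cases [consumes 1, case_names iota hat]:
  assumes "c \<in> C"
  obtains a where "a \<in> A" "c = \<iota> a" | b where "b \<in> B" "c = hat b"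
  using assms hat_q q_Bhat by (metis Un_iff imageE)

lemma labelG_word:
  assumes "g \<in> carrier G" "c \<in> C"
  shows "labelG g c \<in> lists C" "word_val G (labelG g c) = c"
proof -
  have "labelG g c \<in> lists C \<and> word_val G (labelG g c) = c"
    using assms(2)
  proof (cases rule: letter_cases)
    case (iota a)
    then show ?thesis
      using assms(1) K.flow_label[OF flow_functions(1) kernel_part(1)] last_yQ[of "q g"]
      by (simp add: labelG_iota val_map_iota map_iota_lists conj_word)
  next
    case (hat b)
    then show ?thesis
      using assms(1) Q.flow_label[OF flow_functions(2), of "q g" b] by (simp add: labelG_hat lift_word)
  qed
  then show "labelG g c \<in> lists C" "word_val G (labelG g c) = c" by auto
qed

lemma trace_letter: "(h, c) \<in> set (trace G g w) \<Longrightarrow> c \<in> set w"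
  by (induction w arbitrary: g) auto

lemma trace_map_iota:
  assumes "g \<in> carrier G" "w \<in> lists A" "(h, c) \<in> set (trace G g (map \<iota> w))"
  shows "h \<in> carrier G \<and> q h = q g \<and> c \<in> \<iota> ` A"
  using assms
proof (induction w arbitrary: g)
  case (Cons a w)
  then show ?case using Cons.IH[of "g \<otimes>\<^bsub>G\<^esub> \<iota> a"] by auto
qed simp

lemma trace_map_iota_kernel:
  "k \<in> carrier K \<Longrightarrow> w \<in> lists A \<Longrightarrow> trace G (\<iota> k) (map \<iota> w) = map (map_prod \<iota> \<iota>) (trace K k w)"
  by (induction w arbitrary: k) (auto simp flip: iota.hom_mult)

lemma trace_map_hat:
  "g \<in> carrier G \<Longrightarrow> w \<in> lists B \<Longrightarrow> map (map_prod q q) (trace G g (map hat w)) = trace Q (q g) w"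
  by (induction w arbitrary: g) auto

text \<open>
  The lexicographic rank of an edge: edges labeled in \<open>Bhat\<close> come above edges labeled in \<open>\<iota> A\<close>, and among
  the latter the distance of the image in \<open>Q\<close> from the root is compared before the flow of \<open>K\<close>. The
  undefined components make edges of the same kind agree in the component that does not concern
  them.
\<close>

definition rank :: "'g \<times> 'g \<Rightarrow> nat \<times> nat \<times> ('k \<times> 'k) \<times> ('q \<times> 'q)" where
  "rank = (\<lambda>(g, c). if c \<in> Bhat then (1, 0, undefined, (q g, q c))
     else (0, length (yQ (q g)), (kernel_part g, inv_into A \<iota> c), undefined))"

text \<open>
  The four kinds of edges on a flow path that are not in the tree: a correction edge labeled in \<open>\<iota> A\<close> on the
  path of an edge labeled in \<open>Bhat\<close> has smaller tag; a lifted edge has an image that is smaller in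
  the flow order of \<open>Q\<close>; on the path of an edge in \<open>\<iota> K\<close> all edges are images of edges that are
  smaller in the flow order of \<open>K\<close>; and the middle edges of a conjugated path lie nearer to the
  root. The outer edges of a conjugated path are in the tree.
\<close>

lemma rank_decreases:
  assumes "(e', e) \<in> flow_rel G C TG \<Phi>G"
  shows "(rank e', rank e) \<in>
    less_than <*lex*> less_than <*lex*> flow_rel K A TK \<Phi>K <*lex*> flow_rel Q B TQ \<Phi>Q"
proof -
  obtain g c h d where e: "e = (g, c)" "e' = (h, d)" by fastforce
  from assms have g: "g \<in> carrier G" "c \<in> C" and h: "h \<in> carrier G" "d \<in> C"
    and on_path: "(h, d) \<in> set (trace G g (labelG g c))"
    and nontree: "undirected G (g, c) \<notin> TG" "undirected G (h, d) \<notin> TG"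
    by (auto simp: flow_rel_def e \<Phi>G_def)
  from g(2) show ?thesis
  proof (cases rule: letter_cases)
    case (hat b)
    obtain z where z: "z \<in> lists B" "word_val Q z = b" "\<Phi>Q (q g, b) = trace Q (q g) z"
      using Q.flow_pathE[OF flow_functions(2), of "q g" b] g hat by auto
    let ?w = "kernel_word (hat b \<otimes>\<^bsub>G\<^esub> inv\<^bsub>G\<^esub> word_val G (map hat z))"
    note w = lift_kernel_word[OF hat(1) z(1,2)]
    have "labelG g c = map \<iota> ?w @ map hat z" using hat by (simp add: labelG_hat lift_word_def z(3))
    with on_path consider "(h, d) \<in> set (trace G g (map \<iota> ?w))"
      | "(h, d) \<in> set (trace G (g \<otimes>\<^bsub>G\<^esub> word_val G (map \<iota> ?w)) (map hat z))"
      using GC.trace_append[OF g(1) map_iota_lists[OF w(1)]] by auto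
    then show ?thesis
    proof cases
      case 1
      then have "d \<in> \<iota> ` A" using trace_map_iota[OF g(1) w(1)] by blast
      then have "d \<notin> Bhat" using iota_not_Bhat by auto
      then show ?thesis using hat by (simp add: e rank_def)
    next
      case 2
      let ?g' = "g \<otimes>\<^bsub>G\<^esub> word_val G (map \<iota> ?w)"
      have g': "?g' \<in> carrier G" "q ?g' = q g"
        using g w(1) by (simp_all add: val_map_iota)
      from 2 have "(q h, q d) \<in> map_prod q q ` set (trace G ?g' (map hat z))" by force
      also have "\<dots> = set (trace Q (q g) z)"
        using trace_map_hat[OF g'(1) z(1)] unfolding g'(2) by (simp flip: set_map)
      also have "\<dots> = set (\<Phi>Q (q g, b))" by (simp only: z(3))
      finally have on: "(q h, q d) \<in> set (\<Phi>Q (q g, b))" .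
      have "d \<in> set (map hat z)"
        using 2 by (rule trace_letter)
      then have d: "d \<in> Bhat" using z(1) by (auto simp: in_lists_conv_set)
      have "(q h, q d) \<in> arcs (cayley_graph Q B)" "(q g, b) \<in> arcs (cayley_graph Q B)"
        using g h d hat by simp_all
      moreover have "undirected Q (q g, b) \<notin> TQ" "undirected Q (q h, q d) \<notin> TQ"
        using nontree hat_edge_in_tree[OF g(1) hat(1)] hat_edge_in_tree[OF h(1), of "q d"] d hat by auto
      ultimately have "((q h, q d), (q g, b)) \<in> flow_rel Q B TQ \<Phi>Q"
        using on by (simp add: flow_rel_def)
      then show ?thesis using hat d by (simp add: e rank_def)
    qed
  next
    case (iota a)
    have c: "c \<notin> Bhat" "inv_into A \<iota> c = a" using iota iota_not_Bhat inj_iota by auto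
    show ?thesis
    proof (cases "yQ (q g)" rule: rev_cases)
      case Nil
      then have "q g = \<one>\<^bsub>Q\<^esub>" using yQ_eq_Nil_iff g by simp
      then have gk: "g = \<iota> (kernel_part g)" using kernel_part[OF g(1)] by simp
      let ?k = "kernel_part g"
      have k: "?k \<in> carrier K" using kernel_part g by simp
      obtain z where z: "z \<in> lists A" "\<Phi>K (?k, a) = trace K ?k z"
        using K.flow_pathE[OF flow_functions(1) k iota(1)] by blast
      have "(h, d) \<in> set (trace G (\<iota> ?k) (map \<iota> z))"
        using on_path iota Nil z(2) by (simp add: labelG_iota flip: gk)
      then have "(h, d) \<in> map_prod \<iota> \<iota> ` set (\<Phi>K (?k, a))"
        using trace_map_iota_kernel[OF k z(1)] z(2) by simp
      then obtain k' a' where k': "(k', a') \<in> set (\<Phi>K (?k, a))" "h = \<iota> k'" "d = \<iota> a'" by auto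
      have arc: "k' \<in> carrier K" "a' \<in> A"
        using k'(1) K.trace_arcs[OF k z(1)] z(2) by auto
      then have d: "d \<notin> Bhat" "inv_into A \<iota> d = a'" using k'(3) iota_not_Bhat inj_iota by auto
      have "undirected K (?k, a) \<notin> TK" "undirected K (k', a') \<notin> TK"
        using nontree iota_edge_in_tree[OF k iota(1)] iota_edge_in_tree[OF arc] iota k' gk by auto
      then have "((k', a'), (?k, a)) \<in> flow_rel K A TK \<Phi>K"
        using k'(1) arc k iota by (simp add: flow_rel_def)
      moreover have "yQ (q h) = []" using arc k'(2) yQ_eq_Nil_iff by simp
      ultimately show ?thesis
        using c d Nil arc k'(2) by (simp add: e rank_def kernel_part_iota)
    next
      case (snoc u b)
      have qg: "q g \<in> carrier Q" using g by simp
      note s = yQ_snocD[OF qg snoc]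
      let ?w = "kernel_word (hat b \<otimes>\<^bsub>G\<^esub> \<iota> a \<otimes>\<^bsub>G\<^esub> inv\<^bsub>G\<^esub> hat b)"
      let ?g' = "g \<otimes>\<^bsub>G\<^esub> inv\<^bsub>G\<^esub> hat b" and ?g'' = "g \<otimes>\<^bsub>G\<^esub> inv\<^bsub>G\<^esub> hat b \<otimes>\<^bsub>G\<^esub> word_val G (map \<iota> ?w)"
      note w = conj_kernel_word[OF s(1) iota(1)]
      have closed: "?g' \<in> carrier G" "?g'' \<in> carrier G" using g s(1) w iota(1) by simp_all
      have q: "q ?g' = q g \<otimes>\<^bsub>Q\<^esub> inv\<^bsub>Q\<^esub> b" "q ?g'' = q g \<otimes>\<^bsub>Q\<^esub> inv\<^bsub>Q\<^esub> b"
        using g s(1) w iota(1) by (simp_all add: val_map_iota)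
      have "labelG g c = inv\<^bsub>G\<^esub> hat b # map \<iota> ?w @ [hat b]"
        using iota snoc by (simp add: labelG_iota conj_word_def)
      with on_path consider "(h, d) = (g, inv\<^bsub>G\<^esub> hat b)" | "(h, d) \<in> set (trace G ?g' (map \<iota> ?w))"
        | "(h, d) = (?g'', hat b)"
        using GC.trace_append[OF closed(1) map_iota_lists[OF w(1)]] by auto
      then show ?thesis
      proof cases
        case 1
        have "undirected Q (q g, inv\<^bsub>Q\<^esub> b) \<in> TQ"
          using qg s snoc by (simp add: in_TQ_iff)
        then have "undirected G (g, hat (inv\<^bsub>Q\<^esub> b)) \<in> TG" using hat_edge_in_tree g s(1) by simp
        then show ?thesis using 1 nontree s(1) by (simp add: hat_inv)
      next
        case 2
        then have *: "q h = q g \<otimes>\<^bsub>Q\<^esub> inv\<^bsub>Q\<^esub> b" "d \<in> \<iota> ` A"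
          using trace_map_iota[OF closed(1) w(1)] q by auto
        then have "d \<notin> Bhat" using iota_not_Bhat by auto
        moreover have "length (yQ (q h)) < length (yQ (q g))" using *(1) s(2) snoc by simp
        ultimately show ?thesis using c by (simp add: e rank_def)
      next
        case 3
        have "q g \<otimes>\<^bsub>Q\<^esub> inv\<^bsub>Q\<^esub> b \<otimes>\<^bsub>Q\<^esub> b = q g" using qg s(1) by (simp add: Q.m_assoc)
        then have "undirected Q (q ?g'', b) \<in> TQ"
          using qg s snoc q by (simp add: in_TQ_iff)
        then have "undirected G (?g'', hat b) \<in> TG" using hat_edge_in_tree[OF closed(2) s(1)] by simp
        then show ?thesis using 3 nontree by simp
      qed
    qed
  qed
qed

lemma flow_functionG: "flow_function G C TG \<Phi>G"
  unfolding flow_function_def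
proof (intro conjI ballI impI)
  show "maximal_tree G C TG" by (rule GC.tree_forms_maximal_tree[OF formsG])
next
  fix e assume "e \<in> arcs (cayley_graph G C)"
  then obtain g c where e: "e = (g, c)" "g \<in> carrier G" "c \<in> C" by (cases e) auto
  show "pre_digraph.awalk (cayley_graph G C) (tail (cayley_graph G C) e) (\<Phi>G e) (head (cayley_graph G C) e)"
    unfolding GC.awalk_cayley_iff using labelG_word[OF e(2,3)] e
    by (intro bexI[of _ "labelG g c"]) (simp_all add: \<Phi>G_def cayley_graph_def)
  assume tree: "undirected G e \<in> TG"
  from e(3) have "labelG g c = [c]"
  proof (cases rule: letter_cases)
    case (hat b)
    then have "undirected Q (q g, b) \<in> TQ" using tree hat_edge_in_tree e by simp
    then have "\<Phi>Q (q g, b) = [(q g, b)]"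
      using flow_functions(2) e hat unfolding flow_function_def by simp
    then show ?thesis using hat by (simp add: labelG_hat path_label_def lift_word_single)
  next
    case (iota a)
    then have one: "q g = \<one>\<^bsub>Q\<^esub>" using tree e iota_edge_in_treeD by simp
    then have gk: "g = \<iota> (kernel_part g)" using kernel_part[OF e(2)] by simp
    have k: "kernel_part g \<in> carrier K" using kernel_part e by simp
    then have "undirected K (kernel_part g, a) \<in> TK"
      using tree iota_edge_in_tree[OF k iota(1)] gk e iota by simp
    then have "\<Phi>K (kernel_part g, a) = [(kernel_part g, a)]"
      using flow_functions(1) k iota unfolding flow_function_def by simp
    then show ?thesis using iota one e yQ_eq_Nil_iff[of "q g"] by (simp add: labelG_iota path_label_def)
  qed
  then show "\<Phi>G e = [e]" by (simp add: \<Phi>G_def e)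
next
  have "wf ((flow_rel K A TK \<Phi>K)\<^sup>+)" "wf ((flow_rel Q B TQ \<Phi>Q)\<^sup>+)"
    using flow_functions unfolding flow_function_def by auto
  then have wf: "wf (flow_rel K A TK \<Phi>K)" "wf (flow_rel Q B TQ \<Phi>Q)"
    by (auto elim: wf_subset)
  have "wf (inv_image (less_than <*lex*> less_than <*lex*> flow_rel K A TK \<Phi>K <*lex*> flow_rel Q B TQ \<Phi>Q) rank)"
    by (intro wf_inv_image wf_lex_prod wf_less_than wf)
  then have "wf (flow_rel G C TG \<Phi>G)"
    by (rule wf_subset) (auto simp: inv_image_def dest: rank_decreases)
  then show wfG: "wf ((flow_rel G C TG \<Phi>G)\<^sup>+)" by (rule wf_trancl)
  show "irrefl ((flow_rel G C TG \<Phi>G)\<^sup>+)" using wfG by (auto simp: irrefl_def)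
qed (rule trans_trancl)

section \<open>The stacking map of the extension\<close>

text \<open>
  Since \<open>kernel_part g\<close> and \<open>q g\<close> vary independently, conditions on them separately describe products of
  languages.
\<close>

lemma yG_language:
  assumes "S \<subseteq> carrier K" "R \<subseteq> carrier Q"
  shows "yG ` {g \<in> carrier G. kernel_part g \<in> S \<and> q g \<in> R} = image_concat \<iota> hat (yK ` S) (yQ ` R)"
proof (intro equalityI subsetI)
  fix w assume "w \<in> image_concat \<iota> hat (yK ` S) (yQ ` R)"
  then obtain k p where kp: "k \<in> S" "p \<in> R" "w = map \<iota> (yK k) @ map hat (yQ p)"
    by (auto simp: image_concat_def)
  with assms have "k \<in> carrier K" "p \<in> carrier Q" by auto
  then show "w \<in> yG ` {g \<in> carrier G. kernel_part g \<in> S \<and> q g \<in> R}"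
    using kp by (intro image_eqI[of _ _ "\<iota> k \<otimes>\<^bsub>G\<^esub> sec p"]) (simp_all add: yG_eq kernel_part_eq)
qed (auto simp: yG_def image_concat_def)

lemma stacking_graphG:
  "stacking_graph G C TG \<Phi>G = {[yG g, [c], labelG g c] | g c. g \<in> carrier G \<and> c \<in> C}"
  unfolding stacking_graph_def \<Phi>G_def
  using GC.tree_forms_maximal_tree(2)[OF formsG] by auto metis+

lemma fiberG:
  "c \<in> C \<Longrightarrow> fiber (stacking_graph G C TG \<Phi>G) [[c], v] = yG ` {g \<in> carrier G. labelG g c = v}"
  by (auto simp: fiber_def stacking_graphG)

definition "boundK = (SOME k. \<forall>e\<in>arcs (cayley_graph K A). length (\<Phi>K e) \<le> k)"
definition "boundQ = (SOME k. \<forall>e\<in>arcs (cayley_graph Q B). length (\<Phi>Q e) \<le> k)"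

lemma boundK: "e \<in> arcs (cayley_graph K A) \<Longrightarrow> length (\<Phi>K e) \<le> boundK"
  unfolding boundK_def by (rule someI2_ex[where Q = "\<lambda>k. length (\<Phi>K e) \<le> k"]) (use flowK in \<open>auto simp: bounded_flow_function_def\<close>)

lemma boundQ: "e \<in> arcs (cayley_graph Q B) \<Longrightarrow> length (\<Phi>Q e) \<le> boundQ"
  unfolding boundQ_def by (rule someI2_ex[where Q = "\<lambda>k. length (\<Phi>Q e) \<le> k"]) (use flowQ in \<open>auto simp: bounded_flow_function_def\<close>)

abbreviation "wordsK \<equiv> {z \<in> lists A. length z \<le> boundK}"
abbreviation "wordsQ \<equiv> {z \<in> lists B. length z \<le> boundQ}"

lemma flow_labelK: "k \<in> carrier K \<Longrightarrow> a \<in> A \<Longrightarrow> path_label (\<Phi>K (k, a)) \<in> wordsK"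
  using K.flow_label[OF flow_functions(1), of k a] boundK[of "(k, a)"] by (simp add: path_label_def)

lemma flow_labelQ: "p \<in> carrier Q \<Longrightarrow> b \<in> B \<Longrightarrow> path_label (\<Phi>Q (p, b)) \<in> wordsQ"
  using Q.flow_label[OF flow_functions(2), of p b] boundQ[of "(p, b)"] by (simp add: path_label_def)

text \<open>
  A finite set that contains all path labels of the flow; boundedness of the two given flows enters
  through \<open>wordsK\<close> and \<open>wordsQ\<close>.
\<close>

definition labels :: "'g list set" where
  "labels = map \<iota> ` wordsK \<union> (\<lambda>(b, a). conj_word b a) ` (B \<times> A) \<union>
     (\<lambda>(b, z). lift_word b z) ` (B \<times> wordsQ)"

lemma finite_labels: "finite labels"
  unfolding labels_def
  by (intro finite_UnI finite_imageI finite_cartesian_product K.finite_bounded_words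
      Q.finite_bounded_words K.finite_letters Q.finite_letters)

lemma labelG_in_labels:
  assumes "g \<in> carrier G" "c \<in> C"
  shows "labelG g c \<in> labels"
  using assms(2)
proof (cases rule: letter_cases)
  case (iota a)
  have "path_label (\<Phi>K (kernel_part g, a)) \<in> wordsK" using flow_labelK kernel_part(1)[OF assms(1)] iota(1) .
  then show ?thesis
    using iota last_yQ[of "q g"] assms(1) unfolding labels_def by (simp add: labelG_iota image_iff) blast
next
  case (hat b)
  have "path_label (\<Phi>Q (q g, b)) \<in> wordsQ" by (rule flow_labelQ) (use assms(1) hat in simp_all)
  then show ?thesis
    unfolding hat(2) labelG_hat[OF hat(1)] labels_def using hat(1) by blast
qed

lemma bounded_flow_functionG: "bounded_flow_function G C TG \<Phi>G"
proof -
  obtain k where k: "\<forall>v\<in>labels. length v \<le> k"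
    using finite_labels finite_nat_set_iff_bounded_le[of "length ` labels"] by auto
  have "length (\<Phi>G e) \<le> k" if "e \<in> arcs (cayley_graph G C)" for e
  proof -
    obtain g c where e: "e = (g, c)" by (cases e)
    with that have "labelG g c \<in> labels" by (intro labelG_in_labels) (simp_all add: cayley_graph_def)
    with k show ?thesis by (simp add: e \<Phi>G_def)
  qed
  with flow_functionG show ?thesis unfolding bounded_flow_function_def by blast
qed

lemma stacking_graphG_tails:
  "us \<in> stacking_graph G C TG \<Phi>G \<Longrightarrow> tl us \<in> (\<lambda>(c, v). [[c], v]) ` (C \<times> labels)"
proof -
  assume "us \<in> stacking_graph G C TG \<Phi>G"
  then obtain g c where "us = [yG g, [c], labelG g c]" "g \<in> carrier G" "c \<in> C"
    unfolding stacking_graphG by blast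
  then show ?thesis using labelG_in_labels[of g c] by (intro image_eqI[of _ _ "(c, labelG g c)"]) simp_all
qed

lemma finite_tails: "finite ((\<lambda>(c, v). [[c], v]) ` (C \<times> labels))"
  using finite_labels GC.finite_letters by (intro finite_imageI finite_cartesian_product)

lemma stacking_graphG_word_tuples: "stacking_graph G C TG \<Phi>G \<subseteq> word_tuples 3 C"
proof
  fix us assume "us \<in> stacking_graph G C TG \<Phi>G"
  then obtain g c where us: "us = [yG g, [c], labelG g c]" "g \<in> carrier G" "c \<in> C"
    by (auto simp: stacking_graphG)
  then show "us \<in> word_tuples 3 C"
    using labelG_word(1)[of g c] formsG unfolding word_tuples_def tree_forms_def by simp
qed

abbreviation "NK \<equiv> yK ` carrier K"
abbreviation "NQ \<equiv> yQ ` carrier Q"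

lemma NK_eq: "NK = (if A = {} then {[]}
    else \<Union>v\<in>wordsK. fiber (stacking_graph K A TK \<Phi>K) [[SOME a. a \<in> A], v])"
  by (rule K.normal_forms_UN_fibers[OF formsK flow_functions(1)]) (rule boundK)

lemma NQ_eq: "NQ = (if B = {} then {[]}
    else \<Union>v\<in>wordsQ. fiber (stacking_graph Q B TQ \<Phi>Q) [[SOME b. b \<in> B], v])"
  by (rule Q.normal_forms_UN_fibers[OF formsQ flow_functions(2)]) (rule boundQ)

text \<open>
  The two unions correspond to the vertices inside and outside \<open>\<iota> K\<close>. Inside, the label depends on the
  flow of \<open>K\<close>; outside, only on the last letter of the normal form in \<open>Q\<close>.
\<close>

lemma fiberG_iota:
  assumes a: "a \<in> A"
  shows "fiber (stacking_graph G C TG \<Phi>G) [[\<iota> a], v] =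
    (\<Union>z\<in>{z \<in> wordsK. map \<iota> z = v}. image_concat \<iota> hat (fiber (stacking_graph K A TK \<Phi>K) [[a], z]) {[]}) \<union>
    (\<Union>b\<in>{b \<in> B. conj_word b a = v}. image_concat \<iota> hat NK {w \<in> NQ. w \<noteq> [] \<and> last w = b})"
proof -
  let ?S = "\<lambda>z. {k \<in> carrier K. path_label (\<Phi>K (k, a)) = z}"
  let ?R = "\<lambda>b. {p \<in> carrier Q. yQ p \<noteq> [] \<and> last (yQ p) = b}"
  have "{g \<in> carrier G. labelG g (\<iota> a) = v} =
    (\<Union>z\<in>{z \<in> wordsK. map \<iota> z = v}. {g \<in> carrier G. kernel_part g \<in> ?S z \<and> q g \<in> {\<one>\<^bsub>Q\<^esub>}}) \<union>
    (\<Union>b\<in>{b \<in> B. conj_word b a = v}. {g \<in> carrier G. kernel_part g \<in> carrier K \<and> q g \<in> ?R b})" (is "?l = ?r1 \<union> ?r2")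
  proof (intro equalityI subsetI)
    fix g assume "g \<in> ?l"
    then have g: "g \<in> carrier G" "labelG g (\<iota> a) = v" by auto
    have k: "kernel_part g \<in> carrier K" and p: "q g \<in> carrier Q" using kernel_part g by auto
    show "g \<in> ?r1 \<union> ?r2"
    proof (cases "yQ (q g) = []")
      case True
      then have "map \<iota> (path_label (\<Phi>K (kernel_part g, a))) = v" using g(2) a by (simp add: labelG_iota)
      moreover have "q g = \<one>\<^bsub>Q\<^esub>" using True yQ_eq_Nil_iff[OF p] by simp
      ultimately show ?thesis using g(1) k flow_labelK[OF k a] by blast
    next
      case False
      then have "conj_word (last (yQ (q g))) a = v" using g(2) a by (simp add: labelG_iota)
      then show ?thesis using g(1) k p False last_yQ[OF p False] by blast
    qed
  next
    fix g assume "g \<in> ?r1 \<union> ?r2"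
    then show "g \<in> ?l" using a by (auto simp: labelG_iota yQ_eq_Nil_iff)
  qed
  then have "fiber (stacking_graph G C TG \<Phi>G) [[\<iota> a], v] =
    (\<Union>z\<in>{z \<in> wordsK. map \<iota> z = v}. yG ` {g \<in> carrier G. kernel_part g \<in> ?S z \<and> q g \<in> {\<one>\<^bsub>Q\<^esub>}}) \<union>
    (\<Union>b\<in>{b \<in> B. conj_word b a = v}. yG ` {g \<in> carrier G. kernel_part g \<in> carrier K \<and> q g \<in> ?R b})"
    using a by (simp only: fiberG UnI1 imageI image_Un image_UN)
  also have "(\<lambda>z. yG ` {g \<in> carrier G. kernel_part g \<in> ?S z \<and> q g \<in> {\<one>\<^bsub>Q\<^esub>}}) =
      (\<lambda>z. image_concat \<iota> hat (fiber (stacking_graph K A TK \<Phi>K) [[a], z]) {[]})"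
  proof
    fix z
    have "fiber (stacking_graph K A TK \<Phi>K) [[a], z] = yK ` ?S z"
      using a by (simp add: K.fiber_stacking_graph)
    moreover have "yQ ` {\<one>\<^bsub>Q\<^esub>} = {[]}" using yQ_eq_Nil_iff by simp
    moreover have "yG ` {g \<in> carrier G. kernel_part g \<in> ?S z \<and> q g \<in> {\<one>\<^bsub>Q\<^esub>}} =
        image_concat \<iota> hat (yK ` ?S z) (yQ ` {\<one>\<^bsub>Q\<^esub>})"
      by (rule yG_language) auto
    ultimately show "yG ` {g \<in> carrier G. kernel_part g \<in> ?S z \<and> q g \<in> {\<one>\<^bsub>Q\<^esub>}} =
      image_concat \<iota> hat (fiber (stacking_graph K A TK \<Phi>K) [[a], z]) {[]}" by simp
  qed
  also have "(\<lambda>b. yG ` {g \<in> carrier G. kernel_part g \<in> carrier K \<and> q g \<in> ?R b}) =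
      (\<lambda>b. image_concat \<iota> hat NK {w \<in> NQ. w \<noteq> [] \<and> last w = b})"
  proof
    fix b
    have "{w \<in> NQ. w \<noteq> [] \<and> last w = b} = yQ ` ?R b" by auto
    moreover have "yG ` {g \<in> carrier G. kernel_part g \<in> carrier K \<and> q g \<in> ?R b} = image_concat \<iota> hat NK (yQ ` ?R b)"
      by (rule yG_language) auto
    ultimately show "yG ` {g \<in> carrier G. kernel_part g \<in> carrier K \<and> q g \<in> ?R b} =
      image_concat \<iota> hat NK {w \<in> NQ. w \<noteq> [] \<and> last w = b}" by simp
  qed
  finally show ?thesis .
qed

lemma fiberG_hat:
  assumes b: "b \<in> B"
  shows "fiber (stacking_graph G C TG \<Phi>G) [[hat b], v] =
    (\<Union>z\<in>{z \<in> wordsQ. lift_word b z = v}. image_concat \<iota> hat NK (fiber (stacking_graph Q B TQ \<Phi>Q) [[b], z]))"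
proof -
  let ?R = "\<lambda>z. {p \<in> carrier Q. path_label (\<Phi>Q (p, b)) = z}"
  have "{g \<in> carrier G. labelG g (hat b) = v} =
    (\<Union>z\<in>{z \<in> wordsQ. lift_word b z = v}. {g \<in> carrier G. kernel_part g \<in> carrier K \<and> q g \<in> ?R z})"
    using kernel_part(1) flow_labelQ[OF _ b] by (auto simp: labelG_hat[OF b])
  then have "fiber (stacking_graph G C TG \<Phi>G) [[hat b], v] =
    (\<Union>z\<in>{z \<in> wordsQ. lift_word b z = v}. yG ` {g \<in> carrier G. kernel_part g \<in> carrier K \<and> q g \<in> ?R z})"
    using b by (simp only: fiberG UnI2 hat_in image_UN)
  also have "(\<lambda>z. yG ` {g \<in> carrier G. kernel_part g \<in> carrier K \<and> q g \<in> ?R z}) =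
      (\<lambda>z. image_concat \<iota> hat NK (fiber (stacking_graph Q B TQ \<Phi>Q) [[b], z]))"
  proof
    fix z
    have "fiber (stacking_graph Q B TQ \<Phi>Q) [[b], z] = yQ ` ?R z"
      using b by (simp add: Q.fiber_stacking_graph)
    moreover have "yG ` {g \<in> carrier G. kernel_part g \<in> carrier K \<and> q g \<in> ?R z} = image_concat \<iota> hat NK (yQ ` ?R z)"
      by (rule yG_language) auto
    ultimately show "yG ` {g \<in> carrier G. kernel_part g \<in> carrier K \<and> q g \<in> ?R z} =
      image_concat \<iota> hat NK (fiber (stacking_graph Q B TQ \<Phi>Q) [[b], z])" by simp
  qed
  finally show ?thesis .
qed

lemma finite_flow_words:
  "finite {z \<in> lists A. length z \<le> boundK \<and> R z}" "finite {z \<in> lists B. length z \<le> boundQ \<and> S z}"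
  by (rule finite_subset[OF _ K.finite_bounded_words[of boundK]] finite_subset[OF _ Q.finite_bounded_words[of boundQ]];
      blast)+

text \<open>
  Used with \<open>P\<close>, \<open>PK\<close> and \<open>PQ\<close> expressing regularity and decidability over the alphabets of the three
  groups.
\<close>

lemma fibers_closed:
  assumes union: "\<And>\<L>. finite \<L> \<Longrightarrow> (\<And>L. L \<in> \<L> \<Longrightarrow> P L) \<Longrightarrow> P (\<Union>\<L>)"
    and concat: "\<And>U W. PK U \<Longrightarrow> PQ W \<Longrightarrow> P (image_concat \<iota> hat U W)"
    and K: "PK NK" "\<And>a z. PK (fiber (stacking_graph K A TK \<Phi>K) [[a], z])"
    and Q: "PQ {[]}" "\<And>b. b \<in> B \<Longrightarrow> PQ {w \<in> NQ. w \<noteq> [] \<and> last w = b}"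
      "\<And>b z. PQ (fiber (stacking_graph Q B TQ \<Phi>Q) [[b], z])"
    and c: "c \<in> C"
  shows "P (fiber (stacking_graph G C TG \<Phi>G) [[c], v])"
  using c
proof (cases rule: letter_cases)
  case (iota a)
  show ?thesis
    unfolding iota(2) fiberG_iota[OF iota(1)] Sup_union_distrib[symmetric]
    by (rule union) (auto intro!: concat K Q finite_UnI finite_imageI finite_flow_words)
next
  case (hat b)
  show ?thesis
    unfolding hat(2) fiberG_hat[OF hat(1)]
    by (rule union) (auto intro!: concat K Q finite_imageI finite_flow_words)
qed

lemma synchronously_regularG:
  assumes K: "synchronously_regular 3 A (stacking_graph K A TK \<Phi>K)"
    and Q: "synchronously_regular 3 B (stacking_graph Q B TQ \<Phi>Q)"
  shows "synchronously_regular 3 C (stacking_graph G C TG \<Phi>G)"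
proof -
  have fiberK: "regular_language A (fiber (stacking_graph K A TK \<Phi>K) vs)" for vs
    using regular_fiber_of_synchronously_regular[of A 2] K by simp
  have fiberQ: "regular_language B (fiber (stacking_graph Q B TQ \<Phi>Q) vs)" for vs
    using regular_fiber_of_synchronously_regular[of B 2] Q by simp
  have NK: "regular_language A NK"
    using regular_language_UN[OF K.finite_bounded_words fiberK]
    unfolding NK_eq
    by (simp add: regular_language_Nil)
  have NQ: "regular_language B NQ"
    using regular_language_UN[OF Q.finite_bounded_words fiberQ]
    unfolding NQ_eq
    by (simp add: regular_language_Nil)
  have last: "regular_language B {w \<in> NQ. w \<noteq> [] \<and> last w = b}" if "b \<in> B" for b
  proof -
    have "{w \<in> NQ. w \<noteq> [] \<and> last w = b} = NQ \<inter> {w \<in> lists B. w \<noteq> [] \<and> last w = b}"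
      using yQ(1) by auto
    then show ?thesis using regular_language_Int[OF NQ regular_language_last[OF that]] by simp
  qed
  have "regular_language C (fiber (stacking_graph G C TG \<Phi>G) [[c], v])" if "c \<in> C" for c v
  proof (rule fibers_closed[where PK = "regular_language A" and PQ = "regular_language B"])
    fix \<L> :: "'g list set set"
    assume "finite \<L>" "\<And>L. L \<in> \<L> \<Longrightarrow> regular_language C L"
    then show "regular_language C (\<Union>\<L>)" using regular_language_UN[of \<L> C "\<lambda>L. L"] by simp
  next
    fix U W assume "regular_language A U" "regular_language B W"
    from regular_language_image_concat[OF this inj_iota inj_hat disjoint_letters]
    show "regular_language C (image_concat \<iota> hat U W)" by (simp only: hat_image)
  qed (use that in \<open>auto intro: NK fiberK fiberQ last regular_language_Nil\<close>)
  then have "synchronously_regular (Suc 2) C (stacking_graph G C TG \<Phi>G)"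
    using stacking_graphG_word_tuples
    by (intro synchronously_regular_of_fibers[OF GC.finite_letters finite_tails _ stacking_graphG_tails])
      auto
  then show ?thesis by simp
qed

lemma decidable_setG:
  assumes K: "decidable_set 3 A (stacking_graph K A TK \<Phi>K)"
    and Q: "decidable_set 3 B (stacking_graph Q B TQ \<Phi>Q)"
  shows "decidable_set 3 C (stacking_graph G C TG \<Phi>G)"
proof -
  obtain cK :: "'k \<Rightarrow> nat" where cK: "inj_on cK A" "stacking_graph K A TK \<Phi>K \<subseteq> word_tuples 3 A"
    "recursive_relation 3 (map (\<lambda>u. list_encode (map cK u)) ` stacking_graph K A TK \<Phi>K)"
    using K by (auto simp: decidable_set_def)
  obtain cQ :: "'q \<Rightarrow> nat" where cQ: "inj_on cQ B" "stacking_graph Q B TQ \<Phi>Q \<subseteq> word_tuples 3 B"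
    "recursive_relation 3 (map (\<lambda>u. list_encode (map cQ u)) ` stacking_graph Q B TQ \<Phi>Q)"
    using Q by (auto simp: decidable_set_def)
  \<comment> \<open>even codes for \<open>\<iota> A\<close> and odd codes for \<open>Bhat\<close>, as \<open>decidable_image_concat\<close> expects\<close>
  define cG where "cG x = (if x \<in> Bhat then Suc (2 * cQ (q x)) else 2 * cK (inv_into A \<iota> x))" for x
  have cG: "a \<in> A \<Longrightarrow> cG (\<iota> a) = 2 * cK a" "b \<in> B \<Longrightarrow> cG (hat b) = Suc (2 * cQ b)" for a b
    by (simp_all add: cG_def iota_not_Bhat inj_iota)
  have inj: "inj_on cG C"
  proof (rule inj_onI)
    fix x y assume x: "x \<in> C" and y: "y \<in> C" and eq: "cG x = cG y"
    have parity: "2 * m \<noteq> Suc (2 * n)" "Suc (2 * n) \<noteq> 2 * m" for m n :: nat by presburger+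
    from x show "x = y"
    proof (cases rule: letter_cases)
      case (iota a)
      note x = this
      from y show ?thesis
      proof (cases rule: letter_cases)
        case (iota a')
        then show ?thesis using x eq cK(1) by (simp add: cG inj_on_eq_iff)
      qed (use x eq parity in \<open>simp add: cG\<close>)
    next
      case (hat b)
      note x = this
      from y show ?thesis
      proof (cases rule: letter_cases)
        case (hat b')
        then show ?thesis using x eq cQ(1) by (simp add: cG inj_on_eq_iff)
      qed (use x eq parity in \<open>simp add: cG\<close>)
    qed
  qed
  let ?PK = "\<lambda>L. decidable_language cK L \<and> L \<subseteq> lists A"
  let ?PQ = "\<lambda>L. decidable_language cQ L \<and> L \<subseteq> lists B"
  have fiberK: "decidable_language cK (fiber (stacking_graph K A TK \<Phi>K) [v, w])" for v w
    by (rule decidable_fiber[OF cK])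
  have fiberQ: "decidable_language cQ (fiber (stacking_graph Q B TQ \<Phi>Q) [v, w])" for v w
    by (rule decidable_fiber[OF cQ])
  have subK: "fiber (stacking_graph K A TK \<Phi>K) vs \<subseteq> lists A" for vs
    by (rule fiber_subset[OF cK(2)])
  have subQ: "fiber (stacking_graph Q B TQ \<Phi>Q) vs \<subseteq> lists B" for vs
    by (rule fiber_subset[OF cQ(2)])
  have NK: "decidable_language cK NK"
    using decidable_language_UN[OF K.finite_bounded_words fiberK]
    unfolding NK_eq
    by (simp add: decidable_language_Nil)
  have NQ: "decidable_language cQ NQ"
    using decidable_language_UN[OF Q.finite_bounded_words fiberQ]
    unfolding NQ_eq
    by (simp add: decidable_language_Nil)
  have NK_sub: "NK \<subseteq> lists A" and NQ_sub: "NQ \<subseteq> lists B" using yK(1) yQ(1) by blast+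
  have "decidable_language cG (fiber (stacking_graph G C TG \<Phi>G) [[c], v])" if "c \<in> C" for c v
  proof (rule fibers_closed[where PK = ?PK and PQ = ?PQ])
    fix \<L> :: "'g list set set"
    assume "finite \<L>" "\<And>L. L \<in> \<L> \<Longrightarrow> decidable_language cG L"
    then show "decidable_language cG (\<Union>\<L>)" using decidable_language_UN[of \<L> cG "\<lambda>L. L"] by simp
  next
    fix U W assume "?PK U" "?PQ W"
    then show "decidable_language cG (image_concat \<iota> hat U W)"
      by (elim conjE) (rule decidable_language_image_concat[where c = cG, OF _ _ _ _ cG])
  next
    fix b assume "b \<in> B"
    then show "?PQ {w \<in> NQ. w \<noteq> [] \<and> last w = b}"
      using decidable_language_last[OF cQ(1) NQ_sub NQ] NQ_sub by blast
  qed (use that NK NK_sub fiberK subK fiberQ subQ decidable_language_Nil in auto)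
  then have "recursive_relation 3 (map (\<lambda>u. list_encode (map cG u)) ` stacking_graph G C TG \<Phi>G)"
    using stacking_graphG_word_tuples
    by (intro recursive_relation_of_fibers[OF finite_tails _ stacking_graphG_tails])
      (auto simp: word_tuples_def)
  then show ?thesis
    unfolding decidable_set_def using stacking_graphG_word_tuples inj GC.finite_letters by blast
qed

end

theorem theorem3p3:
  fixes K :: "('k, 'x) monoid_scheme"
    and G :: "('g, 'y) monoid_scheme"
    and Q :: "('q, 'z) monoid_scheme"
    and \<iota> :: "'k \<Rightarrow> 'g" and q :: "'g \<Rightarrow> 'q"
    and A :: "'k set" and B :: "'q set" and Bhat :: "'g set"
  assumes "group K" and "group G" and "group Q"
    and "\<iota> \<in> hom K G" and "q \<in> hom G Q"
    and "inj_on \<iota> (carrier K)"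
    and "\<iota> ` carrier K = kernel G Q q"
    and "q ` carrier G = carrier Q"
    and "generating_set K A" and "generating_set Q B"
    and "Bhat \<subseteq> carrier G" and "\<forall>b\<in>Bhat. inv\<^bsub>G\<^esub> b \<in> Bhat"
    and "bij_betw q Bhat B"
  shows "generating_set G (\<iota> ` A \<union> Bhat) \<and>
    (autostackable K A \<and> autostackable Q B \<longrightarrow> autostackable G (\<iota> ` A \<union> Bhat)) \<and>
    (stackable K A \<and> stackable Q B \<longrightarrow> stackable G (\<iota> ` A \<union> Bhat)) \<and>
    (algorithmically_stackable K A \<and> algorithmically_stackable Q B \<longrightarrow>
       algorithmically_stackable G (\<iota> ` A \<union> Bhat))"
proof -
  interpret K: group K by fact
  interpret G: group G by fact
  interpret Q: group Q by fact
  interpret E: group_extension K A Q B G \<iota> q Bhat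
    by unfold_locales (fact assms)+
  have flows: "extension_flows K A Q B G \<iota> q Bhat TK \<Phi>K TQ \<Phi>Q"
    if "bounded_flow_function K A TK \<Phi>K" "bounded_flow_function Q B TQ \<Phi>Q" for TK \<Phi>K TQ \<Phi>Q
    by unfold_locales (fact that)+
  show ?thesis
  proof (intro conjI impI)
    show "generating_set G (\<iota> ` A \<union> Bhat)" by (rule E.generating_set_extension)
  next
    assume "autostackable K A \<and> autostackable Q B"
    then obtain TK \<Phi>K TQ \<Phi>Q where
      b: "bounded_flow_function K A TK \<Phi>K" "bounded_flow_function Q B TQ \<Phi>Q" and
      r: "synchronously_regular 3 A (stacking_graph K A TK \<Phi>K)"
        "synchronously_regular 3 B (stacking_graph Q B TQ \<Phi>Q)"
      unfolding autostackable_def by blast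
    interpret F: extension_flows K A Q B G \<iota> q Bhat TK \<Phi>K TQ \<Phi>Q by (rule flows[OF b])
    show "autostackable G (\<iota> ` A \<union> Bhat)"
      unfolding autostackable_def using F.bounded_flow_functionG F.synchronously_regularG[OF r] by blast
  next
    assume "stackable K A \<and> stackable Q B"
    then obtain TK \<Phi>K TQ \<Phi>Q where
      b: "bounded_flow_function K A TK \<Phi>K" "bounded_flow_function Q B TQ \<Phi>Q"
      unfolding stackable_def by blast
    interpret F: extension_flows K A Q B G \<iota> q Bhat TK \<Phi>K TQ \<Phi>Q by (rule flows[OF b])
    show "stackable G (\<iota> ` A \<union> Bhat)"
      unfolding stackable_def using F.bounded_flow_functionG by blast
  next
    assume "algorithmically_stackable K A \<and> algorithmically_stackable Q B"
    then obtain TK \<Phi>K TQ \<Phi>Q where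
      b: "bounded_flow_function K A TK \<Phi>K" "bounded_flow_function Q B TQ \<Phi>Q" and
      d: "decidable_set 3 A (stacking_graph K A TK \<Phi>K)"
        "decidable_set 3 B (stacking_graph Q B TQ \<Phi>Q)"
      unfolding algorithmically_stackable_def by blast
    interpret F: extension_flows K A Q B G \<iota> q Bhat TK \<Phi>K TQ \<Phi>Q by (rule flows[OF b])
    show "algorithmically_stackable G (\<iota> ` A \<union> Bhat)"
      unfolding algorithmically_stackable_def using F.bounded_flow_functionG F.decidable_setG[OF d] by blast
  qed
qed

end
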